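(* Let $d=3$, $\Omega=(0,1)^3$, $p\in[2,+\infty)$, and let $$K_{2,12}=\{\operatorname{diag}(0,0,0),\ \operatorname{diag}(1,0,0),\ \operatorname{diag}(\tfrac12,1,-1)\},\qquad K_{2,21}=\{\operatorname{diag}(0,0,0),\ \operatorname{diag}(1,-1,0),\ \operatorname{diag}(\tfrac12,-\tfrac12,1)\}.$$ For $K$ equal to one of these sets and $F\in\mathbb{R}^{3\times 3}_{\rm sym}$, let $E^{(p)}_{\epsilon,3}(\mathcal{A}_F^{\rm dir})$ be the minimal singularly perturbed energy for the wells $K$ with Dirichlet datum $F$ (defined in the context). (i) (First order laminates.) Let $K=K_{2,12}$ and $F\in K_{2,12}^{(1)}\setminus K_{2,12}$. Then there exists a constant $c>0$ such that for every $\epsilon\in(0,1)$ $$c\,\epsilon^{2p/(2p+1)}\le E^{(p)}_{\epsilon,3}(\mathcal{A}_F^{\rm dir}).$$ Let $K=K_{2,21}$ and $F\in K_{2,21}^{(1)}\setminus K_{2,21}$. Then there exists a constant $c>0$ such that for every $\epsilon\in(0,1)$ $$c\,\epsilon^{2p/(2p+2)}\le E^{(p)}_{\epsilon,3}(\mathcal{A}_F^{\rm dir}).$$ (ii) (Second order laminates.) Let $K$ be either $K_{2,12}$ or $K_{2,21}$ and let $F\in K^{(2)}\setminus K^{(1)}$. Then there exists a constant $c>0$ such that for every $\epsilon\in(0,1)$ $$c\,\epsilon^{2p/(2p+3)}\le E^{(p)}_{\epsilon,3}(\mathcal{A}_F^{\rm dir}).$$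
   Context: **Energy.** $\operatorname{sym}(M)=\frac12(M+M^T)$. Let $K=\{A_0,\dots,A_m\}\subset\mathbb{R}^{d\times d}_{\rm sym}$ be a set of $m+1$ matrices (wells), here $d=3$, $m=2$. A function $\chi:\Omega\to K$ is written $\chi=\sum_{j=0}^m\chi_jA_j$ with $\chi_j:\Omega\to\{0,1\}$, $\sum_{j=0}^m\chi_j=1$. Define $$E^{(p)}_{\epsilon,m+1}(u;\chi)=\int_\Omega|\operatorname{sym}(\nabla u)-\chi|^p\,dx+\epsilon\sum_{j=1}^m\|D\chi_j\|_{TV(\Omega)}.$$ For $F\in\mathbb{R}^{d\times d}_{\rm sym}$ let $$\mathcal{A}_F^{\rm dir}=\{u\in W^{1,p}_{\rm loc}(\mathbb{R}^d;\mathbb{R}^d): u(x)=Fx+b\text{ in }\mathbb{R}^d\setminus\Omega\text{ for some }b\in\mathbb{R}^d\},$$ $$E^{(p)}_{\epsilon,m+1}(\mathcal{A}_F^{\rm dir})=\inf_{\chi\in BV(\Omega;K)}\ \inf_{u\in\mathcal{A}_F^{\rm dir}}E^{(p)}_{\epsilon,m+1}(u;\chi).$$ **Laminates.** Two distinct matrices $A,B\in\mathbb{R}^{d\times d}_{\rm sym}$ are compatible if $A-B=a\odot b:=\frac12(a\otimes b+b\otimes a)$ for some $a,b\in\mathbb{R}^d\setminus\{0\}$. For $K\subset\mathbb{R}^{d\times d}_{\rm sym}$ set $K^{(0)}=K$ and, for $j\ge1$, $$K^{(j)}=K^{(j-1)}\cup\{\lambda B_1+(1-\lambda)B_2:\ \lambda\in(0,1),\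 B_1,B_2\in K^{(j-1)}\text{ compatible}\}.$$ *)

theory Defs
  imports "HOL-Analysis.Analysis"
begin

section \<open>Matrices\<close>

definition sym_part :: "real^'n^'n \<Rightarrow> real^'n^'n" where
  "sym_part M = (1/2) *\<^sub>R (M + transpose M)"

definition outer :: "real^'n \<Rightarrow> real^'n \<Rightarrow> real^'n^'n" where
  "outer a b = (\<chi> i j. a $ i * b $ j)"

definition sym_outer :: "real^'n \<Rightarrow> real^'n \<Rightarrow> real^'n^'n" where
  "sym_outer a b = (1/2) *\<^sub>R (outer a b + outer b a)"

definition diag :: "real^'n \<Rightarrow> real^'n^'n" where
  "diag v = (\<chi> i j. if i = j then v $ i else 0)"

section \<open>Laminates\<close>

definition compatible :: "real^'n^'n \<Rightarrow> real^'n^'n \<Rightarrow> bool" where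
  "compatible A B \<longleftrightarrow> A \<noteq> B \<and> (\<exists>a b. a \<noteq> 0 \<and> b \<noteq> 0 \<and> A - B = sym_outer a b)"

primrec laminates :: "(real^'n^'n) set \<Rightarrow> nat \<Rightarrow> (real^'n^'n) set" where
  "laminates K 0 = K"
| "laminates K (Suc j) = laminates K j \<union>
     {t *\<^sub>R B1 + (1 - t) *\<^sub>R B2 | t B1 B2.
        0 < t \<and> t < 1 \<and> B1 \<in> laminates K j \<and> B2 \<in> laminates K j \<and> compatible B1 B2}"

section \<open>Test functions\<close>

definition partial_deriv :: "'n \<Rightarrow> (real^'n \<Rightarrow> real) \<Rightarrow> real^'n \<Rightarrow> real" where
  "partial_deriv i f x = frechet_derivative f (at x) (axis i 1)"

primrec Ck :: "nat \<Rightarrow> (real^'n \<Rightarrow> real) \<Rightarrow> bool" where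
  "Ck 0 f \<longleftrightarrow> continuous_on UNIV f"
| "Ck (Suc k) f \<longleftrightarrow> (\<forall>x. f differentiable (at x)) \<and> (\<forall>i. Ck k (partial_deriv i f))"

definition supp_compact_in :: "(real^'n \<Rightarrow> 'b::real_normed_vector) \<Rightarrow> (real^'n) set \<Rightarrow> bool" where
  "supp_compact_in f \<Omega> \<longleftrightarrow> compact (closure {x. f x \<noteq> 0}) \<and> closure {x. f x \<noteq> 0} \<subseteq> \<Omega>"

text \<open>Elements of \<open>C\<^sub>c\<^sup>\<infinity>(\<real>\<^sup>n)\<close>.\<close>

definition test_fun :: "(real^'n \<Rightarrow> real) \<Rightarrow> bool" where
  "test_fun \<phi> \<longleftrightarrow> (\<forall>k. Ck k \<phi>) \<and> supp_compact_in \<phi> UNIV"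

text \<open>Elements of \<open>C\<^sub>c\<^sup>1(\<Omega>;\<real>\<^sup>n)\<close>, extended by zero to the whole space.\<close>

definition test_field :: "(real^'n) set \<Rightarrow> (real^'n \<Rightarrow> real^'n) \<Rightarrow> bool" where
  "test_field \<Omega> \<phi> \<longleftrightarrow> (\<forall>i. Ck 1 (\<lambda>x. \<phi> x $ i)) \<and> supp_compact_in \<phi> \<Omega>"

definition divergence :: "(real^'n \<Rightarrow> real^'n) \<Rightarrow> real^'n \<Rightarrow> real" where
  "divergence \<phi> x = (\<Sum>i\<in>UNIV. partial_deriv i (\<lambda>y. \<phi> y $ i) x)"

section \<open>Functions of bounded variation\<close>

text \<open>The variation of the measure \<open>Df\<close> on \<open>\<Omega>\<close>, in its dual form. It is meaningful for \<open>f\<close>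
  integrable on \<open>\<Omega>\<close>; since \<open>\<phi> = 0\<close> is admissible, the truncation of negative values by
  \<^const>\<open>ennreal\<close> is harmless.\<close>

definition total_variation :: "(real^'n) set \<Rightarrow> (real^'n \<Rightarrow> real) \<Rightarrow> ennreal" where
  "total_variation \<Omega> f =
     (SUP \<phi>\<in>{\<phi>. test_field \<Omega> \<phi> \<and> (\<forall>x. norm (\<phi> x) \<le> 1)}.
        ennreal (LINT x:\<Omega>|lebesgue. f x * divergence \<phi> x))"

text \<open>\<open>BV(\<Omega>;K)\<close>. Functions on \<open>\<Omega>\<close> are functions on the whole space whose values outside \<open>\<Omega>\<close>
  are irrelevant.\<close>

definition BV_into :: "(real^'n) set \<Rightarrow> (real^'n^'n) set \<Rightarrow> (real^'n \<Rightarrow> real^'n^'n) set" where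
  "BV_into \<Omega> K = {X. (\<forall>x\<in>\<Omega>. X x \<in> K) \<and> set_integrable lebesgue \<Omega> X \<and>
     (\<forall>i j. total_variation \<Omega> (\<lambda>x. X x $ i $ j) < \<infinity>)}"

section \<open>Sobolev functions\<close>

definition L1_loc :: "(real^'n \<Rightarrow> 'b::euclidean_space) \<Rightarrow> bool" where
  "L1_loc f \<longleftrightarrow> (\<forall>C. compact C \<longrightarrow> set_integrable lebesgue C f)"

definition Lp_loc :: "real \<Rightarrow> (real^'n \<Rightarrow> 'b::euclidean_space) \<Rightarrow> bool" where
  "Lp_loc p f \<longleftrightarrow> f \<in> borel_measurable lebesgue \<and>
     (\<forall>C. compact C \<longrightarrow> set_integrable lebesgue C (\<lambda>x. norm (f x) powr p))"

text \<open>The entry \<open>G x $ i $ j\<close> is the weak derivative \<open>\<partial>\<^sub>j u\<^sub>i\<close>.\<close>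

definition has_weak_gradient :: "(real^'n \<Rightarrow> real^'n) \<Rightarrow> (real^'n \<Rightarrow> real^'n^'n) \<Rightarrow> bool" where
  "has_weak_gradient u G \<longleftrightarrow> L1_loc u \<and> L1_loc G \<and>
     (\<forall>\<phi> i j. test_fun \<phi> \<longrightarrow>
        (LINT x|lebesgue. u x $ i * partial_deriv j \<phi> x) = - (LINT x|lebesgue. G x $ i $ j * \<phi> x))"

text \<open>The weak gradient is unique up to null sets; an arbitrary representative is chosen.\<close>

definition weak_gradient :: "(real^'n \<Rightarrow> real^'n) \<Rightarrow> real^'n \<Rightarrow> real^'n^'n" where
  "weak_gradient u = (SOME G. has_weak_gradient u G)"

definition W1p_loc :: "real \<Rightarrow> (real^'n \<Rightarrow> real^'n) set" where
  "W1p_loc p = {u. Lp_loc p u \<and> (\<exists>G. has_weak_gradient u G \<and> Lp_loc p G)}"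

section \<open>The energy\<close>

text \<open>The wells are a list \<open>[A\<^sub>0, \<dots>, A\<^sub>m]\<close> of distinct matrices. For \<open>X\<close> with values in this list, the
  only decomposition \<open>X = \<Sum>\<^sub>j X\<^sub>j A\<^sub>j\<close> with \<open>X\<^sub>j(x) \<in> {0,1}\<close> and \<open>\<Sum>\<^sub>j X\<^sub>j = 1\<close> has
  \<open>X\<^sub>j = phase A X j\<close>.\<close>

definition phase :: "(real^'n^'n) list \<Rightarrow> (real^'n \<Rightarrow> real^'n^'n) \<Rightarrow> nat \<Rightarrow> real^'n \<Rightarrow> real" where
  "phase A X j = indicator {x. X x = A ! j}"

text \<open>The norm on matrices is the Euclidean (Frobenius) norm.\<close>

definition energy ::
  "real \<Rightarrow> real \<Rightarrow> (real^'n) set \<Rightarrow> (real^'n^'n) list \<Rightarrow>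
   (real^'n \<Rightarrow> real^'n) \<Rightarrow> (real^'n \<Rightarrow> real^'n^'n) \<Rightarrow> ennreal" where
  "energy p \<epsilon> \<Omega> A u X =
     (\<integral>\<^sup>+ x\<in>\<Omega>. ennreal (norm (sym_part (weak_gradient u x) - X x) powr p) \<partial>lebesgue)
     + ennreal \<epsilon> * (\<Sum>j=1..<length A. total_variation \<Omega> (phase A X j))"

definition dirichlet_class :: "real \<Rightarrow> (real^'n) set \<Rightarrow> real^'n^'n \<Rightarrow> (real^'n \<Rightarrow> real^'n) set" where
  "dirichlet_class p \<Omega> F =
     {u \<in> W1p_loc p. \<exists>b. AE x in lebesgue. x \<notin> \<Omega> \<longrightarrow> u x = F *v x + b}"

definition min_energy ::
  "real \<Rightarrow> real \<Rightarrow> (real^'n) set \<Rightarrow> (real^'n^'n) list \<Rightarrow> real^'n^'n \<Rightarrow> ennreal" where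
  "min_energy p \<epsilon> \<Omega> A F =
     (INF X\<in>BV_into \<Omega> (set A). INF u\<in>dirichlet_class p \<Omega> F. energy p \<epsilon> \<Omega> A u X)"

section \<open>The domain and the wells\<close>

definition unit_cube :: "(real^3) set" where
  "unit_cube = {x. \<forall>i. 0 < x $ i \<and> x $ i < 1}"

definition K212 :: "(real^3^3) list" where
  "K212 = [diag (vector [0, 0, 0]), diag (vector [1, 0, 0]), diag (vector [1/2, 1, -1])]"

definition K221 :: "(real^3^3) list" where
  "K221 = [diag (vector [0, 0, 0]), diag (vector [1, -1, 0]), diag (vector [1/2, -1/2, 1])]"

end

theory Submission
  imports Defs
begin

text \<open>The displacement minus its affine boundary datum, \<open>v\<close>, is supported in the cube, and its
  symmetrized gradient is a diagonal field \<open>f\<close> determined by the phases plus an error \<open>e\<close> of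
  \<open>L\<^sup>2\<close>-norm \<open>\<surd>D\<close>. A field \<open>f\<close> with perimeter \<open>T\<close> is close in \<open>L\<^sup>1\<close> to its mollification at
  scale \<open>r \<lless> 1/T\<close>, while the compatibility equations make mollifications small. If two diagonal
  entries cancel then so does the two-dimensional divergence of the corresponding displacements, up
  to \<open>e\<close>; this yields the bounds \<open>\<surd>D/r\<close> for one of the two cancelling entries (two rank-one
  directions) and \<open>\<surd>D/r\<^sup>2\<close> for the remaining one (a single rank-one direction). Since the
  boundary datum is not a well, \<open>f\<close> cannot be small, and for first order laminates this bounds \<open>T\<close>
  from below by a power of \<open>D\<close>. For second order laminates the entry \<open>g\<close> that describes the outer
  lamination is a function of the entry that oscillates on the inner scale, \<open>g = a - 4 f\<^sup>2\<close>. The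
  latter is regular transversally to its lamination directions up to a scale \<open>H\<close> much larger
  than \<open>r\<close>. Hence \<open>g\<close> is also close to its mollification at scale \<open>H\<close>, which is small. For
  exponents \<open>p > 2\<close> the \<open>L\<^sup>2\<close>-norm of the error is bounded by its \<open>L\<^sup>p\<close>-norm on the unit cube.\<close>

section \<open>Smooth functions\<close>

text \<open>Each bound is arranged so that its right side is small if \<open>(1 + T) * s ^ k\<close>
  is, with \<open>D = s ^ 4\<close> and \<open>k\<close> equal to 1, 2 or 3. The perimeter forces
  \<open>r\<close> of order \<open>1 / (1 + T)\<close>. Then \<open>s\<^sup>2 / r\<^sup>2\<close>
  (one direction) leads to \<open>k = 1\<close> and \<open>s\<^sup>2 / r\<close> (two directions) to
  \<open>k = 2\<close>. In the second order cases the coarse entry needs \<open>H\<close> of order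
  \<open>s\<^sup>2\<close> or \<open>s\<close>, the transversal error is \<open>H * s / r\<close> or
  \<open>H * s\<^sup>2 / r\<close>, and both are \<open>s ^ 3 / r\<close>, hence
  \<open>k = 3\<close>. If the elastic energy is \<open>m\<close>, then \<open>s ^ k\<close> has
  order \<open>m powr (k / (2 * p))\<close>; balancing \<open>m\<close> with
  \<open>\<epsilon> * T\<close> yields the exponent \<open>2 * p / (2 * p + k)\<close>. An obstacle
  is that the perimeter is measured only inside the open cube, while the extended fields may jump
  across its boundary. All \<open>L^1\<close> bounds therefore carry a weight supported well inside
  the cube, whereas the elastic bounds live on the whole space. Localization in frequency is
  replaced by mollification over boxes whose side lengths are chosen separately for each
  coordinate.\<close>

primrec Dk :: "nat \<Rightarrow> (real \<Rightarrow> real) \<Rightarrow> bool" where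
  "Dk 0 f \<longleftrightarrow> True"
| "Dk (Suc k) f \<longleftrightarrow> (\<forall>t. f field_differentiable (at t)) \<and> Dk k (deriv f)"

lemma Dk_Suc: "Dk (Suc k) f \<Longrightarrow> Dk k f"
  by (induction k arbitrary: f) auto

lemma Dk_SucI:
  assumes "\<And>t. (f has_real_derivative g t) (at t)" "Dk k g"
  shows "Dk (Suc k) f"
proof -
  have "deriv f = g" using assms(1) by (auto intro!: ext DERIV_imp_deriv)
  then show ?thesis using assms by (auto simp: field_differentiable_def)
qed

lemma Dk_SucD:
  assumes "Dk (Suc k) f" shows "(f has_real_derivative deriv f t) (at t)" "Dk k (deriv f)"
  using assms by (auto simp: field_differentiable_derivI)

lemma Dk_const: "Dk k (\<lambda>t. c)"
proof (induction k arbitrary: c)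
  case (Suc k)
  show ?case by (rule Dk_SucI[where g="\<lambda>t. 0"]) (auto simp: Suc)
qed simp

lemma Dk_add: "Dk k f \<Longrightarrow> Dk k g \<Longrightarrow> Dk k (\<lambda>t. f t + g t)"
proof (induction k arbitrary: f g)
  case (Suc k)
  show ?case
    by (rule Dk_SucI[where g="\<lambda>t. deriv f t + deriv g t"])
       (auto intro!: DERIV_add Dk_SucD(1)[OF Suc.prems(1)] Dk_SucD(1)[OF Suc.prems(2)]
          Suc.IH Dk_SucD(2)[OF Suc.prems(1)] Dk_SucD(2)[OF Suc.prems(2)])
qed simp

lemma Dk_mult: "Dk k f \<Longrightarrow> Dk k g \<Longrightarrow> Dk k (\<lambda>t. f t * g t)"
proof (induction k arbitrary: f g)
  case (Suc k)
  show ?case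
  proof (rule Dk_SucI)
    show "((\<lambda>t. f t * g t) has_real_derivative deriv f t * g t + deriv g t * f t) (at t)" for t
      by (intro DERIV_mult Dk_SucD(1)[OF Suc.prems(1)] Dk_SucD(1)[OF Suc.prems(2)])
    show "Dk k (\<lambda>t. deriv f t * g t + deriv g t * f t)"
      by (intro Dk_add Suc.IH Dk_Suc[OF Suc.prems(1)] Dk_Suc[OF Suc.prems(2)]
          Dk_SucD(2)[OF Suc.prems(1)] Dk_SucD(2)[OF Suc.prems(2)])
  qed
qed simp

lemma Dk_affine: "Dk k f \<Longrightarrow> Dk k (\<lambda>t. f (a * t + b))"
proof (induction k arbitrary: f)
  case (Suc k)
  show ?case
  proof (rule Dk_SucI)
    show "((\<lambda>t. f (a * t + b)) has_real_derivative deriv f (a * t + b) * a) (at t)" for t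
      by (rule DERIV_chain2[OF Dk_SucD(1)[OF Suc.prems]]) (auto intro!: derivative_eq_intros)
    show "Dk k (\<lambda>t. deriv f (a * t + b) * a)"
      by (intro Dk_mult Dk_const Suc.IH Dk_SucD(2)[OF Suc.prems])
  qed
qed simp

text \<open>The classical flat function \<open>exp (-1/t)\<close>; the polynomial factor in
  \<open>1/t\<close> makes the family closed under differentiation.\<close>

definition flat :: "real poly \<Rightarrow> real \<Rightarrow> real" where
  "flat p t = (if t > 0 then poly p (1/t) * exp (-1/t) else 0)"

lemma poly_exp_tendsto_0: "((\<lambda>x. poly p x * exp (-x)) \<longlongrightarrow> (0::real)) at_top"
proof -
  have "((\<lambda>x. \<Sum>i\<le>degree p. coeff p i * (x ^ i / exp x)) \<longlongrightarrow> (\<Sum>i\<le>degree p. coeff p i * (0::real))) at_top"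
    by (intro tendsto_intros tendsto_power_div_exp_0)
  then show ?thesis by (simp add: poly_altdef sum_distrib_right exp_minus divide_inverse mult.assoc)
qed

lemma flat_tendsto_0: "(flat p \<longlongrightarrow> 0) (at_right 0)"
proof -
  have "((\<lambda>t. poly p (inverse t) * exp (- inverse t)) \<longlongrightarrow> 0) (at_right (0::real))"
    by (rule filterlim_compose[OF poly_exp_tendsto_0 filterlim_inverse_at_top_right])
  then show ?thesis
    by (rule Lim_transform_eventually)
       (auto simp: eventually_at_filter flat_def divide_inverse intro!: always_eventually)
qed

text \<open>For \<open>t > 0\<close> put \<open>x = 1/t\<close>, whose derivative is
  \<open>- x\<^sup>2\<close>: so \<open>p(x) exp(-x)\<close> turns into
  \<open>x\<^sup>2 (p - p')(x) exp(-x)\<close>, and \<open>[:0,0,1:]\<close> is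
  \<open>x\<^sup>2\<close>. At 0 the right difference quotient is again a member of the family, with
  \<open>p\<close> multiplied by \<open>x\<close>, and tends to 0.\<close>

lemma flat_has_derivative:
  "(flat p has_real_derivative flat ([:0,0,1:] * (p - pderiv p)) t) (at t)"
proof -
  consider "t > 0" | "t < 0" | "t = 0" by linarith
  then show ?thesis
  proof cases
    case 1
    have "((\<lambda>t. poly p (1/t) * exp (-1/t)) has_real_derivative
        flat ([:0,0,1:] * (p - pderiv p)) t) (at t)"
      using 1 by (auto intro!: derivative_eq_intros simp: flat_def field_simps power2_eq_square)
    then show ?thesis
      by (rule has_field_derivative_transform_within_open[where S="{0<..}"])
         (use 1 in \<open>auto simp: flat_def\<close>)
  next
    case 2
    have "((\<lambda>t. 0) has_real_derivative flat ([:0,0,1:] * (p - pderiv p)) t) (at t)"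
      using 2 by (simp add: flat_def)
    then show ?thesis
      by (rule has_field_derivative_transform_within_open[where S="{..<0}"])
         (use 2 in \<open>auto simp: flat_def\<close>)
  next
    case 3
    have "((\<lambda>h. flat p h / h) \<longlongrightarrow> 0) (at_right 0)"
      using flat_tendsto_0[of "[:0,1:] * p"]
      by (rule Lim_transform_eventually)
         (auto simp: eventually_at_filter flat_def intro!: always_eventually)
    moreover have "((\<lambda>h. flat p h / h) \<longlongrightarrow> 0) (at_left 0)"
      by (rule Lim_transform_eventually[of "\<lambda>h. 0"])
         (auto simp: eventually_at_filter flat_def intro!: always_eventually)
    ultimately have "((\<lambda>h. flat p h / h) \<longlongrightarrow> 0) (at 0)"
      by (simp add: filterlim_split_at)
    then show ?thesis using 3
      by (simp add: DERIV_def flat_def)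
  qed
qed

lemma Dk_flat: "Dk k (flat p)"
  by (induction k arbitrary: p) (auto intro: Dk_SucI[OF flat_has_derivative] simp del: Dk.simps(2))

text \<open>One bump function together with all its derivatives, indexed by their order, so that a
  kernel and its derivatives are products from a single family. The affine arguments are written as
  \<open>1 * t + 1\<close> and \<open>(- 1) * t + 1\<close> to match
  \<open>Dk_affine\<close>.\<close>

definition bump :: "nat \<Rightarrow> real \<Rightarrow> real" where
  "bump n = (deriv ^^ n) (\<lambda>t. flat 1 (1 * t + 1) * flat 1 ((- 1) * t + 1))"

lemma bump_0: "bump 0 t = flat 1 (1 + t) * flat 1 (1 - t)"
  by (simp add: bump_def add.commute)

lemma bump_derivative: "(bump n has_real_derivative bump (Suc n) t) (at t)"
proof -
  have "Dk k (bump n)" for k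
  proof (induction n arbitrary: k)
    case 0
    then show ?case unfolding bump_def funpow_0 by (intro Dk_mult Dk_affine Dk_flat)
  next
    case (Suc n)
    from Dk_SucD(2)[OF Suc] show ?case by (simp add: bump_def)
  qed
  from Dk_SucD(1)[OF this[of "Suc 0"]] show ?thesis by (simp add: bump_def)
qed

text \<open>By induction on the order: a function that vanishes on an open set has vanishing
  derivative there.\<close>

lemma bump_outside: "\<bar>t\<bar> > 1 \<Longrightarrow> bump n t = 0"
proof (induction n arbitrary: t)
  case 0
  then show ?case by (auto simp: bump_0 flat_def)
next
  case (Suc n)
  have "((\<lambda>t. 0) has_real_derivative bump (Suc n) t) (at t)"
    by (rule has_field_derivative_transform_within_open[OF bump_derivative[of n t], where S="{t. \<bar>t\<bar> > 1}"])
       (use Suc in \<open>auto intro!: open_Collect_less continuous_intros\<close>)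
  from DERIV_unique[OF this DERIV_const] show ?case by simp
qed

lemma bump_0_nonneg: "0 \<le> bump 0 t"
  by (auto simp: bump_0 flat_def)

lemma bump_0_pos: "\<bar>t\<bar> < 1 \<Longrightarrow> 0 < bump 0 t"
  by (auto simp: bump_0 flat_def)

lemma continuous_bump [continuous_intros]:
  "continuous_on S f \<Longrightarrow> continuous_on S (\<lambda>x. bump n (f x))"
  by (rule continuous_on_compose2[of UNIV "bump n"])
     (auto intro!: continuous_at_imp_continuous_on DERIV_isCont bump_derivative)

section \<open>Calculus of the classes \<open>Ck\<close> and of test functions\<close>

lemma Ck_SucI:
  assumes "\<And>x. (f has_derivative f' x) (at x)" "\<And>i. Ck k (\<lambda>x. f' x (axis i 1))"
  shows "Ck (Suc k) f"
proof -
  have "partial_deriv i f = (\<lambda>x. f' x (axis i 1))" for i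
    by (rule ext) (simp add: partial_deriv_def flip: frechet_derivative_at[OF assms(1)])
  then show ?thesis using assms by (auto simp: differentiable_def)
qed

lemma partial_derivI: "(f has_derivative f') (at x) \<Longrightarrow> partial_deriv i f x = f' (axis i 1)"
  by (simp add: partial_deriv_def flip: frechet_derivative_at)

lemma Ck_SucD:
  assumes "Ck (Suc k) f"
  shows "(f has_derivative (\<lambda>z. \<Sum>i\<in>UNIV. z $ i * partial_deriv i f x)) (at x)"
    "Ck k (partial_deriv i f)"
proof -
  have *: "(f has_derivative frechet_derivative f (at x)) (at x)"
    using assms by (auto simp: frechet_derivative_works)
  then interpret bounded_linear "frechet_derivative f (at x)" by (rule has_derivative_bounded_linear)
  have "frechet_derivative f (at x) z = (\<Sum>i\<in>UNIV. z $ i * partial_deriv i f x)" for z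
  proof -
    have "frechet_derivative f (at x) z = frechet_derivative f (at x) (\<Sum>i\<in>UNIV. z $ i *\<^sub>R axis i 1)"
      by (simp add: basis_expansion flip: scalar_mult_eq_scaleR)
    then show ?thesis by (simp add: sum scale partial_deriv_def)
  qed
  then have "frechet_derivative f (at x) = (\<lambda>z. \<Sum>i\<in>UNIV. z $ i * partial_deriv i f x)" by auto
  with * show "(f has_derivative (\<lambda>z. \<Sum>i\<in>UNIV. z $ i * partial_deriv i f x)) (at x)" by simp
  show "Ck k (partial_deriv i f)" using assms by auto
qed

lemma Ck_continuous: "Ck k f \<Longrightarrow> continuous_on UNIV f"
proof (cases k)
  case (Suc k')
  assume "Ck k f"
  then show ?thesis using Suc
    by (auto intro!: continuous_at_imp_continuous_on differentiable_imp_continuous_within)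
qed auto

lemma Ck_Suc: "Ck (Suc k) f \<Longrightarrow> Ck k f"
proof (induction k arbitrary: f)
  case 0
  then show ?case using Ck_continuous[of "Suc 0" f] by simp
qed auto

lemma Ck_const: "Ck k (\<lambda>x. c)"
proof (induction k arbitrary: c)
  case (Suc k)
  show ?case by (rule Ck_SucI[where f'="\<lambda>x z. 0"]) (auto simp: Suc)
qed simp

lemma Ck_linear: "bounded_linear f \<Longrightarrow> Ck k f"
  by (cases k) (auto intro!: Ck_SucI[where f'="\<lambda>x. f"] bounded_linear_imp_has_derivative Ck_const
      linear_continuous_on simp del: Ck.simps(2))

lemma Ck_add: "Ck k f \<Longrightarrow> Ck k g \<Longrightarrow> Ck k (\<lambda>t. f t + g t)"
proof (induction k arbitrary: f g)
  case (Suc k)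
  have "Ck k (\<lambda>x. (\<Sum>i\<in>UNIV. axis j 1 $ i * partial_deriv i f x) + (\<Sum>i\<in>UNIV. axis j 1 $ i * partial_deriv i g x))" for j
    using Suc.IH[OF Ck_SucD(2)[OF Suc.prems(1)] Ck_SucD(2)[OF Suc.prems(2)], of j j]
    by (simp add: axis_def if_distrib[of "\<lambda>x. x * _"] cong: if_cong)
  then show ?case
    by (intro Ck_SucI[OF has_derivative_add[OF Ck_SucD(1)[OF Suc.prems(1)] Ck_SucD(1)[OF Suc.prems(2)]]])
qed (auto intro: continuous_intros)

lemma Ck_mult: "Ck k f \<Longrightarrow> Ck k g \<Longrightarrow> Ck k (\<lambda>t. f t * g t)"
proof (induction k arbitrary: f g)
  case (Suc k)
  have "Ck k (\<lambda>x. f x * (\<Sum>i\<in>UNIV. axis j 1 $ i * partial_deriv i g x) + (\<Sum>i\<in>UNIV. axis j 1 $ i * partial_deriv i f x) * g x)" for j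
    using Ck_add[OF Suc.IH[OF Ck_Suc[OF Suc.prems(1)] Ck_SucD(2)[OF Suc.prems(2)]] Suc.IH[OF Ck_SucD(2)[OF Suc.prems(1)] Ck_Suc[OF Suc.prems(2)]], of j j]
    by (simp add: axis_def if_distrib[of "\<lambda>x. x * _"] cong: if_cong)
  then show ?case
    by (intro Ck_SucI[OF has_derivative_mult[OF Ck_SucD(1)[OF Suc.prems(1)] Ck_SucD(1)[OF Suc.prems(2)]]])
qed (auto intro: continuous_intros)

lemma Ck_affine_derivative:
  fixes f :: "real^'n \<Rightarrow> real"
  assumes "Ck (Suc k) f"
  shows "((\<lambda>y. f (c + s *\<^sub>R y)) has_derivative (\<lambda>z. \<Sum>i\<in>UNIV. z $ i * (s * partial_deriv i f (c + s *\<^sub>R x)))) (at x)"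
proof -
  have "((\<lambda>y. f (c + s *\<^sub>R y)) has_derivative (\<lambda>z. \<Sum>i\<in>UNIV. (s *\<^sub>R z) $ i * partial_deriv i f (c + s *\<^sub>R x))) (at x)"
    by (rule has_derivative_compose[OF _ Ck_SucD(1)[OF assms]]) (auto intro!: derivative_eq_intros)
  then show ?thesis by (simp add: mult_ac)
qed

lemma partial_deriv_affine:
  fixes f :: "real^'n \<Rightarrow> real"
  assumes "Ck (Suc k) f"
  shows "partial_deriv i (\<lambda>y. f (c + s *\<^sub>R y)) x = s * partial_deriv i f (c + s *\<^sub>R x)"
  by (subst partial_derivI[OF Ck_affine_derivative[OF assms]])
     (simp add: axis_def if_distrib[of "\<lambda>x. x * _"] cong: if_cong)

lemma Ck_affine:
  fixes f :: "real^'n \<Rightarrow> real"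
  shows "Ck k f \<Longrightarrow> Ck k (\<lambda>y. f (c + s *\<^sub>R y))"
proof (induction k arbitrary: f)
  case 0
  then show ?case by (auto intro!: continuous_on_compose2[of UNIV f] continuous_intros)
next
  case (Suc k)
  have "partial_deriv i (\<lambda>y. f (c + s *\<^sub>R y)) = (\<lambda>x. s * partial_deriv i f (c + s *\<^sub>R x))" for i
    by (rule ext) (rule partial_deriv_affine[OF Suc.prems])
  moreover have "Ck k (\<lambda>x. s * partial_deriv i f (c + s *\<^sub>R x))" for i
    by (intro Ck_mult Ck_const Suc.IH Ck_SucD(2)[OF Suc.prems])
  ultimately show ?case
    unfolding Ck.simps(2) using differentiableI[OF Ck_affine_derivative[OF Suc.prems]] by metis
qed

lemma Ck_polynomial: "real_polynomial_function p \<Longrightarrow> Ck k p"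
  by (induction rule: real_polynomial_function.induct) (auto intro: Ck_linear Ck_const Ck_add Ck_mult)

lemma partial_deriv_mult:
  assumes "Ck 1 f" "Ck 1 g"
  shows "partial_deriv i (\<lambda>x. f x * g x) x = partial_deriv i f x * g x + f x * partial_deriv i g x"
proof -
  have d: "(f has_derivative (\<lambda>z. \<Sum>i\<in>UNIV. z $ i * partial_deriv i f x)) (at x)"
    "(g has_derivative (\<lambda>z. \<Sum>i\<in>UNIV. z $ i * partial_deriv i g x)) (at x)"
    using assms Ck_SucD(1)[of 0] by auto
  show ?thesis
    by (subst partial_derivI[OF has_derivative_mult[OF d]])
       (simp add: axis_def if_distrib[of "\<lambda>x. x * _"] cong: if_cong)
qed

lemma supp_compact_in_boundedI:
  fixes f :: "real^'n \<Rightarrow> 'b::real_normed_vector"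
  assumes "\<And>x. x \<notin> C \<Longrightarrow> f x = 0" "compact C" "C \<subseteq> S"
  shows "supp_compact_in f S"
proof -
  have *: "closure {x. f x \<noteq> 0} \<subseteq> C"
    by (rule closure_minimal) (use assms compact_imp_closed in auto)
  then have "compact (closure {x. f x \<noteq> 0})"
    using assms(2) closed_closure compact_Int_closed[of C "closure {x. f x \<noteq> 0}"] by (simp add: Int_absorb1)
  with * assms show ?thesis by (auto simp: supp_compact_in_def)
qed

lemma test_funI:
  assumes "\<And>k. Ck k f" "\<And>x. x \<notin> C \<Longrightarrow> f x = 0" "compact C"
  shows "test_fun f"
  using assms supp_compact_in_boundedI[of C f UNIV] by (auto simp: test_fun_def)

lemma test_fun_support:
  assumes "test_fun f" obtains C where "compact C" "\<And>x. x \<notin> C \<Longrightarrow> f x = 0"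
proof -
  from assms have "compact (closure {x. f x \<noteq> 0})" unfolding test_fun_def supp_compact_in_def by blast
  then show thesis using closure_subset[of "{x. f x \<noteq> 0}"] by (intro that[of "closure {x. f x \<noteq> 0}"]) auto
qed

lemma test_fun_Ck: "test_fun f \<Longrightarrow> Ck k f"
  by (simp add: test_fun_def)

lemma test_fun_mult_Ck:
  assumes "test_fun f" "\<And>k. Ck k g" shows "test_fun (\<lambda>x. f x * g x)"
proof -
  obtain C where C: "compact C" "\<And>x. x \<notin> C \<Longrightarrow> f x = 0" using test_fun_support[OF assms(1)] by metis
  show ?thesis by (rule test_funI[OF _ _ C(1)]) (auto intro: Ck_mult assms(2) test_fun_Ck assms(1) simp: C)
qed

lemma test_fun_affine:
  fixes f :: "real^'n \<Rightarrow> real"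
  assumes "test_fun f" "s \<noteq> 0" shows "test_fun (\<lambda>y. f (c + s *\<^sub>R y))"
proof -
  obtain C where C: "compact C" "\<And>x. x \<notin> C \<Longrightarrow> f x = 0" using test_fun_support[OF assms(1)] by metis
  let ?C = "(\<lambda>y. (1/s) *\<^sub>R (y - c)) ` C"
  show ?thesis
  proof (rule test_funI[of _ ?C])
    show "compact ?C" by (intro compact_continuous_image C continuous_intros)
    show "f (c + s *\<^sub>R x) = 0" if "x \<notin> ?C" for x
    proof (rule C(2), rule)
      assume "c + s *\<^sub>R x \<in> C"
      then have "(1/s) *\<^sub>R ((c + s *\<^sub>R x) - c) \<in> ?C" by blast
      with that assms(2) show False by simp
    qed
  qed (auto intro: Ck_affine test_fun_Ck assms)
qed

section \<open>Mollifiers\<close>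

definition up :: "'n \<Rightarrow> ('n \<Rightarrow> nat) \<Rightarrow> 'n \<Rightarrow> nat" where
  "up j a = a(j := Suc (a j))"

lemma up_same: "up i a i = Suc (a i)"
  by (simp add: up_def)

lemma up_commute: "up i (up j a) = up j (up i a)"
  by (auto simp: up_def fun_eq_iff)

text \<open>The partial derivative with multi-index \<open>a\<close> of a tensor product of bumps of
  width \<open>h i\<close> in coordinate \<open>i\<close>. One factor \<open>1 / h i\<close>
  normalizes the mass, the other \<open>a i\<close> factors come from the chain rule; thus
  differentiation just raises \<open>a\<close>.\<close>

definition kern :: "('n \<Rightarrow> real) \<Rightarrow> ('n \<Rightarrow> nat) \<Rightarrow> real^'n \<Rightarrow> real" where
  "kern h a x = (\<Prod>i\<in>UNIV. bump (a i) (x $ i / h i) / h i ^ Suc (a i))"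

lemma kern_outside:
  assumes "\<And>i. 0 < h i" "x \<notin> {z. \<forall>i. \<bar>z $ i\<bar> \<le> h i}" shows "kern h a x = 0"
proof -
  obtain i where "\<bar>x $ i\<bar> > h i" using assms(2) by (auto simp: not_le)
  then have "\<bar>x $ i / h i\<bar> > 1" using assms(1)[of i] by (simp add: abs_divide)
  from bump_outside[OF this] have "bump (a i) (x $ i / h i) / h i ^ Suc (a i) = 0" by simp
  then show ?thesis unfolding kern_def by (intro prod_zero bexI[of _ i]) auto
qed

lemma compact_hbox: "compact {z::real^'n. \<forall>i. \<bar>z $ i\<bar> \<le> h i}"
proof -
  have "\<bar>z $ i\<bar> \<le> h i \<longleftrightarrow> - h i \<le> z $ i \<and> z $ i \<le> h i" for z :: "real^'n" and i
    by (auto simp: abs_le_iff)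
  then have "{z::real^'n. \<forall>i. \<bar>z $ i\<bar> \<le> h i} = cbox (\<chi> i. - h i) (\<chi> i. h i)"
    by (simp add: set_eq_iff mem_box_cart)
  then show ?thesis by simp
qed

lemma kern_derivative:
  fixes h :: "'n::finite \<Rightarrow> real"
  assumes "\<And>i. 0 < h i"
  shows "(kern h a has_derivative (\<lambda>z. \<Sum>i\<in>UNIV. z $ i * kern h (up i a) x)) (at x)"
proof -
  have d: "((\<lambda>x::real^'n. bump (a i) (x $ i / h i) / h i ^ Suc (a i)) has_derivative
      (\<lambda>z. z $ i * (bump (Suc (a i)) (x $ i / h i) / h i ^ Suc (Suc (a i))))) (at x)" for i
  proof -
    have 1: "((\<lambda>x::real^'n. x $ i / h i) has_derivative (\<lambda>z. z $ i / h i)) (at x)"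
      unfolding divide_inverse
      by (intro bounded_linear_imp_has_derivative
          bounded_linear_compose[OF bounded_linear_mult_left bounded_linear_vec_nth])
    have 2: "(bump (a i) has_derivative (\<lambda>t. t * bump (Suc (a i)) (x $ i / h i))) (at (x $ i / h i))"
      using bump_derivative[of "a i" "x $ i / h i"] unfolding has_field_derivative_def
      by (rule has_derivative_eq_rhs) (simp add: fun_eq_iff)
    have 3: "((\<lambda>x::real^'n. bump (a i) (x $ i / h i)) has_derivative
        (\<lambda>z. z $ i / h i * bump (Suc (a i)) (x $ i / h i))) (at x)"
      by (rule has_derivative_compose[OF 1 2])
    have "((\<lambda>x::real^'n. inverse (h i ^ Suc (a i)) * bump (a i) (x $ i / h i)) has_derivative
        (\<lambda>z. inverse (h i ^ Suc (a i)) * (z $ i / h i * bump (Suc (a i)) (x $ i / h i)))) (at x)"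
      by (rule has_derivative_mult_right[OF 3])
    then show ?thesis by (simp add: divide_inverse mult_ac)
  qed
  have "(kern h a has_derivative (\<lambda>z. \<Sum>i\<in>UNIV. (z $ i * (bump (Suc (a i)) (x $ i / h i) / h i ^ Suc (Suc (a i)))) *
      (\<Prod>j\<in>UNIV - {i}. bump (a j) (x $ j / h j) / h j ^ Suc (a j)))) (at x)"
    unfolding kern_def[abs_def] by (rule has_derivative_prod) (rule d)
  moreover have "(bump (Suc (a i)) (x $ i / h i) / h i ^ Suc (Suc (a i))) *
      (\<Prod>j\<in>UNIV - {i}. bump (a j) (x $ j / h j) / h j ^ Suc (a j)) = kern h (up i a) x" for i
  proof -
    have "kern h (up i a) x = (bump (up i a i) (x $ i / h i) / h i ^ Suc (up i a i)) *
      (\<Prod>j\<in>UNIV - {i}. bump (up i a j) (x $ j / h j) / h j ^ Suc (up i a j))"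
      unfolding kern_def by (rule prod.remove) auto
    also have "(\<Prod>j\<in>UNIV - {i}. bump (up i a j) (x $ j / h j) / h j ^ Suc (up i a j)) =
       (\<Prod>j\<in>UNIV - {i}. bump (a j) (x $ j / h j) / h j ^ Suc (a j))"
      by (rule prod.cong) (auto simp: up_def)
    finally show ?thesis by (simp add: up_same)
  qed
  ultimately show ?thesis by (simp only: mult.assoc)
qed

lemma partial_deriv_kern:
  fixes h :: "'n::finite \<Rightarrow> real"
  assumes "\<And>i. 0 < h i" shows "partial_deriv j (kern h a) = kern h (up j a)"
  by (rule ext, subst partial_derivI[OF kern_derivative[OF assms]])
     (simp add: axis_def if_distrib[of "\<lambda>x. x * _"] cong: if_cong)

lemma continuous_kern: "continuous_on S (kern h a)"
  unfolding kern_def[abs_def] divide_inverse by (intro continuous_intros)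

lemma test_fun_kern:
  fixes h :: "'n::finite \<Rightarrow> real"
  assumes "\<And>i. 0 < h i" shows "test_fun (kern h a)"
proof (rule test_funI[OF _ kern_outside compact_hbox])
  show "Ck k (kern h a)" for k
  proof (induction k arbitrary: a)
    case (Suc k)
    have "kern h a differentiable (at x)" for a x
      by (rule differentiableI, rule kern_derivative) (rule assms)
    with Suc show ?case unfolding Ck.simps(2) partial_deriv_kern[OF assms] by blast
  qed (simp add: continuous_kern)
qed (use assms in auto)

lemma kern_nonneg: "(\<And>i. 0 < h i) \<Longrightarrow> 0 \<le> kern h (\<lambda>_. 0) x"
  unfolding kern_def by (intro prod_nonneg) (auto intro!: divide_nonneg_pos bump_0_nonneg)

lemma kern_pos: "(\<And>i. \<bar>x $ i\<bar> < h i) \<Longrightarrow> 0 < kern h (\<lambda>_. 0) x"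
  unfolding kern_def
proof (intro prod_pos ballI)
  fix i assume *: "\<And>i. \<bar>x $ i\<bar> < h i"
  have "0 < h i" using *[of i] by linarith
  then show "0 < bump 0 (x $ i / h i) / h i ^ Suc 0" using *[of i]
    by (auto intro!: divide_pos_pos bump_0_pos simp: abs_divide)
qed

section \<open>Integration over the whole space\<close>

text \<open>The case \<open>s = 1\<close> is translation; \<open>s = -1\<close> is the reflection
  that exchanges \<open>y\<close> and \<open>x - y\<close> in convolutions.\<close>

lemma lborel_distr_isometry:
  fixes t :: "'a::euclidean_space"
  assumes "\<bar>s\<bar> = 1" shows "distr lborel borel (\<lambda>x. t + s *\<^sub>R x) = lborel"
proof -
  have "s \<noteq> 0" using assms by auto
  from lborel_affine[OF this, of t] show ?thesis using assms by (simp add: density_1)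
qed

lemma nn_integral_lborel_isometry:
  fixes t :: "'a::euclidean_space"
  assumes "\<bar>s\<bar> = 1" "f \<in> borel_measurable borel"
  shows "(\<integral>\<^sup>+x. f (t + s *\<^sub>R x) \<partial>lborel) = (\<integral>\<^sup>+x. f x \<partial>lborel)"
  by (subst (2) lborel_distr_isometry[OF assms(1), of t, symmetric]) (simp add: nn_integral_distr assms(2))

lemma nn_integral_lborel_add:
  fixes t :: "'a::euclidean_space"
  assumes "f \<in> borel_measurable borel"
  shows "(\<integral>\<^sup>+x. f (x + t) \<partial>lborel) = (\<integral>\<^sup>+x. f x \<partial>lborel)"
  using nn_integral_lborel_isometry[of 1 f t, OF _ assms] by (simp add: add.commute)

lemma integral_lborel_isometry:
  fixes t :: "'a::euclidean_space" and f :: "'a \<Rightarrow> real"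
  assumes "\<bar>s\<bar> = 1" "f \<in> borel_measurable borel"
  shows "(\<integral>x. f (t + s *\<^sub>R x) \<partial>lborel) = (\<integral>x. f x \<partial>lborel)"
  by (subst (2) lborel_distr_isometry[OF assms(1), of t, symmetric]) (simp add: integral_distr assms(2))

lemma integrable_lborel_isometry:
  fixes t :: "'a::euclidean_space" and f :: "'a \<Rightarrow> real"
  assumes "\<bar>s\<bar> = 1" "integrable lborel f"
  shows "integrable lborel (\<lambda>x. f (t + s *\<^sub>R x))"
proof -
  have "integrable (distr lborel borel (\<lambda>x. t + s *\<^sub>R x)) f"
    unfolding lborel_distr_isometry[OF assms(1)] by (rule assms(2))
  then show ?thesis by (rule integrable_distr[rotated]) simp
qed

lemma integrable_lborel_add:
  fixes t :: "'a::euclidean_space" and f :: "'a \<Rightarrow> real"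
  shows "integrable lborel f \<Longrightarrow> integrable lborel (\<lambda>x. f (x + t))"
  using integrable_lborel_isometry[of 1 f t] by (simp add: add.commute)

lemma integral_lborel_add:
  fixes t :: "'a::euclidean_space" and f :: "'a \<Rightarrow> real"
  shows "f \<in> borel_measurable borel \<Longrightarrow> (\<integral>x. f (x + t) \<partial>lborel) = (\<integral>x. f x \<partial>lborel)"
  using integral_lborel_isometry[of 1 f t] by (simp add: add.commute)

text \<open>The functions below arise by mollifying functions on the unit cube at scales at most 1.\<close>

definition cs :: "(real^'n \<Rightarrow> real) \<Rightarrow> bool" where
  "cs \<phi> \<longleftrightarrow> continuous_on UNIV \<phi> \<and> (\<forall>x. x \<notin> cbox (-1) 2 \<longrightarrow> \<phi> x = 0)"

lemma cs_mult: "cs f \<Longrightarrow> cs g \<Longrightarrow> cs (\<lambda>x. f x * g x)"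
  by (auto simp: cs_def intro: continuous_intros)

lemma cs_add: "cs f \<Longrightarrow> cs g \<Longrightarrow> cs (\<lambda>x. f x + g x)"
  by (auto simp: cs_def intro: continuous_intros)

lemma cs_diff: "cs f \<Longrightarrow> cs g \<Longrightarrow> cs (\<lambda>x. f x - g x)"
  by (auto simp: cs_def intro: continuous_intros)

lemma cs_cmult: "cs f \<Longrightarrow> cs (\<lambda>x. c * f x)"
  by (auto simp: cs_def intro: continuous_intros)

lemma cs_power2: "cs f \<Longrightarrow> cs (\<lambda>x. (f x)\<^sup>2)"
  by (auto simp: cs_def intro: continuous_intros)

lemma cs_abs: "cs f \<Longrightarrow> cs (\<lambda>x. \<bar>f x\<bar>)"
  by (auto simp: cs_def intro: continuous_intros)

lemma cs_sum: "(\<And>i. i \<in> I \<Longrightarrow> cs (f i)) \<Longrightarrow> cs (\<lambda>x. \<Sum>i\<in>I. f i x)"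
  by (auto simp: cs_def intro!: continuous_intros sum.neutral)

lemmas cs_intros = cs_cmult cs_mult cs_add cs_diff cs_power2 cs_abs

lemma cs_borel: "cs f \<Longrightarrow> f \<in> borel_measurable borel"
  by (auto simp: cs_def intro: borel_measurable_continuous_onI)

lemma cs_integrable:
  assumes "cs f" shows "integrable lborel f"
proof -
  have "integrable lborel (\<lambda>x. indicator (cbox (-1) 2) x *\<^sub>R f x)"
    by (rule borel_integrable_compact) (use assms continuous_on_subset in \<open>auto simp: cs_def\<close>)
  moreover have "(\<lambda>x. indicator (cbox (-1) 2) x *\<^sub>R f x) = f"
    using assms by (auto simp: cs_def indicator_def fun_eq_iff)
  ultimately show ?thesis by simp
qed

lemma compact_support_bounded:
  fixes f :: "real^'n \<Rightarrow> real"
  assumes "continuous_on UNIV f" "compact C" "\<And>x. x \<notin> C \<Longrightarrow> f x = 0"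
  obtains B where "0 \<le> B" "\<And>x. \<bar>f x\<bar> \<le> B"
proof -
  have "bounded (f ` C)"
    by (rule compact_imp_bounded[OF compact_continuous_image]) (use assms continuous_on_subset in blast)+
  then obtain B where "\<And>x. x \<in> C \<Longrightarrow> \<bar>f x\<bar> \<le> B" by (auto simp: bounded_iff)
  then have "\<bar>f x\<bar> \<le> max B 0" for x using assms(3)[of x] by (cases "x \<in> C") (auto simp: le_max_iff_disj)
  then show thesis by (intro that[of "max B 0"]) auto
qed

lemma cs_bounded: assumes "cs f" obtains B where "0 \<le> B" "\<And>x. \<bar>f x\<bar> \<le> B"
  using compact_support_bounded[of f "cbox (-1) 2"] assms by (auto simp: cs_def)

text \<open>A directional derivative, required along all lines parallel to \<open>a\<close>. Oblique
  directions such as \<open>e_i + e_j\<close> occur below. Since \<open>a\<close> is not normalized,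
  a translation by \<open>a\<close> amounts to integrating \<open>\<psi>\<close> over the parameter
  interval \<open>[0,1]\<close>.\<close>

definition ld :: "real^'n \<Rightarrow> (real^'n \<Rightarrow> real) \<Rightarrow> (real^'n \<Rightarrow> real) \<Rightarrow> bool" where
  "ld a \<phi> \<psi> \<longleftrightarrow> (\<forall>x t. ((\<lambda>t. \<phi> (x + t *\<^sub>R a)) has_real_derivative \<psi> (x + t *\<^sub>R a)) (at t))"

lemma ld_mult: "ld a f f' \<Longrightarrow> ld a g g' \<Longrightarrow> ld a (\<lambda>x. f x * g x) (\<lambda>x. f' x * g x + f x * g' x)"
  by (auto simp: ld_def intro!: derivative_eq_intros)

lemma ld_add: "ld a f f' \<Longrightarrow> ld a g g' \<Longrightarrow> ld a (\<lambda>x. f x + g x) (\<lambda>x. f' x + g' x)"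
  by (auto simp: ld_def intro!: derivative_eq_intros)

lemma ld_cmult: "ld a f f' \<Longrightarrow> ld a (\<lambda>x. c * f x) (\<lambda>x. c * f' x)"
  by (auto simp: ld_def intro!: derivative_eq_intros)

lemma ld_scale:
  assumes "ld a f f'" shows "ld (c *\<^sub>R a) f (\<lambda>x. c * f' x)"
  unfolding ld_def
proof (intro allI)
  fix x t
  have "((\<lambda>t. f (x + t *\<^sub>R a)) has_real_derivative f' (x + (t * c) *\<^sub>R a)) (at (t * c))"
    using assms by (auto simp: ld_def)
  moreover have "((\<lambda>t. t * c) has_real_derivative c) (at t)" by (auto intro!: derivative_eq_intros)
  ultimately have "((\<lambda>t. f (x + (t * c) *\<^sub>R a)) has_real_derivative f' (x + (t * c) *\<^sub>R a) * c) (at t)"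
    by (rule DERIV_chain2)
  then show "((\<lambda>t. f (x + t *\<^sub>R c *\<^sub>R a)) has_real_derivative c * f' (x + t *\<^sub>R c *\<^sub>R a)) (at t)"
    by (simp add: mult.commute)
qed

lemma ld_mvt:
  assumes "ld a \<phi> \<psi>" "\<And>x. \<bar>\<psi> x\<bar> \<le> B" shows "\<bar>\<phi> (x + s *\<^sub>R a) - \<phi> x\<bar> \<le> B * \<bar>s\<bar>"
proof -
  have "norm (\<phi> (x + s *\<^sub>R a) - \<phi> (x + 0 *\<^sub>R a)) \<le> B * norm (s - 0)"
    by (rule field_differentiable_bound[of UNIV "\<lambda>t. \<phi> (x + t *\<^sub>R a)" "\<lambda>t. \<psi> (x + t *\<^sub>R a)"])
       (use assms in \<open>auto simp: ld_def\<close>)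
  then show ?thesis by simp
qed

text \<open>Difference quotients of \<open>\<phi>\<close> along \<open>a\<close> have integral 0 by
  translation invariance, and they converge to \<open>\<psi>\<close>. The mean value bound together
  with \<open>s n \<le> 1\<close> provides a dominating function, a multiple of the indicator of a
  ball.\<close>

lemma integral_line_derivative:
  assumes cont: "continuous_on UNIV \<phi>" "continuous_on UNIV \<psi>"
    and S: "compact S" "\<And>x. x \<notin> S \<Longrightarrow> \<phi> x = 0" "\<And>x. x \<notin> S \<Longrightarrow> \<psi> x = 0"
    and ld: "ld a \<phi> \<psi>"
  shows "(\<integral>x. \<psi> x \<partial>lborel) = 0"
proof -
  obtain B where B: "0 \<le> B" "\<And>x. \<bar>\<psi> x\<bar> \<le> B"
    using compact_support_bounded[OF cont(2) S(1,3)] by blast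
  have int\<phi>: "integrable lborel \<phi>"
  proof -
    have "integrable lborel (\<lambda>x. indicator S x *\<^sub>R \<phi> x)"
      by (rule borel_integrable_compact[OF S(1) continuous_on_subset[OF cont(1)]]) simp
    moreover have "(\<lambda>x. indicator S x *\<^sub>R \<phi> x) = \<phi>" using S(2) by (auto simp: indicator_def fun_eq_iff)
    ultimately show ?thesis by simp
  qed
  define s where "s n = inverse (real (Suc n))" for n
  have s: "0 < s n" "s n \<le> 1" for n by (auto simp: s_def divide_simps)
  have s0: "s \<longlonglongrightarrow> 0" unfolding s_def by (rule LIMSEQ_inverse_real_of_nat)
  obtain R where R: "S \<subseteq> cball (0::real^'a) R"
    using compact_imp_bounded[OF S(1)] by (auto simp: bounded_iff subset_iff)
  note [measurable] = borel_measurable_continuous_onI[OF cont(1)] borel_measurable_continuous_onI[OF cont(2)]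
  have lim: "(\<lambda>n. \<integral>x. (\<phi> (x + s n *\<^sub>R a) - \<phi> x) / s n \<partial>lborel) \<longlonglongrightarrow> (\<integral>x. \<psi> x \<partial>lborel)"
  proof (rule integral_dominated_convergence[where w="\<lambda>x. B * indicator (cball 0 (R + norm a)) x"])
    show "integrable lborel (\<lambda>x. B * indicator (cball 0 (R + norm a)) x :: real)"
      by (intro integrable_mult_right integrable_real_indicator emeasure_bounded_finite bounded_cball) auto
    show "AE x in lborel. (\<lambda>n. (\<phi> (x + s n *\<^sub>R a) - \<phi> x) / s n) \<longlonglongrightarrow> \<psi> x"
    proof (rule AE_I2)
      fix x
      have "((\<lambda>t. \<phi> (x + t *\<^sub>R a)) has_real_derivative \<psi> (x + 0 *\<^sub>R a)) (at 0)"
        using ld unfolding ld_def by blast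
      then have "((\<lambda>h. (\<phi> (x + h *\<^sub>R a) - \<phi> x) / h) \<longlongrightarrow> \<psi> x) (at 0)"
        by (simp add: DERIV_def)
      then show "(\<lambda>n. (\<phi> (x + s n *\<^sub>R a) - \<phi> x) / s n) \<longlonglongrightarrow> \<psi> x"
        by (rule filterlim_compose) (use s s0 in \<open>auto simp: filterlim_at intro!: always_eventually less_imp_neq[symmetric]\<close>)
    qed
    show "AE x in lborel. norm ((\<phi> (x + s n *\<^sub>R a) - \<phi> x) / s n) \<le> B * indicator (cball 0 (R + norm a)) x" for n
    proof (rule AE_I2)
      fix x
      show "norm ((\<phi> (x + s n *\<^sub>R a) - \<phi> x) / s n) \<le> B * indicator (cball 0 (R + norm a)) x"
      proof (cases "x \<in> cball 0 (R + norm a)")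
        case True
        then show ?thesis using ld_mvt[OF ld B(2), of x "s n"] s[of n]
          by (simp add: divide_simps abs_if split: if_splits)
      next
        case False
        have "norm x \<le> norm (x + s n *\<^sub>R a) + norm (s n *\<^sub>R a)"
          using norm_triangle_ineq4[of "x + s n *\<^sub>R a" "s n *\<^sub>R a"] by simp
        moreover have "norm (s n *\<^sub>R a) \<le> norm a" using s[of n] by (simp add: mult_left_le_one_le)
        ultimately have "norm x > R" "norm (x + s n *\<^sub>R a) > R" using False norm_ge_zero[of a] by (auto simp: dist_norm simp del: norm_ge_zero)
        then have "x \<notin> S" "x + s n *\<^sub>R a \<notin> S" using R by (auto simp: subset_iff dist_norm)
        then show ?thesis using S(2) by (auto simp: B)
      qed
    qed
  qed auto
  have "(\<integral>x. (\<phi> (x + s n *\<^sub>R a) - \<phi> x) / s n \<partial>lborel) = 0" for n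
    using int\<phi>
    by (simp add: integrable_lborel_add integral_lborel_add)
  with lim have "(\<lambda>n::nat. 0) \<longlonglongrightarrow> (\<integral>x. \<psi> x \<partial>lborel)" by (simp only:)
  then show ?thesis by (simp add: LIMSEQ_const_iff)
qed

lemma integral_ld:
  assumes "cs \<phi>" "cs \<psi>" "ld a \<phi> \<psi>" shows "(\<integral>x. \<psi> x \<partial>lborel) = 0"
  by (rule integral_line_derivative[OF _ _ compact_cbox _ _ assms(3)]) (use assms in \<open>auto simp: cs_def\<close>)

lemma integration_by_parts:
  assumes "cs f" "cs g" "cs f'" "cs g'" "ld a f f'" "ld a g g'"
  shows "(\<integral>x. f x * g' x \<partial>lborel) = - (\<integral>x. f' x * g x \<partial>lborel)"
proof -
  have "(\<integral>x. f' x * g x + f x * g' x \<partial>lborel) = 0"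
    by (rule integral_ld[OF _ _ ld_mult[OF assms(5,6)]]) (intro cs_intros assms)+
  then show ?thesis
    using Bochner_Integration.integral_add[OF cs_integrable[OF cs_mult[OF assms(3,2)]] cs_integrable[OF cs_mult[OF assms(1,4)]]]
    by simp
qed

lemma integrable_translate_diff_square:
  assumes "cs \<phi>" shows "integrable lborel (\<lambda>x. (\<phi> (x + a) - \<phi> x)\<^sup>2)"
proof -
  have eq: "(\<phi> (x + a) - \<phi> x)\<^sup>2 = (\<phi> (x + a))\<^sup>2 + (\<phi> x)\<^sup>2 - 2 * (\<phi> (x + a) * \<phi> x)" for x
    by (simp add: power2_eq_square algebra_simps)
  have "cs (\<lambda>x. \<phi> (x + a) * \<phi> x)"
    using assms by (auto simp: cs_def intro!: continuous_intros continuous_on_compose2[of UNIV \<phi>])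
  then show ?thesis unfolding eq
    by (intro Bochner_Integration.integrable_add Bochner_Integration.integrable_diff integrable_mult_right
        integrable_lborel_add[of "\<lambda>x. (\<phi> x)\<^sup>2"] cs_integrable cs_power2 assms)
qed

text \<open>The increment is the average of \<open>\<psi>\<close> over the segment from
  \<open>x\<close> to \<open>x + a\<close>; Jensen's inequality, Tonelli's theorem and translation
  invariance do the rest.\<close>

lemma translation_square:
  assumes "cs \<phi>" "cs \<psi>" "ld a \<phi> \<psi>"
  shows "(\<integral>x. (\<phi> (x + a) - \<phi> x)\<^sup>2 \<partial>lborel) \<le> (\<integral>x. (\<psi> x)\<^sup>2 \<partial>lborel)"
proof -
  note [measurable] = cs_borel[OF assms(1)] cs_borel[OF assms(2)]
  have pt: "ennreal ((\<phi> (x + a) - \<phi> x)\<^sup>2) \<le> (\<integral>\<^sup>+t. ennreal ((\<psi> (x + t *\<^sub>R a))\<^sup>2) * indicator {0..1} t \<partial>lborel)" for x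
  proof -
    define m where "m = \<phi> (x + a) - \<phi> x"
    define q where "q t = \<psi> (x + t *\<^sub>R a)" for t
    have qc: "continuous_on S q" for S unfolding q_def
      by (rule continuous_on_compose2[of UNIV \<psi>]) (use assms(2) in \<open>auto simp: cs_def intro!: continuous_intros\<close>)
    have q: "(q has_integral m) {0..1}"
      using fundamental_theorem_of_calculus[of 0 1 "\<lambda>t. \<phi> (x + t *\<^sub>R a)" q] assms(3)
      by (auto simp: ld_def m_def q_def has_real_derivative_iff_has_vector_derivative[symmetric] intro: has_field_derivative_at_within)
    have q2: "((\<lambda>t. (q t)\<^sup>2) has_integral integral {0..1} (\<lambda>t. (q t)\<^sup>2)) {0..1}"
      by (intro integrable_integral integrable_continuous_real continuous_intros qc)
    \<comment> \<open>Jensen's inequality for the square: \<open>m\<close> is the mean of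
      \<open>q\<close> on \<open>[0,1]\<close>, and the integral of \<open>(q t - m)\<^sup>2\<close>
      is nonnegative.\<close>
    have "((\<lambda>t. (q t)\<^sup>2 - 2 * m * q t + m\<^sup>2) has_integral (integral {0..1} (\<lambda>t. (q t)\<^sup>2) - 2 * m * m + m\<^sup>2)) {0..1}"
      by (intro has_integral_add has_integral_diff q2 has_integral_mult_right q)
         (use has_integral_const_real[of "m\<^sup>2" 0 1] in simp)
    moreover have "0 \<le> (q t)\<^sup>2 - 2 * m * q t + m\<^sup>2" for t
      using zero_le_power2[of "q t - m"] by (simp add: power2_eq_square algebra_simps)
    ultimately have "0 \<le> integral {0..1} (\<lambda>t. (q t)\<^sup>2) - 2 * m * m + m\<^sup>2"
      by (rule has_integral_nonneg)
    then have "m\<^sup>2 \<le> integral {0..1} (\<lambda>t. (q t)\<^sup>2)" by (simp add: power2_eq_square)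
    then have "ennreal (m\<^sup>2) \<le> ennreal (integral {0..1} (\<lambda>t. (q t)\<^sup>2))" by (rule ennreal_leI)
    also have "\<dots> = (\<integral>\<^sup>+t. ennreal ((q t)\<^sup>2) * indicator {0..1} t \<partial>lborel)"
      by (rule nn_integral_has_integral_lebesgue'[OF _ q2, symmetric]) simp
    finally show ?thesis by (simp add: m_def q_def)
  qed
  have "ennreal (\<integral>x. (\<phi> (x + a) - \<phi> x)\<^sup>2 \<partial>lborel) = (\<integral>\<^sup>+x. ennreal ((\<phi> (x + a) - \<phi> x)\<^sup>2) \<partial>lborel)"
    by (intro nn_integral_eq_integral[symmetric] integrable_translate_diff_square assms) simp
  also have "\<dots> \<le> (\<integral>\<^sup>+x. (\<integral>\<^sup>+t. ennreal ((\<psi> (x + t *\<^sub>R a))\<^sup>2) * indicator {0..1} t \<partial>lborel) \<partial>lborel)"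
    by (rule nn_integral_mono) (rule pt)
  also have "\<dots> = (\<integral>\<^sup>+t. (\<integral>\<^sup>+x. ennreal ((\<psi> (x + t *\<^sub>R a))\<^sup>2) * indicator {0..1} t \<partial>lborel) \<partial>lborel)"
    by (rule lborel_pair.Fubini'[symmetric]) (simp add: split_beta')
  also have "\<dots> = (\<integral>\<^sup>+t. (\<integral>\<^sup>+x. ennreal ((\<psi> x)\<^sup>2) \<partial>lborel) * indicator {0..1} (t::real) \<partial>lborel)"
    by (intro nn_integral_cong) (simp add: nn_integral_multc nn_integral_lborel_add[of "\<lambda>x. ennreal ((\<psi> x)\<^sup>2)"])
  also have "\<dots> = (\<integral>\<^sup>+x. ennreal ((\<psi> x)\<^sup>2) \<partial>lborel)"
    by (simp add: nn_integral_cmult_indicator)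
  also have "\<dots> = ennreal (\<integral>x. (\<psi> x)\<^sup>2 \<partial>lborel)"
    by (intro nn_integral_eq_integral cs_integrable cs_intros assms) simp
  finally show ?thesis by (simp add: ennreal_le_iff)
qed

text \<open>The support has width 3 in coordinate \<open>i\<close>, so a translation by
  \<open>4 *\<^sub>R a\<close> carries it off itself and \<open>\<phi> x\<close> is, up to sign, its
  own increment wherever it is nonzero. The constant is \<open>4\<^sup>2\<close>.\<close>

lemma poincare:
  assumes "cs \<phi>" "cs \<psi>" "ld a \<phi> \<psi>" "\<bar>a $ i\<bar> = 1"
  shows "(\<integral>x. (\<phi> x)\<^sup>2 \<partial>lborel) \<le> 16 * (\<integral>x. (\<psi> x)\<^sup>2 \<partial>lborel)"
proof -
  have ptw: "(\<phi> x)\<^sup>2 \<le> (\<phi> (x + 4 *\<^sub>R a) - \<phi> x)\<^sup>2" for x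
  proof (cases "x \<in> cbox (-1) 2")
    case True
    then have "-1 \<le> x $ i" "x $ i \<le> 2" by (auto simp: mem_box_cart)
    then have "\<not> (-1 \<le> (x + 4 *\<^sub>R a) $ i \<and> (x + 4 *\<^sub>R a) $ i \<le> 2)" using assms(4) by (auto simp: abs_if split: if_splits)
    then have "x + 4 *\<^sub>R a \<notin> cbox (-1) 2" unfolding mem_box_cart by force
    then show ?thesis using assms(1) by (simp add: cs_def)
  next
    case False
    then show ?thesis using assms(1) by (simp add: cs_def)
  qed
  have i: "integrable lborel \<phi>" by (rule cs_integrable[OF assms(1)])
  note integrable_translate_diff_square[OF assms(1), of "4 *\<^sub>R a"]
  then have "(\<integral>x. (\<phi> x)\<^sup>2 \<partial>lborel) \<le> (\<integral>x. (\<phi> (x + 4 *\<^sub>R a) - \<phi> x)\<^sup>2 \<partial>lborel)"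
    by (intro integral_mono[OF cs_integrable[OF cs_power2[OF assms(1)]]] ptw)
  also have "\<dots> \<le> (\<integral>x. (4 * \<psi> x)\<^sup>2 \<partial>lborel)"
    by (rule translation_square[OF assms(1) _ ld_scale[OF assms(3)]]) (intro cs_intros assms)
  finally show ?thesis by (simp add: power_mult_distrib)
qed

lemma cs_Cauchy_Schwarz_Young:
  assumes "cs f" "cs g" "c > 0"
  shows "(\<integral>x. f x * g x \<partial>lborel) \<le> c * (\<integral>x. (f x)\<^sup>2 \<partial>lborel) + (1 / (4 * c)) * (\<integral>x. (g x)\<^sup>2 \<partial>lborel)"
proof -
  have "f x * g x \<le> c * (f x)\<^sup>2 + (1 / (4 * c)) * (g x)\<^sup>2" for x
  proof -
    have "0 \<le> (2 * c * f x - g x)\<^sup>2 / (4 * c)" using assms(3) by simp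
    also have "\<dots> = c * (f x)\<^sup>2 + (1 / (4 * c)) * (g x)\<^sup>2 - f x * g x"
      using assms(3) by (simp add: field_simps power2_eq_square)
    finally show ?thesis by simp
  qed
  then have "(\<integral>x. f x * g x \<partial>lborel) \<le> (\<integral>x. c * (f x)\<^sup>2 + (1 / (4 * c)) * (g x)\<^sup>2 \<partial>lborel)"
    by (intro integral_mono cs_integrable cs_intros assms)
  also have "\<dots> = c * (\<integral>x. (f x)\<^sup>2 \<partial>lborel) + (1 / (4 * c)) * (\<integral>x. (g x)\<^sup>2 \<partial>lborel)"
    by (subst Bochner_Integration.integral_add[OF cs_integrable[OF cs_cmult[OF cs_power2[OF assms(1)]]]
          cs_integrable[OF cs_cmult[OF cs_power2[OF assms(2)]]]]) simp
  finally show ?thesis .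
qed

section \<open>Convolution\<close>

definition conv :: "(real^'n \<Rightarrow> real) \<Rightarrow> (real^'n \<Rightarrow> real) \<Rightarrow> real^'n \<Rightarrow> real" where
  "conv g k x = (\<integral>y. g y * k (x - y) \<partial>lborel)"

text \<open>The supports in \<open>loc\<close> and in \<open>ker\<close> below are fixed such that
  the convolution vanishes outside \<open>cbox (-1) 2\<close>, that is, lies in
  \<open>cs\<close>.\<close>

definition loc :: "(real^'n \<Rightarrow> real) \<Rightarrow> bool" where
  "loc g \<longleftrightarrow> integrable lborel g \<and> (\<forall>x. x \<notin> cbox 0 1 \<longrightarrow> g x = 0)"

definition ker :: "(real^'n \<Rightarrow> real) \<Rightarrow> bool" where
  "ker k \<longleftrightarrow> test_fun k \<and> (\<forall>z. k z \<noteq> 0 \<longrightarrow> (\<forall>i. \<bar>z $ i\<bar> \<le> 1))"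

lemma ker_continuous: "ker k \<Longrightarrow> continuous_on UNIV k"
  by (auto simp: ker_def intro!: Ck_continuous[of 0] test_fun_Ck)

lemma ker_borel [measurable_dest]: "ker k \<Longrightarrow> k \<in> borel_measurable borel"
  by (intro borel_measurable_continuous_onI ker_continuous)

lemma loc_borel [measurable_dest]: "loc g \<Longrightarrow> g \<in> borel_measurable borel"
  using borel_measurable_integrable[of lborel g] by (auto simp: loc_def)

lemma ker_outside: "ker k \<Longrightarrow> z \<notin> cbox (-1) 1 \<Longrightarrow> k z = 0"
  unfolding ker_def mem_box_cart abs_le_iff by force

lemma ker_bounded: assumes "ker k" obtains B where "0 \<le> B" "\<And>x. \<bar>k x\<bar> \<le> B"
  using compact_support_bounded[OF ker_continuous[OF assms] compact_cbox ker_outside[OF assms]] by blast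

lemma ker_cs: "ker k \<Longrightarrow> cs k"
  unfolding cs_def
proof (intro conjI allI impI)
  fix x :: "real^'a" assume k: "ker k" and "x \<notin> cbox (-1) 2"
  then obtain i where "\<not> (-1 \<le> x $ i \<and> x $ i \<le> 2)" by (auto simp: mem_box_cart)
  then have "\<not> (-1 \<le> x $ i \<and> x $ i \<le> 1)" by auto
  then have "x \<notin> cbox (-1) 1" by (auto simp: mem_box_cart)
  then show "k x = 0" by (rule ker_outside[OF k])
qed (rule ker_continuous)

lemma conv_integrable:
  assumes "loc g" "ker k" shows "integrable lborel (\<lambda>y. g y * k (x - y))"
proof -
  obtain B where B: "0 \<le> B" "\<And>x. \<bar>k x\<bar> \<le> B" using ker_bounded[OF assms(2)] by blast
  note [measurable] = loc_borel[OF assms(1)] ker_borel[OF assms(2)]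
  show ?thesis
  proof (rule Bochner_Integration.integrable_bound[where f="\<lambda>y. B * g y"])
    show "integrable lborel (\<lambda>y. B * g y)" using assms by (simp add: loc_def)
    show "AE y in lborel. norm (g y * k (x - y)) \<le> norm (B * g y)"
      using B by (auto simp: abs_mult mult.commute[of B] intro!: mult_left_mono)
  qed simp
qed

lemma cs_conv:
  assumes "loc g" "ker k" shows "cs (conv g k)"
  unfolding cs_def
proof (intro conjI allI impI)
  obtain B where B: "0 \<le> B" "\<And>x. \<bar>k x\<bar> \<le> B" using ker_bounded[OF assms(2)] by blast
  note [measurable] = loc_borel[OF assms(1)] ker_borel[OF assms(2)]
  show "continuous_on UNIV (conv g k)"
    unfolding continuous_on_sequentially comp_def conv_def
  proof (intro allI impI ballI, elim conjE)
    fix X :: "nat \<Rightarrow> real^'a" and a assume X: "X \<longlonglongrightarrow> a"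
    show "(\<lambda>n. \<integral>y. g y * k (X n - y) \<partial>lborel) \<longlonglongrightarrow> (\<integral>y. g y * k (a - y) \<partial>lborel)"
    proof (rule integral_dominated_convergence[where w="\<lambda>y. B * \<bar>g y\<bar>"])
      show "integrable lborel (\<lambda>y. B * \<bar>g y\<bar>)" using assms by (simp add: loc_def)
      show "AE y in lborel. (\<lambda>n. g y * k (X n - y)) \<longlonglongrightarrow> g y * k (a - y)"
        using ker_continuous[OF assms(2)]
        by (intro AE_I2 tendsto_intros continuous_on_tendsto_compose[of UNIV k] X) auto
      show "AE y in lborel. norm (g y * k (X n - y)) \<le> B * \<bar>g y\<bar>" for n
        using B by (auto simp: abs_mult mult.commute[of B] intro!: mult_left_mono)
    qed auto
  qed
  fix x :: "real^'a" assume "x \<notin> cbox (-1) 2"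
  then obtain i where i: "x $ i < -1 \<or> x $ i > 2" by (auto simp: mem_box_cart not_le)
  have "g y * k (x - y) = 0" for y
  proof (cases "y \<in> cbox 0 1")
    case True
    then have "0 \<le> y $ i" "y $ i \<le> 1" by (auto simp: mem_box_cart)
    with i have "\<not> \<bar>(x - y) $ i\<bar> \<le> 1" by auto
    then show ?thesis using assms(2) unfolding ker_def by auto
  next
    case False
    then show ?thesis using assms(1) by (simp add: loc_def)
  qed
  then have "(\<lambda>y. g y * k (x - y)) = (\<lambda>y. 0)" by (rule ext)
  then show "conv g k x = 0" by (simp only: conv_def) simp
qed

lemma Ck_ld:
  assumes "Ck 1 k" shows "ld a k (\<lambda>x. \<Sum>i\<in>UNIV. a $ i * partial_deriv i k x)"
  unfolding ld_def
proof (intro allI)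
  fix x t
  have "((\<lambda>t. k (x + t *\<^sub>R a)) has_derivative (\<lambda>s. \<Sum>i\<in>UNIV. (s *\<^sub>R a) $ i * partial_deriv i k (x + t *\<^sub>R a))) (at t)"
    by (rule has_derivative_compose[OF _ Ck_SucD(1)[of 0 k]])
       (use assms in \<open>auto intro!: derivative_eq_intros\<close>)
  then show "((\<lambda>t. k (x + t *\<^sub>R a)) has_real_derivative (\<Sum>i\<in>UNIV. a $ i * partial_deriv i k (x + t *\<^sub>R a))) (at t)"
    unfolding has_field_derivative_def
    by (rule has_derivative_eq_rhs) (auto simp: fun_eq_iff sum_distrib_left mult_ac)
qed

lemma partial_deriv_outside:
  assumes "Ck 1 \<phi>" "closed S" "\<And>x. x \<notin> S \<Longrightarrow> \<phi> x = 0" "x \<notin> S"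
  shows "partial_deriv j \<phi> x = 0"
proof -
  have "((\<lambda>x. 0) has_derivative (\<lambda>z. \<Sum>i\<in>UNIV. z $ i * partial_deriv i \<phi> x)) (at x)"
    by (rule has_derivative_transform_within_open[OF Ck_SucD(1)[of 0 \<phi>], of "- S"])
       (use assms in \<open>auto simp: open_Compl\<close>)
  from has_derivative_unique[OF this has_derivative_const] have "(\<Sum>i\<in>UNIV. z $ i * partial_deriv i \<phi> x) = 0" for z
    by (simp add: fun_eq_iff)
  from this[of "axis j 1"] show ?thesis
    by (simp add: axis_def if_distrib[of "\<lambda>x. x * _"] cong: if_cong)
qed

lemma test_fun_partial_deriv:
  assumes "test_fun \<phi>" shows "test_fun (partial_deriv j \<phi>)"
proof -
  obtain S where S: "compact S" "\<And>x. x \<notin> S \<Longrightarrow> \<phi> x = 0" using test_fun_support[OF assms] by blast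
  show ?thesis
    by (rule test_funI[OF Ck_SucD(2)[OF test_fun_Ck[OF assms]] _ S(1)])
       (rule partial_deriv_outside[OF test_fun_Ck[OF assms] compact_imp_closed[OF S(1)] S(2)])
qed

lemma integral_partial_deriv:
  assumes "test_fun \<phi>" shows "(\<integral>x. partial_deriv j \<phi> x \<partial>lborel) = 0"
proof -
  have t: "test_fun (partial_deriv j \<phi>)" by (rule test_fun_partial_deriv[OF assms])
  obtain S S' where S: "compact S" "\<And>x. x \<notin> S \<Longrightarrow> \<phi> x = 0" "compact S'" "\<And>x. x \<notin> S' \<Longrightarrow> partial_deriv j \<phi> x = 0"
    using test_fun_support[OF assms] test_fun_support[OF t] by metis
  have "ld (axis j 1) \<phi> (partial_deriv j \<phi>)"
    using Ck_ld[OF test_fun_Ck[OF assms], of "axis j 1"]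
    by (simp add: axis_def if_distrib[of "\<lambda>x. x * _"] cong: if_cong)
  then show ?thesis
    by (rule integral_line_derivative[rotated -1, where S="S \<union> S'"])
       (use S Ck_continuous[OF test_fun_Ck[OF assms, of 0]] Ck_continuous[OF test_fun_Ck[OF t, of 0]] in auto)
qed

text \<open>The function \<open>g\<close> is merely integrable, so the derivative goes onto the
  kernel. Its difference quotients are uniformly bounded, hence dominated convergence applies with a
  multiple of \<open>\<bar>g\<bar>\<close>.\<close>

lemma has_ld_conv:
  assumes "loc g" "ker k" "\<And>i. ker (partial_deriv i k)"
  shows "ld a (conv g k) (\<lambda>x. \<Sum>i\<in>UNIV. a $ i * conv g (partial_deriv i k) x)"
  unfolding ld_def
proof (intro allI)
  fix x t
  define D where "D z = (\<Sum>i\<in>UNIV. a $ i * partial_deriv i k z)" for z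
  have "test_fun k" using assms(2) by (simp add: ker_def)
  then have D: "ld a k D" unfolding D_def[abs_def] by (intro Ck_ld test_fun_Ck)
  have Dcs: "cs D" unfolding D_def by (intro cs_sum cs_cmult ker_cs assms)
  obtain B where B: "0 \<le> B" "\<And>x. \<bar>D x\<bar> \<le> B" using cs_bounded[OF Dcs] by blast
  note [measurable] = loc_borel[OF assms(1)] ker_borel[OF assms(2)] cs_borel[OF Dcs]
  have "((\<lambda>h. (conv g k (x + (t + h) *\<^sub>R a) - conv g k (x + t *\<^sub>R a)) / h) \<longlongrightarrow> (\<integral>y. g y * D (x + t *\<^sub>R a - y) \<partial>lborel)) (at 0)"
    unfolding tendsto_at_iff_sequentially comp_def
  proof (intro allI impI)
    fix X :: "nat \<Rightarrow> real" assume X: "\<forall>i. X i \<in> UNIV - {0}" "X \<longlonglongrightarrow> 0"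
    have "(\<lambda>n. \<integral>y. g y * ((k (x + t *\<^sub>R a - y + X n *\<^sub>R a) - k (x + t *\<^sub>R a - y)) / X n) \<partial>lborel)
       \<longlonglongrightarrow> (\<integral>y. g y * D (x + t *\<^sub>R a - y) \<partial>lborel)"
    proof (rule integral_dominated_convergence[where w="\<lambda>y. B * \<bar>g y\<bar>"])
      show "integrable lborel (\<lambda>y. B * \<bar>g y\<bar>)" using assms by (simp add: loc_def)
      show "AE y in lborel. (\<lambda>n. g y * ((k (x + t *\<^sub>R a - y + X n *\<^sub>R a) - k (x + t *\<^sub>R a - y)) / X n))
        \<longlonglongrightarrow> g y * D (x + t *\<^sub>R a - y)"
      proof (intro AE_I2 tendsto_intros)
        fix y
        have "((\<lambda>s. k ((x + t *\<^sub>R a - y) + s *\<^sub>R a)) has_real_derivative D ((x + t *\<^sub>R a - y) + 0 *\<^sub>R a)) (at 0)"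
          using D unfolding ld_def by blast
        then have "((\<lambda>h. (k (x + t *\<^sub>R a - y + h *\<^sub>R a) - k (x + t *\<^sub>R a - y)) / h) \<longlongrightarrow> D (x + t *\<^sub>R a - y)) (at 0)"
          by (simp add: DERIV_def)
        then show "(\<lambda>n. (k (x + t *\<^sub>R a - y + X n *\<^sub>R a) - k (x + t *\<^sub>R a - y)) / X n) \<longlonglongrightarrow> D (x + t *\<^sub>R a - y)"
          by (rule filterlim_compose) (use X in \<open>auto simp: filterlim_at\<close>)
      qed
      show "AE y in lborel. norm (g y * ((k (x + t *\<^sub>R a - y + X n *\<^sub>R a) - k (x + t *\<^sub>R a - y)) / X n)) \<le> B * \<bar>g y\<bar>" for n
      proof (rule AE_I2)
        fix y
        have "\<bar>(k (x + t *\<^sub>R a - y + X n *\<^sub>R a) - k (x + t *\<^sub>R a - y)) / X n\<bar> \<le> B"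
          using ld_mvt[OF D B(2), of "x + t *\<^sub>R a - y" "X n"] X(1) by (auto simp: divide_simps)
        then show "norm (g y * ((k (x + t *\<^sub>R a - y + X n *\<^sub>R a) - k (x + t *\<^sub>R a - y)) / X n)) \<le> B * \<bar>g y\<bar>"
          unfolding real_norm_def abs_mult mult.commute[of B] by (intro mult_left_mono) auto
      qed
    qed auto
    moreover have "(\<integral>y. g y * ((k (x + t *\<^sub>R a - y + X n *\<^sub>R a) - k (x + t *\<^sub>R a - y)) / X n) \<partial>lborel) =
      (conv g k (x + (t + X n) *\<^sub>R a) - conv g k (x + t *\<^sub>R a)) / X n" for n
    proof -
      have "(conv g k (x + (t + X n) *\<^sub>R a) - conv g k (x + t *\<^sub>R a)) =
         (\<integral>y. g y * k (x + (t + X n) *\<^sub>R a - y) - g y * k (x + t *\<^sub>R a - y) \<partial>lborel)"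
        unfolding conv_def by (subst Bochner_Integration.integral_diff) (auto intro: conv_integrable assms)
      then show ?thesis
        by (simp add: scaleR_add_left algebra_simps diff_divide_distrib flip: integral_divide_zero)
    qed
    ultimately show "(\<lambda>n. (conv g k (x + (t + X n) *\<^sub>R a) - conv g k (x + t *\<^sub>R a)) / X n) \<longlonglongrightarrow> (\<integral>y. g y * D (x + t *\<^sub>R a - y) \<partial>lborel)"
      by (simp only:)
  qed
  moreover have "(\<integral>y. g y * D (x + t *\<^sub>R a - y) \<partial>lborel) = (\<Sum>i\<in>UNIV. a $ i * conv g (partial_deriv i k) (x + t *\<^sub>R a))"
  proof -
    have "(\<integral>y. g y * D (x + t *\<^sub>R a - y) \<partial>lborel) = (\<integral>y. (\<Sum>i\<in>UNIV. a $ i * (g y * partial_deriv i k (x + t *\<^sub>R a - y))) \<partial>lborel)"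
      unfolding D_def by (simp add: sum_distrib_left mult_ac)
    also have "\<dots> = (\<Sum>i\<in>UNIV. a $ i * conv g (partial_deriv i k) (x + t *\<^sub>R a))"
      unfolding conv_def by (subst Bochner_Integration.integral_sum) (auto intro: conv_integrable assms)
    finally show ?thesis .
  qed
  ultimately show "((\<lambda>t. conv g k (x + t *\<^sub>R a)) has_real_derivative
           (\<Sum>i\<in>UNIV. a $ i * conv g (partial_deriv i k) (x + t *\<^sub>R a))) (at t)"
    by (simp add: DERIV_def)
qed

lemma conv_add: "loc f \<Longrightarrow> loc g \<Longrightarrow> ker k \<Longrightarrow> conv (\<lambda>x. f x + g x) k x = conv f k x + conv g k x"
  unfolding conv_def distrib_right by (rule Bochner_Integration.integral_add) (intro conv_integrable; assumption)+

lemma conv_cmult: "conv (\<lambda>x. c * f x) k x = c * conv f k x"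
  unfolding conv_def mult.assoc by simp

lemma loc_add: "loc f \<Longrightarrow> loc g \<Longrightarrow> loc (\<lambda>x. f x + g x)"
  and loc_diff: "loc f \<Longrightarrow> loc g \<Longrightarrow> loc (\<lambda>x. f x - g x)"
  and loc_cmult: "loc f \<Longrightarrow> loc (\<lambda>x. c * f x)"
  by (auto simp: loc_def)

text \<open>Young's convolution inequality. For fixed \<open>x\<close> the kernel is split into two
  square roots and Cauchy-Schwarz is applied; integrating in \<open>x\<close> with Tonelli's theorem
  produces the second factor \<open>N\<close>.\<close>

lemma young:
  assumes "loc g" "integrable lborel (\<lambda>x. (g x)\<^sup>2)" "ker k"
  shows "(\<integral>x. (conv g k x)\<^sup>2 \<partial>lborel) \<le> (\<integral>z. \<bar>k z\<bar> \<partial>lborel)\<^sup>2 * (\<integral>x. (g x)\<^sup>2 \<partial>lborel)"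
proof -
  note [measurable] = loc_borel[OF assms(1)] ker_borel[OF assms(3)]
  define N where "N = (\<integral>\<^sup>+z. ennreal \<bar>k z\<bar> \<partial>lborel)"
  have N: "N = ennreal (\<integral>z. \<bar>k z\<bar> \<partial>lborel)" unfolding N_def
    by (intro nn_integral_eq_integral cs_integrable cs_abs ker_cs assms) simp
  have pt: "ennreal ((conv g k x)\<^sup>2) \<le> N * (\<integral>\<^sup>+y. ennreal ((g y)\<^sup>2) * ennreal \<bar>k (x - y)\<bar> \<partial>lborel)" for x
  proof -
    have "ennreal \<bar>conv g k x\<bar> \<le> (\<integral>\<^sup>+y. ennreal (norm (g y * k (x - y))) \<partial>lborel)"
      unfolding conv_def using integral_norm_bound_ennreal[OF conv_integrable[OF assms(1,3)]] by simp
    also have "\<dots> = (\<integral>\<^sup>+y. ennreal (sqrt \<bar>k (x - y)\<bar>) * ennreal (\<bar>g y\<bar> * sqrt \<bar>k (x - y)\<bar>) \<partial>lborel)"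
      by (intro nn_integral_cong) (simp add: ennreal_mult'[symmetric] abs_mult mult_ac flip: power2_eq_square real_sqrt_mult)
    finally have "ennreal \<bar>conv g k x\<bar> ^ 2 \<le> (\<integral>\<^sup>+y. ennreal (sqrt \<bar>k (x - y)\<bar>) * ennreal (\<bar>g y\<bar> * sqrt \<bar>k (x - y)\<bar>) \<partial>lborel) ^ 2"
      by (rule power_mono) simp
    also have "\<dots> \<le> (\<integral>\<^sup>+y. ennreal (sqrt \<bar>k (x - y)\<bar>) ^ 2 \<partial>lborel) * (\<integral>\<^sup>+y. ennreal (\<bar>g y\<bar> * sqrt \<bar>k (x - y)\<bar>) ^ 2 \<partial>lborel)"
      by (rule Cauchy_Schwarz_nn_integral) auto
    also have "(\<integral>\<^sup>+y. ennreal (sqrt \<bar>k (x - y)\<bar>) ^ 2 \<partial>lborel) = N"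
      using nn_integral_lborel_isometry[of "-1" "\<lambda>z. ennreal \<bar>k z\<bar>" x] by (simp add: N_def ennreal_power)
    also have "(\<integral>\<^sup>+y. ennreal (\<bar>g y\<bar> * sqrt \<bar>k (x - y)\<bar>) ^ 2 \<partial>lborel) = (\<integral>\<^sup>+y. ennreal ((g y)\<^sup>2) * ennreal \<bar>k (x - y)\<bar> \<partial>lborel)"
      by (intro nn_integral_cong) (simp add: ennreal_power ennreal_mult'[symmetric] power_mult_distrib)
    finally show ?thesis by (simp add: ennreal_power)
  qed
  have "ennreal (\<integral>x. (conv g k x)\<^sup>2 \<partial>lborel) = (\<integral>\<^sup>+x. ennreal ((conv g k x)\<^sup>2) \<partial>lborel)"
    by (intro nn_integral_eq_integral[symmetric] cs_integrable cs_power2 cs_conv assms) simp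
  also have "\<dots> \<le> (\<integral>\<^sup>+x. N * (\<integral>\<^sup>+y. ennreal ((g y)\<^sup>2) * ennreal \<bar>k (x - y)\<bar> \<partial>lborel) \<partial>lborel)"
    by (intro nn_integral_mono pt)
  also have "\<dots> = N * (\<integral>\<^sup>+x. (\<integral>\<^sup>+y. ennreal ((g y)\<^sup>2) * ennreal \<bar>k (x - y)\<bar> \<partial>lborel) \<partial>lborel)"
    by (intro nn_integral_cmult) simp
  also have "(\<integral>\<^sup>+x. (\<integral>\<^sup>+y. ennreal ((g y)\<^sup>2) * ennreal \<bar>k (x - y)\<bar> \<partial>lborel) \<partial>lborel) =
      (\<integral>\<^sup>+y. (\<integral>\<^sup>+x. ennreal ((g y)\<^sup>2) * ennreal \<bar>k (x - y)\<bar> \<partial>lborel) \<partial>lborel)"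
    by (rule lborel_pair.Fubini'[symmetric]) (simp add: split_beta')
  also have "\<dots> = (\<integral>\<^sup>+y. ennreal ((g y)\<^sup>2) * N \<partial>lborel)"
  proof (rule nn_integral_cong)
    fix y
    have "(\<integral>\<^sup>+x. ennreal \<bar>k (x - y)\<bar> \<partial>lborel) = N"
      using nn_integral_lborel_add[of "\<lambda>z. ennreal \<bar>k z\<bar>" "-y"] by (simp add: N_def)
    then show "(\<integral>\<^sup>+x. ennreal ((g y)\<^sup>2) * ennreal \<bar>k (x - y)\<bar> \<partial>lborel) = ennreal ((g y)\<^sup>2) * N"
      by (simp add: nn_integral_cmult)
  qed
  also have "\<dots> = (\<integral>\<^sup>+y. ennreal ((g y)\<^sup>2) \<partial>lborel) * N" by (rule nn_integral_multc) simp
  also have "(\<integral>\<^sup>+y. ennreal ((g y)\<^sup>2) \<partial>lborel) = ennreal (\<integral>y. (g y)\<^sup>2 \<partial>lborel)"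
    by (intro nn_integral_eq_integral assms) simp
  finally have "ennreal (\<integral>x. (conv g k x)\<^sup>2 \<partial>lborel) \<le> ennreal ((\<integral>z. \<bar>k z\<bar> \<partial>lborel)\<^sup>2 * (\<integral>x. (g x)\<^sup>2 \<partial>lborel))"
    by (simp add: N ennreal_mult'[symmetric] power2_eq_square mult_ac)
  then show ?thesis by (simp add: ennreal_le_iff)
qed

lemma Basis_vec_axis: "(Basis :: (real^'n) set) = range (\<lambda>i. axis i 1)"
  by (auto simp: Basis_vec_def)

lemma inj_axis: "inj (\<lambda>i. axis i (1::real))"
  by (auto simp: inj_on_def axis_eq_axis)

section \<open>Anisotropic scaling and normalization of the mollifiers\<close>

lemma integral_diagonal_scaling:
  fixes f :: "real^'n \<Rightarrow> real"
  assumes "\<And>i. 0 < h i" "f \<in> borel_measurable borel"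
  shows "(\<integral>x. f x \<partial>lborel) = (\<Prod>i\<in>UNIV. h i) * (\<integral>x. f (\<chi> i. h i * x $ i) \<partial>lborel)"
proof -
  define c where "c b = (\<chi> i. h i) \<bullet> b" for b :: "real^'n"
  have c: "c (axis i 1) = h i" for i by (simp add: c_def inner_axis)
  have cpos: "c b \<noteq> 0" if "b \<in> Basis" for b
    using that assms(1) by (auto simp: Basis_vec_axis c) (metis less_irrefl)
  have T: "0 + (\<Sum>b\<in>Basis. (c b * (x \<bullet> b)) *\<^sub>R b) = (\<chi> i. h i * x $ i)" for x :: "real^'n"
  proof -
    have "(\<Sum>b\<in>Basis. (c b * (x \<bullet> b)) *\<^sub>R b) = (\<Sum>i\<in>UNIV. (h i * x $ i) *\<^sub>R axis i 1)"
      unfolding Basis_vec_axis by (subst sum.reindex[OF inj_axis]) (simp add: c inner_axis)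
    also have "\<dots> = (\<chi> i. h i * x $ i)"
      using basis_expansion[of "\<chi> i. h i * x $ i"] by (simp add: scalar_mult_eq_scaleR)
    finally show ?thesis by simp
  qed
  have p: "(\<Prod>b\<in>(Basis :: (real^'n) set). \<bar>c b\<bar>) = (\<Prod>i\<in>UNIV. h i)"
    unfolding Basis_vec_axis by (subst prod.reindex[OF inj_axis]) (use assms(1) in \<open>auto simp: c less_imp_le intro!: prod.cong\<close>)
  have p0: "0 < (\<Prod>i\<in>UNIV. h i)" using assms(1) by (intro prod_pos) auto
  have meas: "(\<lambda>x. (\<chi> i. h i * x $ i) :: real^'n) \<in> borel \<rightarrow>\<^sub>M borel"
    by (intro borel_measurable_continuous_onI continuous_intros)
  have "lborel = density (distr lborel borel (\<lambda>x. (\<chi> i. h i * x $ i) :: real^'n)) (\<lambda>_. ennreal (\<Prod>i\<in>UNIV. h i))"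
    using lborel_affine_euclidean[of c 0, OF cpos] unfolding T p .
  then have "(\<integral>x. f x \<partial>lborel) = (\<integral>x. f x \<partial>density (distr lborel borel (\<lambda>x. (\<chi> i. h i * x $ i) :: real^'n)) (\<lambda>_. ennreal (\<Prod>i\<in>UNIV. h i)))"
    by simp
  also have "\<dots> = (\<Prod>i\<in>UNIV. h i) * (\<integral>x. f (\<chi> i. h i * x $ i) \<partial>lborel)"
    using p0 meas assms(2) by (subst integral_density) (auto simp: integral_distr intro!: less_imp_le)
  finally show ?thesis .
qed

lemma kern_scaling:
  assumes "\<And>i. 0 < h i"
  shows "kern h a (\<chi> i. h i * x $ i) = kern (\<lambda>_. 1) a x / (\<Prod>i\<in>UNIV. h i ^ Suc (a i))"
  unfolding kern_def using less_imp_neq[OF assms] by (simp add: prod_dividef)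

lemma ker_kern:
  assumes "\<And>i. 0 < h i" "\<And>i. h i \<le> 1" shows "ker (kern h a)"
  unfolding ker_def
proof (intro conjI allI impI)
  show "test_fun (kern h a)" by (rule test_fun_kern) (rule assms)
  fix z i assume "kern h a z \<noteq> 0"
  then have "\<bar>z $ i\<bar> \<le> h i" using kern_outside[of h z a, OF assms(1)] by auto
  then show "\<bar>z $ i\<bar> \<le> 1" using assms(2)[of i] by simp
qed

lemma integral_abs_kern:
  assumes "\<And>i. 0 < h i"
  shows "(\<integral>x. \<bar>kern h a x\<bar> \<partial>lborel) = (\<integral>x. \<bar>kern (\<lambda>_. 1) a x :: real\<bar> \<partial>(lborel :: (real^'n) measure)) / (\<Prod>i\<in>UNIV. h i ^ a i)"
proof -
  have m: "kern h a \<in> borel_measurable borel" by (intro borel_measurable_continuous_onI continuous_kern)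
  have p0: "0 < (\<Prod>i\<in>UNIV. h i ^ Suc (a i))" "0 < (\<Prod>i\<in>UNIV. h i)"
    using assms by (auto intro!: prod_pos)
  have eq: "(\<Prod>i\<in>UNIV. h i ^ Suc (a i)) = (\<Prod>i\<in>UNIV. h i) * (\<Prod>i\<in>UNIV. h i ^ a i)"
    by (simp add: prod.distrib)
  have "(\<integral>x. \<bar>kern h a x\<bar> \<partial>lborel) = (\<Prod>i\<in>UNIV. h i) * (\<integral>x. \<bar>kern (\<lambda>_. 1) a x\<bar> / (\<Prod>i\<in>UNIV. h i ^ Suc (a i)) \<partial>(lborel :: (real^'n) measure))"
    using m p0(1) by (subst integral_diagonal_scaling[of h, OF assms]) (auto simp only: kern_scaling[OF assms] abs_divide abs_of_pos borel_measurable_abs)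
  also have "\<dots> = (\<Prod>i\<in>UNIV. h i) * ((\<integral>x. \<bar>kern (\<lambda>_. 1) a x\<bar> \<partial>(lborel :: (real^'n) measure)) / ((\<Prod>i\<in>UNIV. h i) * (\<Prod>i\<in>UNIV. h i ^ a i)))"
    by (simp only: integral_divide_zero eq)
  also have "\<dots> = (\<integral>x. \<bar>kern (\<lambda>_. 1) a x\<bar> \<partial>(lborel :: (real^'n) measure)) / (\<Prod>i\<in>UNIV. h i ^ a i)"
    by (simp only: times_divide_eq_right mult_divide_mult_cancel_left[OF less_imp_neq[OF p0(2), symmetric]])
  finally show ?thesis .
qed

definition kern_mass :: "'n::finite itself \<Rightarrow> real" where
  "kern_mass _ = (\<integral>x. kern (\<lambda>_. 1) (\<lambda>_. 0) x \<partial>(lborel :: (real^'n) measure))"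

lemma kern_mass_pos: "0 < kern_mass TYPE('n::finite)"
proof -
  let ?k = "kern (\<lambda>_. 1) (\<lambda>_. 0) :: real^'n \<Rightarrow> real"
  have k: "ker ?k" by (rule ker_kern) auto
  have int: "integrable lborel ?k" by (intro cs_integrable ker_cs k)
  have nn: "0 \<le> ?k x" for x by (rule kern_nonneg) simp
  have "kern_mass TYPE('n) \<noteq> 0"
  proof
    assume "kern_mass TYPE('n) = 0"
    then have "AE x in lborel. ?k x = 0"
      using integral_nonneg_eq_0_iff_AE[OF int] nn by (simp add: kern_mass_def)
    then have "AE x in lborel. x \<notin> box (-1) (1::real^'n)"
    proof eventually_elim
      case (elim x)
      show ?case
      proof
        assume "x \<in> box (-1) 1"
        then have "0 < ?k x" by (intro kern_pos) (auto simp: mem_box_cart abs_less_iff minus_less_iff)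
        with elim show False by simp
      qed
    qed
    then have "emeasure lborel (box (-1) (1::real^'n)) = 0"
      by (subst (asm) AE_iff_measurable[OF _ refl]) auto
    moreover have "0 < emeasure lborel (box (-1) (1::real^'n))"
      by (subst emeasure_lborel_box) (auto simp: Basis_vec_axis inner_axis intro!: prod_pos ennreal_less_zero_iff[THEN iffD2])
    ultimately show False by simp
  qed
  moreover have "0 \<le> kern_mass TYPE('n)" unfolding kern_mass_def by (simp add: nn)
  ultimately show ?thesis by (simp add: less_le)
qed

definition mol :: "('n \<Rightarrow> real) \<Rightarrow> ('n \<Rightarrow> nat) \<Rightarrow> real^'n \<Rightarrow> real" where
  "mol h a x = inverse (kern_mass TYPE('n)) * kern h a x"

context
  fixes h :: "'n::finite \<Rightarrow> real"
  assumes h: "\<And>i. 0 < h i" "\<And>i. h i \<le> 1"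
begin

lemma ker_mol: "ker (mol h a)"
proof -
  have "test_fun (\<lambda>x. kern h a x * inverse (kern_mass TYPE('n)))"
    using ker_kern[of h a, OF h] by (intro test_fun_mult_Ck Ck_const) (auto simp: ker_def)
  then show ?thesis using ker_kern[of h a, OF h] by (auto simp: ker_def mol_def[abs_def] mult.commute)
qed

lemma partial_deriv_mol: "partial_deriv j (mol h a) = mol h (up j a)"
proof
  fix x
  have "(mol h a has_derivative (\<lambda>z. inverse (kern_mass TYPE('n)) * (\<Sum>i\<in>UNIV. z $ i * kern h (up i a) x))) (at x)"
    unfolding mol_def[abs_def] by (intro has_derivative_mult_right kern_derivative h)
  then show "partial_deriv j (mol h a) x = mol h (up j a) x"
    unfolding partial_derivI[OF \<open>(mol h a has_derivative _) _\<close>]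
    by (simp add: mol_def axis_def if_distrib[of "\<lambda>x. x * _"] cong: if_cong)
qed

lemma ker_partial_deriv_mol: "ker (partial_deriv i (mol h a))"
  by (simp add: partial_deriv_mol ker_mol)

lemma mol_nonneg: "0 \<le> mol h (\<lambda>_. 0) x"
  using kern_nonneg[of h x] h kern_mass_pos[where 'n='n] by (auto simp: mol_def intro!: mult_nonneg_nonneg)

lemma mol_support: "mol h a x \<noteq> 0 \<Longrightarrow> \<bar>x $ i\<bar> \<le> h i"
  using kern_outside[of h x a, OF h(1)] by (auto simp: mol_def)

lemma integral_mol: "(\<integral>x. mol h (\<lambda>_. 0) x \<partial>lborel) = 1"
proof -
  have "(\<integral>x. mol h (\<lambda>_. 0) x \<partial>lborel) = inverse (kern_mass TYPE('n)) * (\<integral>x. \<bar>kern h (\<lambda>_. 0) x\<bar> \<partial>lborel)"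
    using kern_nonneg[of h] h by (simp add: mol_def)
  also have "(\<integral>x. \<bar>kern h (\<lambda>_. 0) x\<bar> \<partial>lborel) = kern_mass TYPE('n)"
    using integral_abs_kern[of h "\<lambda>_. 0", OF h(1)] kern_nonneg[of "\<lambda>_. 1" "_ :: real^'n"] by (simp add: kern_mass_def)
  finally show ?thesis using kern_mass_pos[where 'n='n] by simp
qed

end

text \<open>A common majorant for the \<open>L^1\<close> norms of the first and second derivatives
  of the unit mollifier; all are added up so that it serves for every pair of indices.\<close>

definition mol_const :: "'n::finite itself \<Rightarrow> real" where
  "mol_const _ = 1 + (\<Sum>i\<in>UNIV. \<integral>x. \<bar>mol (\<lambda>_. 1) (up i (\<lambda>_. 0)) x\<bar> \<partial>(lborel :: (real^'n) measure))
    + (\<Sum>i\<in>UNIV. \<Sum>j\<in>UNIV. \<integral>x. \<bar>mol (\<lambda>_. 1) (up i (up j (\<lambda>_. 0))) x\<bar> \<partial>(lborel :: (real^'n) measure))"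

lemma mol_const_ge:
  shows "1 \<le> mol_const TYPE('n::finite)"
    "(\<integral>x. \<bar>mol (\<lambda>_. 1) (up i (\<lambda>_. 0)) x\<bar> \<partial>(lborel :: (real^'n) measure)) \<le> mol_const TYPE('n)"
    "(\<integral>x. \<bar>mol (\<lambda>_. 1) (up i (up j (\<lambda>_. 0))) x\<bar> \<partial>(lborel :: (real^'n) measure)) \<le> mol_const TYPE('n)"
proof -
  define N where "N a = (\<integral>x. \<bar>mol (\<lambda>_. 1) a x\<bar> \<partial>(lborel :: (real^'n) measure))" for a
  have N: "0 \<le> N a" for a by (simp add: N_def)
  have 1: "0 \<le> (\<Sum>i\<in>UNIV. N (up i (\<lambda>_. 0)))" "0 \<le> (\<Sum>i\<in>UNIV. \<Sum>j\<in>UNIV. N (up i (up j (\<lambda>_. 0))))"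
    by (auto intro!: sum_nonneg N)
  have 2: "N (up i (\<lambda>_. 0)) \<le> (\<Sum>i\<in>UNIV. N (up i (\<lambda>_. 0)))"
    by (rule member_le_sum) (auto simp: N)
  have "N (up i (up j (\<lambda>_. 0))) \<le> (\<Sum>j\<in>UNIV. N (up i (up j (\<lambda>_. 0))))"
    by (rule member_le_sum) (auto simp: N)
  also have "\<dots> \<le> (\<Sum>i\<in>UNIV. \<Sum>j\<in>UNIV. N (up i (up j (\<lambda>_. 0))))"
    by (rule member_le_sum[of i UNIV "\<lambda>i. \<Sum>j\<in>UNIV. N (up i (up j (\<lambda>_. 0)))"]) (auto simp: N intro: sum_nonneg)
  finally have 3: "N (up i (up j (\<lambda>_. 0))) \<le> (\<Sum>i\<in>UNIV. \<Sum>j\<in>UNIV. N (up i (up j (\<lambda>_. 0))))" .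
  have eq: "mol_const TYPE('n) = 1 + (\<Sum>i\<in>UNIV. N (up i (\<lambda>_. 0))) + (\<Sum>i\<in>UNIV. \<Sum>j\<in>UNIV. N (up i (up j (\<lambda>_. 0))))"
    by (simp add: mol_const_def N_def)
  show "1 \<le> mol_const TYPE('n)" using 1 unfolding eq by linarith
  show "(\<integral>x. \<bar>mol (\<lambda>_. 1) (up i (\<lambda>_. 0)) x\<bar> \<partial>(lborel :: (real^'n) measure)) \<le> mol_const TYPE('n)"
    using 1 2 unfolding eq N_def[symmetric] by linarith
  show "(\<integral>x. \<bar>mol (\<lambda>_. 1) (up i (up j (\<lambda>_. 0))) x\<bar> \<partial>(lborel :: (real^'n) measure)) \<le> mol_const TYPE('n)"
    using 1 3 unfolding eq N_def[symmetric] by linarith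
qed

lemma prod_up: fixes h :: "'n::finite \<Rightarrow> real" shows "(\<Prod>l\<in>UNIV. h l ^ up i a l) = h i * (\<Prod>l\<in>UNIV. h l ^ a l)"
proof -
  have "(\<Prod>l\<in>UNIV. h l ^ up i a l) = h i ^ up i a i * (\<Prod>l\<in>UNIV - {i}. h l ^ up i a l)"
    by (rule prod.remove) auto
  also have "(\<Prod>l\<in>UNIV - {i}. h l ^ up i a l) = (\<Prod>l\<in>UNIV - {i}. h l ^ a l)"
    by (rule prod.cong) (auto simp: up_def)
  also have "h i ^ up i a i * \<dots> = h i * (h i ^ a i * (\<Prod>l\<in>UNIV - {i}. h l ^ a l))"
    by (simp add: up_same)
  also have "h i ^ a i * (\<Prod>l\<in>UNIV - {i}. h l ^ a l) = (\<Prod>l\<in>UNIV. h l ^ a l)"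
    by (rule prod.remove[symmetric]) auto
  finally show ?thesis .
qed

lemma integral_abs_mol:
  fixes h :: "'n::finite \<Rightarrow> real"
  assumes "\<And>i. 0 < h i"
  shows "(\<integral>x. \<bar>mol h a x\<bar> \<partial>lborel) = (\<integral>x. \<bar>mol (\<lambda>_. 1) a x\<bar> \<partial>(lborel :: (real^'n) measure)) / (\<Prod>i\<in>UNIV. h i ^ a i)"
  using integral_abs_kern[of h a, OF assms] by (simp add: mol_def abs_mult)

text \<open>Young's inequality combined with scaling: a derivative in coordinate \<open>i\<close>
  costs one factor \<open>1 / h i\<close>, and no other side length of the box enters.\<close>

lemma integral_conv_mol_square:
  fixes h :: "'n::finite \<Rightarrow> real"
  assumes h: "\<And>i. 0 < h i" "\<And>i. h i \<le> 1"
    and g: "loc g" "integrable lborel (\<lambda>x. (g x)\<^sup>2)" "(\<integral>x. (g x)\<^sup>2 \<partial>lborel) \<le> D"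
  defines "C \<equiv> mol_const TYPE('n)"
  shows "(\<integral>x. (conv g (mol h (\<lambda>_. 0)) x)\<^sup>2 \<partial>lborel) \<le> D"
    and "(\<integral>x. (conv g (mol h (up i (\<lambda>_. 0))) x)\<^sup>2 \<partial>lborel) \<le> C\<^sup>2 * D / (h i)\<^sup>2"
    and "(\<integral>x. (conv g (mol h (up i (up j (\<lambda>_. 0)))) x)\<^sup>2 \<partial>lborel) \<le> C\<^sup>2 * D / (h i * h j)\<^sup>2"
proof -
  have "0 \<le> (\<integral>x. (g x)\<^sup>2 \<partial>lborel)" by simp
  with g(3) have D: "0 \<le> D" by linarith
  have *: "(\<integral>x. (conv g (mol h a) x)\<^sup>2 \<partial>lborel) \<le> K\<^sup>2 * D" if "(\<integral>x. \<bar>mol h a x\<bar> \<partial>lborel) \<le> K" for a K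
  proof -
    have "(\<integral>x. (conv g (mol h a) x)\<^sup>2 \<partial>lborel) \<le> (\<integral>z. \<bar>mol h a z\<bar> \<partial>lborel)\<^sup>2 * (\<integral>x. (g x)\<^sup>2 \<partial>lborel)"
      by (intro young g ker_mol h)
    also have "\<dots> \<le> K\<^sup>2 * D" using that g(3) D by (intro mult_mono power_mono) auto
    finally show ?thesis .
  qed
  have "(\<integral>x. \<bar>mol h (\<lambda>_. 0) x\<bar> \<partial>lborel) \<le> 1" using mol_nonneg[of h] integral_mol[of h] h by simp
  from *[OF this] show "(\<integral>x. (conv g (mol h (\<lambda>_. 0)) x)\<^sup>2 \<partial>lborel) \<le> D" by simp
  have "(\<integral>x. \<bar>mol h (up i (\<lambda>_. 0)) x\<bar> \<partial>lborel) \<le> C / h i"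
    unfolding integral_abs_mol[of h, OF h(1)] prod_up
    using mol_const_ge(2)[of i] h(1)[of i] by (simp add: C_def divide_right_mono less_imp_le)
  from *[OF this] show "(\<integral>x. (conv g (mol h (up i (\<lambda>_. 0))) x)\<^sup>2 \<partial>lborel) \<le> C\<^sup>2 * D / (h i)\<^sup>2"
    by (simp add: power_divide)
  have "(\<integral>x. \<bar>mol h (up i (up j (\<lambda>_. 0))) x\<bar> \<partial>lborel) \<le> C / (h i * h j)"
    unfolding integral_abs_mol[of h, OF h(1)] prod_up
    using mol_const_ge(3)[of i j] h(1)[of i] h(1)[of j] by (simp add: C_def divide_right_mono less_imp_le)
  from *[OF this] show "(\<integral>x. (conv g (mol h (up i (up j (\<lambda>_. 0)))) x)\<^sup>2 \<partial>lborel) \<le> C\<^sup>2 * D / (h i * h j)\<^sup>2"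
    by (simp add: power_divide power_mult_distrib)
qed

section \<open>Mollified displacements\<close>

abbreviation nsq :: "(real^'n \<Rightarrow> real) \<Rightarrow> real" where
  "nsq g \<equiv> (\<integral>x. (g x)\<^sup>2 \<partial>lborel)"

lemma nsq_add: "cs f \<Longrightarrow> cs g \<Longrightarrow> nsq (\<lambda>x. f x + g x) \<le> 2 * nsq f + 2 * nsq g"
proof -
  assume cs: "cs f" "cs g"
  have "nsq (\<lambda>x. f x + g x) \<le> (\<integral>x. 2 * (f x)\<^sup>2 + 2 * (g x)\<^sup>2 \<partial>lborel)"
  proof (intro integral_mono cs_integrable cs_intros cs)
    fix x show "(f x + g x)\<^sup>2 \<le> 2 * (f x)\<^sup>2 + 2 * (g x)\<^sup>2"
      using sum_squares_ge_zero[of "f x - g x" 0] by (simp add: power2_eq_square algebra_simps)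
  qed
  also have "\<dots> = 2 * nsq f + 2 * nsq g"
    by (subst Bochner_Integration.integral_add) (auto intro!: cs_integrable cs_intros cs)
  finally show ?thesis .
qed

lemma nsq_cmult: "nsq (\<lambda>x. c * f x) = c\<^sup>2 * nsq f"
  by (simp add: power_mult_distrib)

lemma nsq_nonneg: "0 \<le> nsq f"
  by simp

lemma nsq_diff: "cs f \<Longrightarrow> cs g \<Longrightarrow> nsq (\<lambda>x. f x - g x) \<le> 2 * nsq f + 2 * nsq g"
  using nsq_add[of f "\<lambda>x. (-1) * g x"] cs_cmult[of g "-1"] by simp

lemma nsq_cong: "(\<And>x. f x = g x) \<Longrightarrow> nsq f = nsq g"
  by (simp add: fun_eq_iff)

text \<open>In the application \<open>v\<close> is the displacement minus its affine boundary datum, \<open>M\<close> its weak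
  gradient, and \<open>f\<close> the diagonal of the deviation of the phase function from the boundary datum.\<close>

locale strain =
  fixes v :: "'n::finite \<Rightarrow> real^'n \<Rightarrow> real" and M :: "'n \<Rightarrow> 'n \<Rightarrow> real^'n \<Rightarrow> real"
    and f :: "'n \<Rightarrow> real^'n \<Rightarrow> real" and D :: real
  fixes e :: "'n \<Rightarrow> 'n \<Rightarrow> real^'n \<Rightarrow> real"
  defines "e \<equiv> \<lambda>i j x. (M i j x + M j i x) / 2 - (if i = j then f i x else 0)"
  assumes loc_v: "loc (v i)" and loc_M: "loc (M i j)" and loc_f: "loc (f i)"
    and weak: "test_fun \<phi> \<Longrightarrow> (\<integral>x. v i x * partial_deriv j \<phi> x \<partial>lborel) = - (\<integral>x. M i j x * \<phi> x \<partial>lborel)"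
    and e_integrable: "integrable lborel (\<lambda>x. (e i j x)\<^sup>2)" and e_le: "nsq (e i j) \<le> D"
begin

lemma loc_e: "loc (e i j)"
proof -
  have "e i j = (\<lambda>x. (1/2) * (M i j x + M j i x) - (if i = j then 1 else 0) * f i x)"
    by (auto simp: e_def fun_eq_iff)
  then show ?thesis by (simp only: loc_diff loc_cmult loc_add loc_M loc_f)
qed

text \<open>The weak formulation is tested with the reflected kernel
  \<open>y \<mapsto> k (x - y)\<close>; the sign from the reflection cancels the one from
  integration by parts.\<close>

lemma conv_gradient:
  assumes "ker k" shows "conv (v i) (partial_deriv j k) x = conv (M i j) k x"
proof -
  have k: "test_fun k" using assms by (simp add: ker_def)
  have "test_fun (\<lambda>y. k (x + (-1) *\<^sub>R y))" by (rule test_fun_affine[OF k]) simp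
  from weak[OF this, of i j] show ?thesis
    by (simp add: partial_deriv_affine[OF test_fun_Ck[OF k], where c=x and s="-1", simplified] conv_def)
qed

end

locale mollified_strain = strain v M f D e
  for v :: "'n::finite \<Rightarrow> real^'n \<Rightarrow> real" and M f D e +
  fixes h :: "'n \<Rightarrow> real" and C :: real
  defines "C \<equiv> mol_const TYPE('n)"
  assumes h_pos: "0 < h i" and h_le: "h i \<le> 1"
begin

abbreviation "k0 \<equiv> (\<lambda>_. 0) :: 'n \<Rightarrow> nat"
abbreviation "k1 i \<equiv> up i k0"
abbreviation "k2 i j \<equiv> up i (up j k0)"

text \<open>The four families are the mollified displacement, gradient, error and phase entries. The
  last argument counts derivatives: applying \<open>up j\<close> to it differentiates in coordinate
  \<open>j\<close>, so for example \<open>V i (k1 j)\<close> is an entry of the mollified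
  gradient.\<close>

definition "V i a = conv (v i) (mol h a)"
definition "G i j a = conv (M i j) (mol h a)"
definition "E i j a = conv (e i j) (mol h a)"
definition "P i a = conv (f i) (mol h a)"

lemma ker_h: "ker (mol h a)"
  using ker_mol[of h a] h_pos h_le by simp

lemma cs_all [intro]: "cs (V i a)" "cs (G i j a)" "cs (E i j a)" "cs (P i a)"
  unfolding V_def G_def E_def P_def by (intro cs_conv loc_v loc_M loc_e loc_f ker_h)+

lemma D_nonneg: "0 \<le> D"
  using e_le nsq_nonneg order_trans by blast

lemma V_up: "V i (up j a) x = G i j a x"
  using conv_gradient[OF ker_h, of i j a x] h_pos h_le by (simp add: V_def G_def partial_deriv_mol)

lemma G_sym: "G i j a x + G j i a x = 2 * E i j a x" if "i \<noteq> j"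
proof -
  have "(\<lambda>x. M i j x + M j i x) = (\<lambda>x. 2 * e i j x)" using that by (auto simp: e_def fun_eq_iff)
  then have "conv (\<lambda>x. M i j x + M j i x) (mol h a) x = conv (\<lambda>x. 2 * e i j x) (mol h a) x" by simp
  then show ?thesis by (simp add: G_def E_def conv_add loc_M ker_h conv_cmult)
qed

lemma G_diag: "G i i a x = P i a x + E i i a x"
proof -
  have "M i i = (\<lambda>x. f i x + e i i x)" by (auto simp: e_def fun_eq_iff)
  then have "conv (M i i) (mol h a) x = conv (\<lambda>x. f i x + e i i x) (mol h a) x" by simp
  then show ?thesis by (simp add: G_def E_def P_def conv_add loc_f loc_e ker_h)
qed

lemma P_cancel: "P i a x + P j a x = 0" if "\<And>x. f i x + f j x = 0"
proof -
  have "P i a x + P j a x = conv (\<lambda>x. f i x + f j x) (mol h a) x"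
    by (simp add: P_def conv_add loc_f ker_h)
  then show ?thesis using that by (simp add: conv_def)
qed

lemma ld_V: "ld a (V i b) (\<lambda>x. \<Sum>l\<in>UNIV. a $ l * V i (up l b) x)"
  using has_ld_conv[OF loc_v[of i] ker_h[of b] ker_partial_deriv_mol[of h _ b], of a] h_pos h_le
  by (simp add: V_def partial_deriv_mol)

lemma ld_V_axis: "ld (axis j 1) (V i b) (V i (up j b))"
  using ld_V[of "axis j 1" i b] by (simp add: axis_def if_distrib[of "\<lambda>x. x * _"] cong: if_cong)

lemma E_le: "nsq (E i j k0) \<le> D" "nsq (E i j (k1 l)) \<le> C\<^sup>2 * D / (h l)\<^sup>2"
  "nsq (E i j (k2 l m)) \<le> C\<^sup>2 * D / (h l * h m)\<^sup>2"
  unfolding E_def C_def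
  using integral_conv_mol_square[of h "e i j" D, OF h_pos h_le loc_e e_integrable e_le] by auto

lemma C_ge: "1 \<le> C" unfolding C_def by (rule mol_const_ge)

lemma D_le_scaled: "D \<le> C\<^sup>2 * D / (h i)\<^sup>2"
proof -
  have "D * (h i)\<^sup>2 \<le> D * 1" using h_pos[of i] h_le[of i] D_nonneg by (intro mult_left_mono) (auto simp: power_le_one)
  also have "D * 1 \<le> D * C\<^sup>2" using C_ge D_nonneg by (intro mult_left_mono one_le_power) auto
  finally show ?thesis using h_pos[of i] by (simp add: field_simps)
qed

text \<open>If the \<open>i\<close>-th and \<open>j\<close>-th diagonal entries cancel, then \<open>v\<^sub>i + v\<^sub>j\<close> and \<open>v\<^sub>i - v\<^sub>j\<close> have small
  derivatives in the directions \<open>e\<^sub>i + e\<^sub>j\<close> and \<open>e\<^sub>i - e\<^sub>j\<close> and are therefore small.\<close>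

lemma two_direction_estimate:
  assumes "i \<noteq> j" "\<And>x. f i x + f j x = 0"
  shows "nsq (P i k0) \<le> 800 * (C\<^sup>2 * D / (h i)\<^sup>2)"
proof -
  \<comment> \<open>Only derivatives in coordinate \<open>i\<close> will fall on the kernel, so the
    bound involves \<open>h i\<close> alone. The other side lengths stay free, which the anisotropic
    boxes for second order laminates exploit.\<close>
  define Q where "Q = C\<^sup>2 * D / (h i)\<^sup>2"
  have sm: "nsq (\<lambda>x. V i (k1 i) x + s * V j (k1 i) x) \<le> 320 * Q" if s: "\<bar>s\<bar> = 1" for s
  proof -
    define w where "w x = V i (k1 i) x + s * V j (k1 i) x" for x
    define w' where "w' x = E i i (k1 i) x + E j j (k1 i) x + (2 * s) * E i j (k1 i) x" for x
    have ss: "s * s = 1" using s by (auto simp: abs_if split: if_splits)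
    let ?a = "axis i 1 + s *\<^sub>R axis j (1::real)"
    have sum: "(\<Sum>l\<in>UNIV. ?a $ l * X l) = X i + s * X j" for X :: "'n \<Rightarrow> real"
      by (simp add: axis_def distrib_right sum.distrib if_distrib[of "\<lambda>x. _ * x"] if_distrib[of "\<lambda>x. x * _"] cong: if_cong)
    have "ld ?a w (\<lambda>x. (V i (up i (k1 i)) x + s * V i (up j (k1 i)) x) + s * (V j (up i (k1 i)) x + s * V j (up j (k1 i)) x))"
      unfolding w_def[abs_def] using ld_add[OF ld_V[of ?a i "k1 i"] ld_cmult[OF ld_V[of ?a j "k1 i"], of s]] unfolding sum .
    \<comment> \<open>As \<open>s * s = 1\<close>, the oblique derivative is the \<open>i\<close>-th
      derivative of \<open>G i i + G j j + s * (G i j + G j i)\<close>. The phases cancel in the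
      first two terms, and the off-diagonal sum consists of errors only.\<close>
    moreover have "(V i (up i (k1 i)) x + s * V i (up j (k1 i)) x) + s * (V j (up i (k1 i)) x + s * V j (up j (k1 i)) x) = w' x" for x
    proof -
      have "s * (s * V j (up j (k1 i)) x) = V j (up j (k1 i)) x" by (metis mult.assoc mult_1 ss)
      then have "(V i (up i (k1 i)) x + s * V i (up j (k1 i)) x) + s * (V j (up i (k1 i)) x + s * V j (up j (k1 i)) x)
         = G i i (k1 i) x + G j j (k1 i) x + s * (G i j (k1 i) x + G j i (k1 i) x)"
        by (simp add: V_up algebra_simps)
      also have "\<dots> = w' x"
        using P_cancel[OF assms(2), of "k1 i" x] unfolding G_sym[OF assms(1)] G_diag w'_def by simp
      finally show ?thesis .
    qed
    ultimately have "ld ?a w w'" by (simp add: fun_eq_iff)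
    moreover have csw: "cs w" "cs w'" unfolding w_def[abs_def] w'_def[abs_def] by (intro cs_intros cs_all)+
    moreover have "\<bar>?a $ i\<bar> = 1" using assms(1) by (simp add: axis_def)
    ultimately have "nsq w \<le> 16 * nsq w'" by (intro poincare)
    moreover have "nsq w' \<le> 16 * Q"
    proof -
      have "nsq w' \<le> 2 * nsq (\<lambda>x. E i i (k1 i) x + E j j (k1 i) x) + 2 * nsq (\<lambda>x. (2 * s) * E i j (k1 i) x)"
        unfolding w'_def by (intro nsq_add cs_intros cs_all)
      moreover have "nsq (\<lambda>x. E i i (k1 i) x + E j j (k1 i) x) \<le> 2 * nsq (E i i (k1 i)) + 2 * nsq (E j j (k1 i))"
        by (intro nsq_add cs_all)
      moreover have "nsq (\<lambda>x. (2 * s) * E i j (k1 i) x) = 4 * nsq (E i j (k1 i))"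
        unfolding nsq_cmult using ss by (simp add: power2_eq_square)
      ultimately show ?thesis using E_le(2)[of i i i] E_le(2)[of j j i] E_le(2)[of i j i] unfolding Q_def[symmetric] by linarith
    qed
    ultimately have "nsq w \<le> 320 * Q"
      using D_le_scaled[of i] D_nonneg unfolding Q_def[symmetric] by linarith
    then show ?thesis by (simp add: w_def)
  qed
  have "nsq (V i (k1 i)) = nsq (\<lambda>x. (1/2) * ((V i (k1 i) x + 1 * V j (k1 i) x) + (V i (k1 i) x + (-1) * V j (k1 i) x)))"
    by (rule nsq_cong) simp
  also have "\<dots> \<le> 320 * Q"
  proof -
    have "nsq (\<lambda>x. (V i (k1 i) x + 1 * V j (k1 i) x) + (V i (k1 i) x + (-1) * V j (k1 i) x))
       \<le> 2 * nsq (\<lambda>x. V i (k1 i) x + 1 * V j (k1 i) x) + 2 * nsq (\<lambda>x. V i (k1 i) x + (-1) * V j (k1 i) x)"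
      by (intro nsq_add cs_intros cs_all)
    then show ?thesis using sm[of 1] sm[of "-1"] unfolding nsq_cmult by (simp add: power2_eq_square)
  qed
  finally have V: "nsq (V i (k1 i)) \<le> 320 * Q" .
  have "nsq (P i k0) = nsq (\<lambda>x. V i (k1 i) x - E i i k0 x)"
    by (rule nsq_cong) (simp add: V_up G_diag)
  also have "\<dots> \<le> 2 * nsq (V i (k1 i)) + 2 * nsq (E i i k0)" by (intro nsq_diff cs_all)
  also have "\<dots> \<le> 800 * Q"
    using V E_le(1)[of i i] D_le_scaled[of i] D_nonneg unfolding Q_def[symmetric] by linarith
  finally show ?thesis by (simp add: Q_def)
qed

text \<open>If the entries \<open>j\<close> and \<open>l\<close> cancel, then \<open>w = \<partial>\<^sub>i v\<^sub>i\<close> satisfies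
  \<open>\<partial>\<^sub>j\<^sub>j w + \<partial>\<^sub>l\<^sub>l w = \<partial>\<^sub>i (2 \<partial>\<^sub>j e\<^sub>i\<^sub>j + 2 \<partial>\<^sub>l e\<^sub>i\<^sub>l) - \<partial>\<^sub>i\<^sub>i (e\<^sub>j\<^sub>j + e\<^sub>l\<^sub>l)\<close>, and this is tested with \<open>w\<close>.\<close>

lemma energy_identity:
  assumes "i \<noteq> j"
  shows "nsq (V i (k2 j i)) = 2 * (\<integral>x. V i (k2 j i) x * E i j (k1 i) x \<partial>lborel) + (\<integral>x. V i (k1 i) x * G j j (k2 i i) x \<partial>lborel)"
proof -
  have eq: "V i (k2 j i) x = 2 * E i j (k1 i) x - V j (k2 i i) x" for x
    using G_sym[OF assms, of "k1 i" x] by (simp add: V_up)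
  have "nsq (V i (k2 j i)) = (\<integral>x. 2 * (V i (k2 j i) x * E i j (k1 i) x) - V j (k2 i i) x * V i (k2 j i) x \<partial>lborel)"
  proof (intro Bochner_Integration.integral_cong refl)
    have "a\<^sup>2 = 2 * (a * e) - b * a" if "a = 2 * e - b" for a b e :: real
    proof -
      have "a * a = a * (2 * e - b)" using that by simp
      then show ?thesis by (simp add: power2_eq_square algebra_simps)
    qed
    from this[OF eq] show "(V i (k2 j i) x)\<^sup>2 = 2 * (V i (k2 j i) x * E i j (k1 i) x) - V j (k2 i i) x * V i (k2 j i) x" for x .
  qed
  also have "\<dots> = 2 * (\<integral>x. V i (k2 j i) x * E i j (k1 i) x \<partial>lborel) - (\<integral>x. V j (k2 i i) x * V i (k2 j i) x \<partial>lborel)"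
    by (subst Bochner_Integration.integral_diff) (auto intro!: cs_integrable cs_intros)
  also have "(\<integral>x. V j (k2 i i) x * V i (k2 j i) x \<partial>lborel) = - (\<integral>x. V j (up j (k2 i i)) x * V i (k1 i) x \<partial>lborel)"
    by (rule integration_by_parts[OF _ _ _ _ ld_V_axis ld_V_axis]) (rule cs_all)+
  finally show ?thesis by (simp add: V_up mult.commute)
qed

text \<open>This is the sum of the energy identities for \<open>j\<close> and \<open>l\<close>: the
  phases enter only through \<open>G j j + G l l\<close>, where they cancel. Young's inequality with
  weight 1/4 allows half of the left side to be absorbed.\<close>

lemma planar_energy:
  assumes "i \<noteq> j" "i \<noteq> l" "\<And>x. f j x + f l x = 0"
  shows "nsq (V i (k2 j i)) + nsq (V i (k2 l i)) \<le> 8 * (C\<^sup>2 * D / (h i)\<^sup>2)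
    + 2 * (\<integral>x. V i (k1 i) x * (E j j (k2 i i) x + E l l (k2 i i) x) \<partial>lborel)"
proof -
  define Q where "Q = C\<^sup>2 * D / (h i)\<^sup>2"
  have Y: "(\<integral>x. V i (k2 j' i) x * E i j' (k1 i) x \<partial>lborel) \<le> (1/4) * nsq (V i (k2 j' i)) + Q" for j'
    using cs_Cauchy_Schwarz_Young[of "V i (k2 j' i)" "E i j' (k1 i)" "1/4"] E_le(2)[of i j' i] cs_all
    unfolding Q_def[symmetric] by simp
  have "(\<integral>x. V i (k1 i) x * (E j j (k2 i i) x + E l l (k2 i i) x) \<partial>lborel)
    = (\<integral>x. V i (k1 i) x * G j j (k2 i i) x + V i (k1 i) x * G l l (k2 i i) x \<partial>lborel)"
  proof (intro Bochner_Integration.integral_cong refl)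
    fix x
    have "E j j (k2 i i) x + E l l (k2 i i) x = G j j (k2 i i) x + G l l (k2 i i) x"
      using P_cancel[OF assms(3), of "k2 i i" x] by (simp add: G_diag)
    then show "V i (k1 i) x * (E j j (k2 i i) x + E l l (k2 i i) x) = V i (k1 i) x * G j j (k2 i i) x + V i (k1 i) x * G l l (k2 i i) x"
      by (simp add: distrib_left)
  qed
  also have "\<dots> = (\<integral>x. V i (k1 i) x * G j j (k2 i i) x \<partial>lborel) + (\<integral>x. V i (k1 i) x * G l l (k2 i i) x \<partial>lborel)"
    by (rule Bochner_Integration.integral_add) (auto intro!: cs_integrable cs_intros)
  finally show ?thesis
    using energy_identity[OF assms(1)] energy_identity[OF assms(2)] Y[of j] Y[of l] unfolding Q_def[symmetric] by linarith
qed

lemma E_sum_le: "nsq (\<lambda>x. E j j (k2 i i) x + E l l (k2 i i) x) \<le> 4 * (C\<^sup>2 * D / (h i)^4)"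
proof -
  have "(h i * h i)\<^sup>2 = (h i)^4" by (simp add: power2_eq_square power4_eq_xxxx mult_ac)
  then have E3: "nsq (E a a (k2 i i)) \<le> C\<^sup>2 * D / (h i)^4" for a using E_le(3)[of a a i i] by simp
  have "nsq (\<lambda>x. E j j (k2 i i) x + E l l (k2 i i) x) \<le> 2 * nsq (E j j (k2 i i)) + 2 * nsq (E l l (k2 i i))"
    by (intro nsq_add cs_all)
  also have "\<dots> \<le> 2 * (C\<^sup>2 * D / (h i)^4) + 2 * (C\<^sup>2 * D / (h i)^4)"
    by (intro add_mono mult_left_mono E3) auto
  finally show ?thesis by (simp add: mult_ac)
qed

text \<open>The integral left over in \<open>planar_energy\<close> contains
  \<open>V i (k1 i)\<close> without transversal derivatives; the Poincare inequality in direction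
  \<open>j\<close> bounds that factor by the left side. The other factor has two derivatives in
  coordinate \<open>i\<close> on the kernel, whence \<open>(h i)^4\<close>.\<close>

lemma one_direction_estimate:
  assumes "i \<noteq> j" "i \<noteq> l" "\<And>x. f j x + f l x = 0"
  shows "nsq (P i k0) \<le> 9000 * (C\<^sup>2 * D / (h i)^4)"
proof -
  define Q where "Q = C\<^sup>2 * D / (h i)^4"
  have hh: "(h i)^4 \<le> (h i)\<^sup>2" using h_pos[of i] h_le[of i] by (intro power_decreasing) auto
  then have "C\<^sup>2 * D / (h i)\<^sup>2 \<le> Q" unfolding Q_def
    using D_nonneg h_pos[of i] by (intro divide_left_mono) auto
  then have Q: "C\<^sup>2 * D / (h i)\<^sup>2 \<le> Q" "D \<le> Q" using D_le_scaled[of i] by linarith+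
  have csE: "cs (\<lambda>x. E j j (k2 i i) x + E l l (k2 i i) x)" by (intro cs_intros cs_all)
  \<comment> \<open>With weight 1/64 the term returns with factor \<open>16 * 2 / 64 = 1/2\<close>
    after the Poincare inequality and can be absorbed.\<close>
  have "(\<integral>x. V i (k1 i) x * (E j j (k2 i i) x + E l l (k2 i i) x) \<partial>lborel) \<le> (1/64) * nsq (V i (k1 i)) + 64 * Q"
    using cs_Cauchy_Schwarz_Young[OF cs_all(1)[of i "k1 i"] csE, of "1/64"] E_sum_le[of j i l] unfolding Q_def by simp
  moreover have pw: "nsq (V i (k1 i)) \<le> 16 * nsq (V i (k2 j i))"
    by (rule poincare[OF _ _ ld_V_axis, of _ _ _ j]) (auto simp: axis_def)
  moreover note planar_energy[OF assms]
  ultimately have "nsq (V i (k1 i)) \<le> 4352 * Q"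
    using Q nsq_nonneg[of "V i (k2 l i)"] nsq_nonneg[of "V i (k2 j i)"] by linarith
  moreover have "nsq (P i k0) \<le> 2 * nsq (V i (k1 i)) + 2 * nsq (E i i k0)"
  proof -
    have "nsq (P i k0) = nsq (\<lambda>x. V i (k1 i) x - E i i k0 x)" by (rule nsq_cong) (simp add: V_up G_diag)
    also have "\<dots> \<le> 2 * nsq (V i (k1 i)) + 2 * nsq (E i i k0)" by (intro nsq_diff cs_all)
    finally show ?thesis .
  qed
  moreover have "nsq (E i i k0) \<le> Q" using E_le(1)[of i i] Q by simp
  moreover have "0 \<le> Q" using Q D_nonneg by simp
  ultimately have "nsq (P i k0) \<le> 9000 * Q" by linarith
  then show ?thesis by (simp add: Q_def)
qed

lemma nsq_P_translate:
  assumes "cs A" "\<And>x. G i i k0 x = A x"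
  shows "nsq (\<lambda>x. P i k0 (x + z) - P i k0 x) \<le> 2 * nsq (\<lambda>x. A (x + z) - A x) + 8 * D"
proof -
  have i: "integrable lborel (\<lambda>x. (g (x + z) - g x)\<^sup>2)" if "cs g" for g :: "real^'n \<Rightarrow> real"
    by (rule integrable_translate_diff_square[OF that])
  have csP: "cs (P i k0)" and csE: "cs (E i i k0)" by auto
  have "nsq (\<lambda>x. P i k0 (x + z) - P i k0 x) \<le>
    (\<integral>x. 2 * (A (x + z) - A x)\<^sup>2 + (4 * (E i i k0 (x + z))\<^sup>2 + 4 * (E i i k0 x)\<^sup>2) \<partial>lborel)"
  proof (intro integral_mono i csP Bochner_Integration.integrable_add integrable_mult_right assms(1)
      integrable_lborel_add[of "\<lambda>x. (E i i k0 x)\<^sup>2"] cs_integrable cs_power2 csE)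
    fix x
    have "P i k0 (x + z) - P i k0 x = (A (x + z) - A x) - (E i i k0 (x + z) - E i i k0 x)"
      using assms(2)[of x] assms(2)[of "x + z"] by (simp add: G_diag)
    moreover have "(a - (b - c))\<^sup>2 \<le> 2 * a\<^sup>2 + (4 * b\<^sup>2 + 4 * c\<^sup>2)" for a b c :: real
      using sum_squares_ge_zero[of "a + (b - c)" "b + c"] zero_le_power2[of "b + c"] by (simp add: power2_eq_square algebra_simps)
    ultimately show "(P i k0 (x + z) - P i k0 x)\<^sup>2 \<le> 2 * (A (x + z) - A x)\<^sup>2 + (4 * (E i i k0 (x + z))\<^sup>2 + 4 * (E i i k0 x)\<^sup>2)"
      by simp
  qed
  also have "\<dots> = 2 * nsq (\<lambda>x. A (x + z) - A x) + (4 * nsq (\<lambda>x. E i i k0 (x + z)) + 4 * nsq (E i i k0))"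
  proof -
    have "integrable lborel (\<lambda>x. (E i i k0 (x + z))\<^sup>2)"
      by (intro integrable_lborel_add[of "\<lambda>x. (E i i k0 x)\<^sup>2"] cs_integrable cs_power2 csE)
    then show ?thesis using i[OF assms(1)] cs_integrable[OF cs_power2[OF csE]] by simp
  qed
  also have "nsq (\<lambda>x. E i i k0 (x + z)) = nsq (E i i k0)"
    by (rule integral_lborel_add[of "\<lambda>x. (E i i k0 x)\<^sup>2"]) (rule cs_borel[OF cs_power2[OF csE]])
  finally show ?thesis using E_le(1)[of i i] by linarith
qed

text \<open>Transversal regularity at scales so small that \<open>one_direction_estimate\<close>
  gives nothing. The a priori bound on \<open>nsq (P i k0)\<close> takes the place of the Poincare
  inequality, and the squared transversal gradient is then of order
  \<open>sqrt D / (h i)\<^sup>2\<close> instead of \<open>D / (h i)^4\<close>.\<close>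

lemma translation_estimate_quartic:
  assumes "i \<noteq> j" "i \<noteq> l" "j \<noteq> l" "\<And>x. f j x + f l x = 0" "nsq (P i k0) \<le> 1" "0 < D" "D \<le> 1"
    and z: "z = s *\<^sub>R axis j 1 + t *\<^sub>R axis l 1"
  shows "nsq (\<lambda>x. P i k0 (x + z) - P i k0 x) \<le> 72 * ((s\<^sup>2 + t\<^sup>2) * (C\<^sup>2 * sqrt D / (h i)\<^sup>2)) + 8 * D"
proof -
  define Q where "Q = C\<^sup>2 * sqrt D / (h i)\<^sup>2"
  have sD: "D \<le> sqrt D" "D = sqrt D * sqrt D" "0 < sqrt D" using assms(6,7)
    by (auto simp: real_le_rsqrt power2_eq_square mult_left_le)
  have "D * C\<^sup>2 / (h i)\<^sup>2 \<le> sqrt D * C\<^sup>2 / (h i)\<^sup>2" using sD by (intro divide_right_mono mult_right_mono) auto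
  then have Q1: "C\<^sup>2 * D / (h i)\<^sup>2 \<le> Q" by (simp add: Q_def mult.commute)
  have csE: "cs (\<lambda>x. E j j (k2 i i) x + E l l (k2 i i) x)" by (intro cs_intros cs_all)
  have w: "nsq (V i (k1 i)) \<le> 4"
  proof -
    have "nsq (V i (k1 i)) = nsq (\<lambda>x. P i k0 x + E i i k0 x)" by (rule nsq_cong) (simp add: V_up G_diag)
    also have "\<dots> \<le> 2 * nsq (P i k0) + 2 * nsq (E i i k0)" by (intro nsq_add cs_all)
    finally show ?thesis using assms(5,7) E_le(1)[of i i] by linarith
  qed
  \<comment> \<open>The weight that balances the two terms in Young's inequality, \<open>c\<close>
    times a bounded norm and \<open>C\<^sup>2 * D / (c * (h i)^4)\<close>.\<close>
  define c where "c = sqrt D / (h i)\<^sup>2"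
  have c: "0 < c" using sD h_pos[of i] by (simp add: c_def)
  have "(\<integral>x. V i (k1 i) x * (E j j (k2 i i) x + E l l (k2 i i) x) \<partial>lborel) \<le>
     c * nsq (V i (k1 i)) + (1 / (4 * c)) * (4 * (C\<^sup>2 * D / (h i)^4))"
    using cs_Cauchy_Schwarz_Young[OF cs_all(1)[of i "k1 i"] csE c] E_sum_le[of j i l] c
      mult_left_mono[OF E_sum_le[of j i l], of "1 / (4 * c)"] by simp
  also have "(1 / (4 * c)) * (4 * (C\<^sup>2 * D / (h i)^4)) = Q"
    using sD h_pos[of i] unfolding c_def Q_def by (subst sD(2)) (simp add: field_simps power2_eq_square power4_eq_xxxx)
  also have "c * nsq (V i (k1 i)) \<le> c * 4" using w c by simp
  also have "c * 4 \<le> 4 * Q"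
    using C_ge sD h_pos[of i] unfolding c_def Q_def by (simp add: divide_right_mono)
  finally have "(\<integral>x. V i (k1 i) x * (E j j (k2 i i) x + E l l (k2 i i) x) \<partial>lborel) \<le> 5 * Q" by simp
  then have grad: "nsq (V i (k2 j i)) + nsq (V i (k2 l i)) \<le> 18 * Q"
    using planar_energy[OF assms(1,2,4)] Q1 by linarith
  have "ld z (V i (k1 i)) (\<lambda>x. s * V i (k2 j i) x + t * V i (k2 l i) x)"
    using ld_V[of z i "k1 i"] unfolding z using assms(3)
    by (simp add: axis_def distrib_right sum.distrib if_distrib[of "\<lambda>x. _ * x"] if_distrib[of "\<lambda>x. x * _"] cong: if_cong)
  then have "nsq (\<lambda>x. V i (k1 i) (x + z) - V i (k1 i) x) \<le> nsq (\<lambda>x. s * V i (k2 j i) x + t * V i (k2 l i) x)"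
    by (intro translation_square cs_intros cs_all)
  also have "\<dots> \<le> 2 * (s\<^sup>2 * nsq (V i (k2 j i))) + 2 * (t\<^sup>2 * nsq (V i (k2 l i)))"
    unfolding nsq_cmult[symmetric] by (intro nsq_add cs_intros cs_all)
  also have "\<dots> \<le> 2 * (s\<^sup>2 * (18 * Q)) + 2 * (t\<^sup>2 * (18 * Q))"
  proof -
    have "nsq (V i (k2 j i)) \<le> 18 * Q" "nsq (V i (k2 l i)) \<le> 18 * Q"
      using grad nsq_nonneg[of "V i (k2 l i)"] nsq_nonneg[of "V i (k2 j i)"] by linarith+
    then show ?thesis by (intro add_mono mult_left_mono) auto
  qed
  finally have "nsq (\<lambda>x. V i (k1 i) (x + z) - V i (k1 i) x) \<le> 36 * (s\<^sup>2 + t\<^sup>2) * Q" by (simp add: algebra_simps)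
  with nsq_P_translate[of "V i (k1 i)" i z, OF cs_all(1) V_up[symmetric]]
  have "nsq (\<lambda>x. P i k0 (x + z) - P i k0 x) \<le> 2 * (36 * (s\<^sup>2 + t\<^sup>2) * Q) + 8 * D"
    by linarith
  moreover have "2 * (36 * (s\<^sup>2 + t\<^sup>2) * Q) = 72 * ((s\<^sup>2 + t\<^sup>2) * Q)" by simp
  ultimately show ?thesis by (simp only: Q_def)
qed

text \<open>Two integrations by parts. Thus the cross term in the norm of a planar Laplacian is
  nonnegative, and the Laplacian controls each pure second derivative.\<close>

lemma mixed_derivatives: "(\<integral>x. V i (k2 j j) x * V i (k2 l l) x \<partial>lborel) = nsq (V i (k2 l j))"
proof -
  have "(\<integral>x. V i (k2 l l) x * V i (k2 j j) x \<partial>lborel) = - (\<integral>x. V i (up j (k2 l l)) x * V i (k1 j) x \<partial>lborel)"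
    by (rule integration_by_parts[OF _ _ _ _ ld_V_axis ld_V_axis]) (rule cs_all)+
  moreover have "(\<integral>x. V i (k1 j) x * V i (up l (k2 j l)) x \<partial>lborel) = - (\<integral>x. V i (k2 l j) x * V i (k2 j l) x \<partial>lborel)"
    by (rule integration_by_parts[OF _ _ _ _ ld_V_axis ld_V_axis]) (rule cs_all)+
  moreover have "up j (k2 l l) = up l (k2 j l)" "k2 j l = k2 l j" by (rule up_commute)+
  ultimately show ?thesis by (simp add: mult.commute power2_eq_square)
qed

text \<open>The Laplacian of \<open>v\<^sub>i\<close> in the coordinates \<open>j\<close> and
  \<open>l\<close> consists of first derivatives of errors, because the phases cancel. This controls
  \<open>\<partial>\<^sub>j \<partial>\<^sub>j v\<^sub>i\<close>, and the symmetric entry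
  \<open>(i, j)\<close> passes the bound on to
  \<open>\<partial>\<^sub>i \<partial>\<^sub>j v\<^sub>j\<close>, the derivative of the oscillating
  entry in the direction orthogonal to both of its lamination directions.\<close>

lemma translation_estimate_quadratic:
  assumes "i \<noteq> j" "i \<noteq> l" "\<And>x. f j x + f l x = 0" "\<And>i. h i = r"
  shows "nsq (\<lambda>x. P j k0 (x + s *\<^sub>R axis i 1) - P j k0 x) \<le> 400 * (s\<^sup>2 * (C\<^sup>2 * D / r\<^sup>2)) + 8 * D"
proof -
  define Q where "Q = C\<^sup>2 * D / r\<^sup>2"
  have E1: "nsq (E a b (k1 c)) \<le> Q" for a b c using E_le(2)[of a b c] by (simp add: Q_def assms(4))
  let ?P = "V i (k2 j j)" and ?R = "V i (k2 l l)"
  have "nsq ?P \<le> nsq (\<lambda>x. ?P x + ?R x)"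
  proof -
    have "nsq (\<lambda>x. ?P x + ?R x) = (\<integral>x. ((?P x)\<^sup>2 + (?R x)\<^sup>2) + 2 * (?P x * ?R x) \<partial>lborel)"
      by (intro Bochner_Integration.integral_cong refl) (simp add: power2_eq_square algebra_simps)
    also have "\<dots> = (nsq ?P + nsq ?R) + 2 * (\<integral>x. ?P x * ?R x \<partial>lborel)"
      by (subst Bochner_Integration.integral_add, (intro cs_integrable cs_intros cs_all)+)
        (subst Bochner_Integration.integral_add, (intro cs_integrable cs_intros cs_all)+, simp)
    finally show ?thesis unfolding mixed_derivatives using nsq_nonneg[of ?R] nsq_nonneg[of "V i (k2 l j)"] by linarith
  qed
  also have "nsq (\<lambda>x. ?P x + ?R x) = nsq (\<lambda>x. (2 * E i j (k1 j) x + 2 * E i l (k1 l) x) - (E j j (k1 i) x + E l l (k1 i) x))"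
  proof (rule nsq_cong)
    fix x
    have g: "G a i (k1 a) x = G a a (k1 i) x" for a
    proof -
      have "G a i (k1 a) x = V a (k2 i a) x" by (simp add: V_up)
      also have "k2 i a = k2 a i" by (rule up_commute)
      finally show ?thesis by (simp add: V_up)
    qed
    have "G j j (k1 i) x + G l l (k1 i) x = E j j (k1 i) x + E l l (k1 i) x"
      using P_cancel[OF assms(3), of "k1 i" x] by (simp add: G_diag)
    then show "?P x + ?R x = (2 * E i j (k1 j) x + 2 * E i l (k1 l) x) - (E j j (k1 i) x + E l l (k1 i) x)"
      using G_sym[OF assms(1), of "k1 j" x] G_sym[OF assms(2), of "k1 l" x] g[of j] g[of l] by (simp add: V_up)
  qed
  also have "\<dots> \<le> 40 * Q"
  proof -
    have "nsq (\<lambda>x. (2 * E i j (k1 j) x + 2 * E i l (k1 l) x) - (E j j (k1 i) x + E l l (k1 i) x)) \<le>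
       2 * nsq (\<lambda>x. 2 * E i j (k1 j) x + 2 * E i l (k1 l) x) + 2 * nsq (\<lambda>x. E j j (k1 i) x + E l l (k1 i) x)"
      by (intro nsq_diff cs_intros cs_all)
    moreover have "nsq (\<lambda>x. 2 * E i j (k1 j) x + 2 * E i l (k1 l) x) \<le> 2 * nsq (\<lambda>x. 2 * E i j (k1 j) x) + 2 * nsq (\<lambda>x. 2 * E i l (k1 l) x)"
      by (intro nsq_add cs_intros cs_all)
    moreover have "nsq (\<lambda>x. E j j (k1 i) x + E l l (k1 i) x) \<le> 2 * nsq (E j j (k1 i)) + 2 * nsq (E l l (k1 i))"
      by (intro nsq_add cs_intros cs_all)
    ultimately show ?thesis unfolding nsq_cmult using E1[of i j j] E1[of i l l] E1[of j j i] E1[of l l i] by simp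
  qed
  finally have PQ: "nsq ?P \<le> 40 * Q" .
  have "nsq (V j (k2 i j)) = nsq (\<lambda>x. 2 * E i j (k1 j) x - ?P x)"
  proof (rule nsq_cong)
    show "V j (k2 i j) x = 2 * E i j (k1 j) x - ?P x" for x
      using G_sym[OF assms(1), of "k1 j" x] by (simp add: V_up)
  qed
  also have "\<dots> \<le> 2 * nsq (\<lambda>x. 2 * E i j (k1 j) x) + 2 * nsq ?P" by (intro nsq_diff cs_intros cs_all)
  finally have V2: "nsq (V j (k2 i j)) \<le> 88 * Q" unfolding nsq_cmult using E1[of i j j] PQ by simp
  have "ld (s *\<^sub>R axis i 1) (V j (k1 j)) (\<lambda>x. s * V j (k2 i j) x)" by (rule ld_scale[OF ld_V_axis])
  then have "nsq (\<lambda>x. V j (k1 j) (x + s *\<^sub>R axis i 1) - V j (k1 j) x) \<le> nsq (\<lambda>x. s * V j (k2 i j) x)"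
    by (intro translation_square cs_intros cs_all)
  also have "\<dots> \<le> s\<^sup>2 * (88 * Q)" unfolding nsq_cmult using V2 by (intro mult_left_mono) auto
  finally have "nsq (\<lambda>x. V j (k1 j) (x + s *\<^sub>R axis i 1) - V j (k1 j) x) \<le> s\<^sup>2 * (88 * Q)" .
  moreover have "nsq (\<lambda>x. P j k0 (x + s *\<^sub>R axis i 1) - P j k0 x) \<le> 2 * nsq (\<lambda>x. V j (k1 j) (x + s *\<^sub>R axis i 1) - V j (k1 j) x) + 8 * D"
    by (rule nsq_P_translate) (auto simp: V_up)
  moreover have "0 \<le> s\<^sup>2 * Q" using D_nonneg by (simp add: Q_def)
  ultimately have "nsq (\<lambda>x. P j k0 (x + s *\<^sub>R axis i 1) - P j k0 x) \<le> 400 * (s\<^sup>2 * Q) + 8 * D" by simp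
  then show ?thesis by (simp add: Q_def mult_ac)
qed

end

section \<open>Testing with polynomials\<close>

lemma AE_lborel_not_in_negligible: "negligible N \<Longrightarrow> AE x in lborel. x \<notin> N"
  using AE_not_in[of N lebesgue] by (simp add: negligible_iff_null_sets AE_completion_iff)

lemma borel_measurable_polynomial:
  fixes P :: "real^'n \<Rightarrow> real"
  shows "real_polynomial_function P \<Longrightarrow> P \<in> borel_measurable borel"
  by (intro borel_measurable_continuous_onI Ck_continuous[of 0] Ck_polynomial)

lemma integrable_mult_polynomial:
  fixes g :: "real^'n \<Rightarrow> real"
  assumes "integrable lborel g" "compact S" "\<And>x. x \<notin> S \<Longrightarrow> g x = 0" "real_polynomial_function P"
  shows "integrable lborel (\<lambda>x. g x * P x)"
proof -
  note [measurable] = borel_measurable_integrable[OF assms(1)] borel_measurable_polynomial[OF assms(4)]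
  have "compact (P ` S)"
    using assms(2) Ck_continuous[OF Ck_polynomial[OF assms(4), of 0]]
    by (intro compact_continuous_image) (auto intro: continuous_on_subset)
  then obtain B where B: "\<And>x. x \<in> S \<Longrightarrow> \<bar>P x\<bar> \<le> B"
    using compact_imp_bounded[OF \<open>compact (P ` S)\<close>] by (auto simp: bounded_iff)
  show ?thesis
  proof (rule Bochner_Integration.integrable_bound[where f="\<lambda>x. B * g x"])
    show "integrable lborel (\<lambda>x. B * g x)" using assms by simp
    have "\<bar>g x * P x\<bar> \<le> \<bar>B * g x\<bar>" for x
    proof (cases "x \<in> S")
      case True
      then have "\<bar>g x\<bar> * \<bar>P x\<bar> \<le> \<bar>g x\<bar> * \<bar>B\<bar>" using B[of x] by (intro mult_left_mono) auto
      then show ?thesis by (simp add: abs_mult mult.commute)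
    qed (use assms in auto)
    then show "AE x in lborel. norm (g x * P x) \<le> norm (B * g x)" by simp
  qed simp
qed

text \<open>Duality for \<open>L^1\<close>: the sign of \<open>g\<close> is an almost everywhere
  limit of continuous functions, and these are approximated by polynomials on \<open>S\<close>.
  Polynomials are convenient because their products with a smooth cutoff are test functions.\<close>

lemma integral_abs_le_polynomial_test:
  fixes g :: "real^'n \<Rightarrow> real"
  assumes g: "integrable lborel g" and S: "compact S" "\<And>x. x \<notin> S \<Longrightarrow> g x = 0"
    and test: "\<And>P. real_polynomial_function P \<Longrightarrow> (\<And>x. x \<in> S \<Longrightarrow> \<bar>P x\<bar> \<le> 1) \<Longrightarrow> (\<integral>x. g x * P x \<partial>lborel) \<le> c"
  shows "(\<integral>x. \<bar>g x\<bar> \<partial>lborel) \<le> c"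
proof -
  note [measurable] = borel_measurable_integrable[OF g]
  have "(\<lambda>x. sgn (g x)) \<in> borel_measurable lborel" by measurable
  then have "(\<lambda>x. sgn (g x)) \<in> borel_measurable (lebesgue_on UNIV)"
    unfolding lebesgue_on_UNIV_eq by (rule measurable_completion)
  then have "(\<lambda>x. sgn (g x)) measurable_on UNIV"
    by (subst measurable_on_iff_borel_measurable) auto
  then obtain N \<phi> where N: "negligible N" and \<phi>: "\<And>n. continuous_on UNIV (\<phi> n)"
    "\<And>x. x \<notin> N \<Longrightarrow> (\<lambda>n. \<phi> n x) \<longlonglongrightarrow> sgn (g x)"
    unfolding measurable_on_def by (auto simp del: sgn_real_def)
  define \<psi> where "\<psi> n x = max (-1) (min 1 (\<phi> n x))" for n x
  have \<psi>c: "continuous_on UNIV (\<psi> n)" for n unfolding \<psi>_def[abs_def] by (intro continuous_intros \<phi>)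
  have \<psi>b: "\<bar>\<psi> n x\<bar> \<le> 1" for n x by (auto simp: \<psi>_def)
  have [measurable]: "\<psi> n \<in> borel_measurable borel" for n by (intro borel_measurable_continuous_onI \<psi>c)
  have int\<psi>: "integrable lborel (\<lambda>x. g x * \<psi> n x)" for n
    by (rule Bochner_Integration.integrable_bound[OF g])
      (use \<psi>b in \<open>auto simp: abs_mult intro!: mult_left_le\<close>)
  have le: "(\<integral>x. g x * \<psi> n x \<partial>lborel) \<le> c" for n
  proof -
    define I where "I = (\<integral>x. g x * \<psi> n x \<partial>lborel)"
    define J where "J = (\<integral>x. \<bar>g x\<bar> \<partial>lborel)"
    have *: "(1 - \<epsilon>) * I - \<epsilon> * J \<le> c" if \<epsilon>: "0 < \<epsilon>" "\<epsilon> < 1" for \<epsilon>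
    proof -
      \<comment> \<open>Shrinking by the factor \<open>1 - \<epsilon>\<close> leaves room for the
        approximation error, so that \<open>P\<close> still obeys the bound 1 on
        \<open>S\<close>.\<close>
      obtain P where P: "real_polynomial_function P" "\<And>x. x \<in> S \<Longrightarrow> \<bar>(1 - \<epsilon>) * \<psi> n x - P x\<bar> < \<epsilon>"
        using Stone_Weierstrass_real_polynomial_function[of S "\<lambda>x. (1 - \<epsilon>) * \<psi> n x" \<epsilon>] S(1) \<epsilon>(1)
          continuous_on_subset[OF \<psi>c] by (metis continuous_on_mult_left subset_UNIV)
      have "\<bar>P x\<bar> \<le> 1" if "x \<in> S" for x
      proof -
        have "\<bar>(1 - \<epsilon>) * \<psi> n x\<bar> \<le> 1 - \<epsilon>" using \<epsilon> \<psi>b[of n x] by (simp add: abs_mult mult_left_le)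
        then show ?thesis using P(2)[OF that] by linarith
      qed
      from test[OF P(1) this] have "(\<integral>x. g x * P x \<partial>lborel) \<le> c" .
      moreover have iP: "integrable lborel (\<lambda>x. g x * P x)" by (rule integrable_mult_polynomial[OF g S P(1)])
      moreover have "(\<integral>x. (1 - \<epsilon>) * (g x * \<psi> n x) - \<epsilon> * \<bar>g x\<bar> \<partial>lborel) \<le> (\<integral>x. g x * P x \<partial>lborel)"
      proof (rule integral_mono)
        show "integrable lborel (\<lambda>x. (1 - \<epsilon>) * (g x * \<psi> n x) - \<epsilon> * \<bar>g x\<bar>)"
          using int\<psi> g by auto
        show "(1 - \<epsilon>) * (g x * \<psi> n x) - \<epsilon> * \<bar>g x\<bar> \<le> g x * P x" for x
        proof (cases "x \<in> S")
          case True
          have "\<bar>g x * ((1 - \<epsilon>) * \<psi> n x - P x)\<bar> \<le> \<bar>g x\<bar> * \<epsilon>"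
            unfolding abs_mult using P(2)[OF True] by (intro mult_left_mono) auto
          then show ?thesis by (simp add: algebra_simps)
        qed (simp add: S(2))
      qed (rule iP)
      moreover have "(\<integral>x. (1 - \<epsilon>) * (g x * \<psi> n x) - \<epsilon> * \<bar>g x\<bar> \<partial>lborel) = (1 - \<epsilon>) * I - \<epsilon> * J"
        using int\<psi> g by (subst Bochner_Integration.integral_diff) (auto simp: I_def J_def)
      ultimately show ?thesis by linarith
    qed
    have "((\<lambda>\<epsilon>. (1 - \<epsilon>) * I - \<epsilon> * J) \<longlongrightarrow> (1 - 0) * I - 0 * J) (at_right (0::real))"
      by (intro tendsto_intros)
    then have "(1 - 0) * I - 0 * J \<le> c"
      by (rule tendsto_upperbound) (use * in \<open>auto simp: eventually_at_right_field intro!: exI[of _ 1]\<close>)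
    then show ?thesis by (simp add: I_def)
  qed
  have "(\<lambda>n. \<integral>x. g x * \<psi> n x \<partial>lborel) \<longlonglongrightarrow> (\<integral>x. \<bar>g x\<bar> \<partial>lborel)"
  proof (rule integral_dominated_convergence[where w="\<lambda>x. \<bar>g x\<bar>"])
    show "AE x in lborel. (\<lambda>n. g x * \<psi> n x) \<longlonglongrightarrow> \<bar>g x\<bar>"
      using AE_lborel_not_in_negligible[OF N]
    proof eventually_elim
      case (elim x)
      have "(\<lambda>n. max (-1) (min 1 (\<phi> n x))) \<longlonglongrightarrow> max (-1) (min 1 (sgn (g x)))"
        by (intro tendsto_intros \<phi>(2) elim)
      moreover have "max (-1) (min 1 (sgn (g x))) = sgn (g x)" by (simp add: sgn_if)
      ultimately have "(\<lambda>n. \<psi> n x) \<longlonglongrightarrow> sgn (g x)" unfolding \<psi>_def by (simp only:)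
      then have "(\<lambda>n. g x * \<psi> n x) \<longlonglongrightarrow> g x * sgn (g x)" by (rule tendsto_mult_left)
      moreover have "g x * sgn (g x) = \<bar>g x\<bar>" by (simp add: sgn_if)
      ultimately show ?case by (simp only:)
    qed
    show "AE x in lborel. norm (g x * \<psi> n x) \<le> \<bar>g x\<bar>" for n
      using \<psi>b by (auto simp: abs_mult intro!: mult_left_le)
  qed (use g in auto)
  then show ?thesis by (rule LIMSEQ_le_const2) (use le in auto)
qed

text \<open>A form of the fundamental lemma of the calculus of variations: with vanishing tests the
  dual bound above holds with \<open>c = 0\<close>.\<close>

lemma AE_zero_polynomial_test:
  fixes g :: "real^'n \<Rightarrow> real"
  assumes "integrable lborel g" "compact S" "\<And>x. x \<notin> S \<Longrightarrow> g x = 0"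
    and "\<And>P. real_polynomial_function P \<Longrightarrow> (\<integral>x. g x * P x \<partial>lborel) = 0"
  shows "AE x in lborel. g x = 0"
proof -
  have "(\<integral>x. \<bar>g x\<bar> \<partial>lborel) \<le> 0"
    by (rule integral_abs_le_polynomial_test[OF assms(1,2,3)]) (use assms(4) in auto)
  moreover have "0 \<le> (\<integral>x. \<bar>g x\<bar> \<partial>lborel)" by simp
  ultimately have "(\<integral>x. \<bar>g x\<bar> \<partial>lborel) = 0" by linarith
  then show ?thesis using assms(1) by (subst (asm) integral_nonneg_eq_0_iff_AE) auto
qed

section \<open>Translations of functions of bounded variation\<close>

text \<open>These averages over a segment of direction \<open>w\<close> are the coefficients of the
  test fields in \<open>bv_translation\<close>. The Leibniz rule asks for the derivative as a
  continuous family of bounded linear maps, hence the passage through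
  \<open>blinfun_inner_right\<close>.\<close>

lemma line_average_Ck:
  fixes g :: "real^'n \<Rightarrow> real" and b w :: "real^'n"
  assumes "Ck 1 g"
  defines "A \<equiv> \<lambda>q y. integral (cbox 0 1) (\<lambda>t::real. q (y - b - t *\<^sub>R w))"
  shows "Ck 1 (A g)" "partial_deriv i (A g) y = A (partial_deriv i g) y"
proof -
  have gd: "(g has_derivative (\<lambda>z. \<Sum>i\<in>UNIV. z $ i * partial_deriv i g x)) (at x)" for x
    using Ck_SucD(1)[of 0 g x] assms(1) by simp
  have gc: "continuous_on UNIV (partial_deriv i g)" for i using assms(1) by simp
  define D where "D y t = blinfun_inner_right (\<chi> i. partial_deriv i g (y - b - t *\<^sub>R w))" for y t
  have Dapp: "blinfun_apply (D y t) z = (\<Sum>i\<in>UNIV. z $ i * partial_deriv i g (y - b - t *\<^sub>R w))" for y t z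
    by (simp add: D_def inner_vec_def mult.commute)
  have cD: "continuous_on (UNIV \<times> cbox 0 1) (\<lambda>(y, t). D y t)"
    unfolding D_def split_beta
    by (intro bounded_linear.continuous_on[OF bounded_linear_blinfun_inner_right] continuous_intros
        continuous_on_compose2[OF gc]) auto
  have cont: "continuous_on UNIV (\<lambda>t. q (y - b - t *\<^sub>R w))" if "continuous_on UNIV q" for q :: "real^'n \<Rightarrow> real" and y
    by (rule continuous_on_compose2[OF that]) (auto intro!: continuous_intros)
  have der: "(A g has_derivative blinfun_apply (integral (cbox 0 1) (D y))) (at y)" for y
    unfolding A_def
  proof (rule leibniz_rule[where U=UNIV, OF _ _ cD])
    show "((\<lambda>x. g (x - b - t *\<^sub>R w)) has_derivative blinfun_apply (D x t)) (at x within UNIV)" for x t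
    proof -
      have "((\<lambda>x. g (x - b - t *\<^sub>R w)) has_derivative (\<lambda>z. \<Sum>i\<in>UNIV. z $ i * partial_deriv i g (x - b - t *\<^sub>R w))) (at x)"
        by (rule has_derivative_compose[OF _ gd]) (auto intro!: derivative_eq_intros)
      moreover have "blinfun_apply (D x t) = (\<lambda>z. \<Sum>i\<in>UNIV. z $ i * partial_deriv i g (x - b - t *\<^sub>R w))"
        by (rule ext) (rule Dapp)
      ultimately show ?thesis by simp
    qed
    show "(\<lambda>t. g (x - b - t *\<^sub>R w)) integrable_on cbox 0 1" for x
      using cont[OF Ck_continuous[OF assms(1)]] by (intro integrable_continuous) (auto intro: continuous_on_subset)
  qed auto
  have Dint: "D y integrable_on cbox 0 1" for y
  proof (intro integrable_continuous)
    show "continuous_on (cbox 0 1) (D y)"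
      by (rule continuous_on_compose2[OF cD, of _ "\<lambda>t. (y, t)", simplified]) (auto intro!: continuous_intros)
  qed
  have pd: "partial_deriv i (A g) y = A (partial_deriv i g) y" for i y
  proof -
    have "partial_deriv i (A g) y = blinfun_apply (integral (cbox 0 1) (D y)) (axis i 1)"
      by (rule partial_derivI[OF der])
    also have "\<dots> = integral (cbox 0 1) (\<lambda>t. blinfun_apply (D y t) (axis i 1))"
      by (rule blinfun_apply_integral[OF Dint])
    also have "\<dots> = A (partial_deriv i g) y"
      unfolding A_def Dapp by (simp add: axis_def if_distrib[of "\<lambda>x. x * _"] cong: if_cong)
    finally show ?thesis .
  qed
  then show "partial_deriv i (A g) y = A (partial_deriv i g) y" .
  have "continuous_on UNIV (A q)" if "continuous_on UNIV q" for q
    unfolding A_def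
    by (rule integral_continuous_on_param) (auto simp: split_beta intro!: continuous_on_compose2[OF that] continuous_intros)
  then have "continuous_on UNIV (partial_deriv i (A g))" for i
    using gc pd by (simp add: fun_eq_iff[symmetric, of "partial_deriv i (A g)"] ext[of "partial_deriv i (A g)" "A (partial_deriv i g)"])
  then show "Ck 1 (A g)" using der by (auto simp: differentiable_def)
qed

text \<open>Localized version of the bound of increments by the total variation. A field of constant
  direction \<open>a - b\<close>, whose coefficient averages \<open>g\<close> along the segment, has
  as divergence a multiple of \<open>g (y - a) - g (y - b)\<close>; a change of variables moves this
  difference onto \<open>f\<close>. With \<open>g = \<zeta> * P\<close> for polynomials
  \<open>P\<close>, duality gives the weighted \<open>L^1\<close> norm.\<close>

lemma bv_translation:
  fixes f :: "real^'n \<Rightarrow> real"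
  assumes f: "integrable lborel f"
    and tv: "\<And>\<phi>. test_field \<Omega> \<phi> \<Longrightarrow> (\<And>x. norm (\<phi> x) \<le> 1) \<Longrightarrow> (\<integral>x. f x * divergence \<phi> x \<partial>lborel) \<le> T"
    and \<zeta>: "test_fun \<zeta>" "\<And>x. 0 \<le> \<zeta> x" "\<And>x. \<zeta> x \<le> B" "0 < B" "compact S" "\<And>x. x \<notin> S \<Longrightarrow> \<zeta> x = 0"
    and seg: "\<And>x t. x \<in> S \<Longrightarrow> 0 \<le> t \<Longrightarrow> t \<le> 1 \<Longrightarrow> x + b + t *\<^sub>R (a - b) \<in> \<Omega>"
  shows "(\<integral>x. \<zeta> x * \<bar>f (x + a) - f (x + b)\<bar> \<partial>lborel) \<le> B * norm (a - b) * T"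
proof (cases "a = b")
  case True
  then show ?thesis by simp
next
  case False
  define w where "w = a - b"
  have w: "0 < norm w" using False by (simp add: w_def)
  have \<zeta>c: "continuous_on UNIV \<zeta>" by (rule Ck_continuous[OF test_fun_Ck[OF \<zeta>(1), of 0]])
  note [measurable] = borel_measurable_integrable[OF f] borel_measurable_continuous_onI[OF \<zeta>c]
  have iab: "integrable lborel (\<lambda>x. f (x + a) - f (x + b))"
    by (intro Bochner_Integration.integrable_diff integrable_lborel_add f)
  have bdd: "integrable lborel (\<lambda>x. q x * r x)"
    if q: "integrable lborel q" and r: "r \<in> borel_measurable borel" "\<And>x. \<bar>r x\<bar> \<le> K" for q r :: "real^'n \<Rightarrow> real" and K
  proof (rule Bochner_Integration.integrable_bound[where f="\<lambda>x. K * q x"])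
    show "integrable lborel (\<lambda>x. K * q x)" using q by simp
    show "(\<lambda>x. q x * r x) \<in> borel_measurable lborel" using q r by simp
    have "\<bar>q x\<bar> * \<bar>r x\<bar> \<le> \<bar>q x\<bar> * \<bar>K\<bar>" for x using r(2)[of x] by (intro mult_left_mono) auto
    then show "AE x in lborel. norm (q x * r x) \<le> norm (K * q x)" by (simp add: abs_mult mult.commute)
  qed
  have int: "integrable lborel (\<lambda>x. \<zeta> x * (f (x + a) - f (x + b)))"
    using bdd[OF iab, of \<zeta> B] \<zeta> by (simp add: mult.commute)
  have "(\<integral>x. \<bar>\<zeta> x * (f (x + a) - f (x + b))\<bar> \<partial>lborel) \<le> B * norm w * T"
  proof (rule integral_abs_le_polynomial_test[OF int \<zeta>(5)])
    show "\<zeta> x * (f (x + a) - f (x + b)) = 0" if "x \<notin> S" for x using \<zeta>(6)[OF that] by simp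
    fix P :: "real^'n \<Rightarrow> real" assume P: "real_polynomial_function P" "\<And>x. x \<in> S \<Longrightarrow> \<bar>P x\<bar> \<le> 1"
    define g where "g x = \<zeta> x * P x" for x
    have gC: "Ck k g" for k unfolding g_def by (intro Ck_mult test_fun_Ck \<zeta>(1) Ck_polynomial P)
    have gb: "\<bar>g x\<bar> \<le> B" for x
    proof (cases "x \<in> S")
      case True
      then have "\<bar>\<zeta> x\<bar> * \<bar>P x\<bar> \<le> B * 1" using P(2) \<zeta>(2,3)[of x] by (intro mult_mono) auto
      then show ?thesis by (simp add: g_def abs_mult)
    qed (use \<zeta> in \<open>simp add: g_def\<close>)
    have gS: "g x = 0" if "x \<notin> S" for x using that \<zeta>(6) by (simp add: g_def)
    have gc: "continuous_on UNIV g" by (rule Ck_continuous[OF gC[of 0]])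
    define A where "A q y = integral (cbox 0 1) (\<lambda>t::real. q (y - b - t *\<^sub>R w))" for q :: "real^'n \<Rightarrow> real" and y
    have A: "Ck 1 (A g)" "partial_deriv i (A g) y = A (partial_deriv i g) y" for i y
      unfolding A_def by (rule line_average_Ck[OF gC])+
    \<comment> \<open>The size makes \<open>\<phi>\<close> admissible, since the average of
      \<open>g\<close> is at most \<open>B\<close>; the sign makes the divergence a positive
      multiple of \<open>g (y - a) - g (y - b)\<close>.\<close>
    define r where "r = - inverse (B * norm w)"
    define \<phi> where "\<phi> y = (r * A g y) *\<^sub>R w" for y
    have \<phi>i: "(\<lambda>y. \<phi> y $ i) = (\<lambda>y. (r * w $ i) * A g y)" for i by (auto simp: \<phi>_def)
    have "test_field \<Omega> \<phi>"
      unfolding test_field_def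
    proof (intro conjI allI)
      show "Ck 1 (\<lambda>x. \<phi> x $ i)" for i unfolding \<phi>i by (intro Ck_mult Ck_const A)
      let ?C = "(\<lambda>(x, t). x + b + t *\<^sub>R w) ` (S \<times> {0..1})"
      show "supp_compact_in \<phi> \<Omega>"
      proof (rule supp_compact_in_boundedI[of ?C])
        show "compact ?C"
          by (intro compact_continuous_image compact_Times \<zeta>(5)) (auto simp: split_beta intro!: continuous_intros)
        show "?C \<subseteq> \<Omega>" using seg by (auto simp: w_def)
        fix y assume y: "y \<notin> ?C"
        have "g (y - b - t *\<^sub>R w) = 0" if "t \<in> cbox 0 1" for t
        proof (rule gS, rule)
          assume "y - b - t *\<^sub>R w \<in> S"
          then have "(\<lambda>(x, t). x + b + t *\<^sub>R w) (y - b - t *\<^sub>R w, t) \<in> ?C" using that by (intro imageI) auto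
          with y show False by simp
        qed
        then have "A g y = integral (cbox 0 1) (\<lambda>t::real. 0 :: real)"
          unfolding A_def by (intro integral_cong) auto
        then show "\<phi> y = 0" by (simp add: \<phi>_def)
      qed
    qed
    moreover have "norm (\<phi> x) \<le> 1" for x
    proof -
      have "norm (A g x) \<le> B * Henstock_Kurzweil_Integration.content (cbox 0 (1::real))"
        unfolding A_def
      proof (rule integrable_bound)
        show "(\<lambda>t. g (x - b - t *\<^sub>R w)) integrable_on cbox 0 1"
          by (intro integrable_continuous continuous_on_compose2[OF gc] continuous_intros) auto
      qed (use \<zeta>(4) gb in auto)
      then have "\<bar>A g x\<bar> * norm w \<le> B * norm w" using w by (intro mult_right_mono) auto
      then show ?thesis using w \<zeta>(4) by (simp add: \<phi>_def r_def abs_mult field_simps)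
    qed
    ultimately have T: "(\<integral>x. f x * divergence \<phi> x \<partial>lborel) \<le> T" by (rule tv)
    have div: "divergence \<phi> y = (- r) * (g (y - a) - g (y - b))" for y
    proof -
      have "divergence \<phi> y = (\<Sum>i\<in>UNIV. (r * w $ i) * A (partial_deriv i g) y)"
      proof -
        have "partial_deriv i (\<lambda>y. (r * w $ i) * A g y) y = (r * w $ i) * A (partial_deriv i g) y" for i
          using partial_deriv_mult[of "\<lambda>y. r * w $ i" "A g" i y] Ck_const A by (simp add: partial_deriv_def)
        then show ?thesis unfolding divergence_def \<phi>i by simp
      qed
      also have "\<dots> = (- r) * (\<Sum>i\<in>UNIV. integral (cbox 0 1) (\<lambda>t. (- w $ i) * partial_deriv i g (y - b - t *\<^sub>R w)))"
        by (simp add: A_def sum_distrib_left mult_ac)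
      also have "(\<Sum>i\<in>UNIV. integral (cbox 0 1) (\<lambda>t. (- w $ i) * partial_deriv i g (y - b - t *\<^sub>R w)))
         = integral (cbox 0 1) (\<lambda>t. \<Sum>i\<in>UNIV. (- w $ i) * partial_deriv i g (y - b - t *\<^sub>R w))"
      proof (rule integral_sum[symmetric])
        fix i
        have "continuous_on UNIV (partial_deriv i g)" using gC[of 1] by simp
        then have "continuous_on (cbox 0 1) (\<lambda>t. partial_deriv i g (y - b - t *\<^sub>R w))"
          by (rule continuous_on_compose2) (auto intro!: continuous_intros)
        then show "(\<lambda>t. (- w $ i) * partial_deriv i g (y - b - t *\<^sub>R w)) integrable_on cbox 0 1"
          by (intro integrable_continuous continuous_on_mult_left)
      qed simp
      also have "\<dots> = g (y - a) - g (y - b)"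
      proof -
        have "((\<lambda>t. g (y - b - t *\<^sub>R w)) has_vector_derivative (\<Sum>i\<in>UNIV. (- w $ i) * partial_deriv i g (y - b - t *\<^sub>R w)))
           (at t within {0..1})" for t
        proof -
          have "((\<lambda>t. g (y - b - t *\<^sub>R w)) has_derivative (\<lambda>s. \<Sum>i\<in>UNIV. (- (s *\<^sub>R w)) $ i * partial_deriv i g (y - b - t *\<^sub>R w))) (at t)"
            by (rule has_derivative_compose[OF _ Ck_SucD(1)[OF gC]]) (auto intro!: derivative_eq_intros)
          then have "((\<lambda>t. g (y - b - t *\<^sub>R w)) has_vector_derivative (\<Sum>i\<in>UNIV. (- w $ i) * partial_deriv i g (y - b - t *\<^sub>R w))) (at t)"
            unfolding has_vector_derivative_def
            by (rule has_derivative_eq_rhs) (auto simp: fun_eq_iff sum_distrib_left mult_ac)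
          then show ?thesis by (rule has_vector_derivative_at_within)
        qed
        then have "((\<lambda>t. \<Sum>i\<in>UNIV. (- w $ i) * partial_deriv i g (y - b - t *\<^sub>R w)) has_integral
            g (y - b - 1 *\<^sub>R w) - g (y - b - 0 *\<^sub>R w)) {0..1}"
          by (intro fundamental_theorem_of_calculus) auto
        then show ?thesis by (simp add: integral_unique w_def)
      qed
      finally show ?thesis .
    qed
    have gm: "g \<in> borel_measurable borel" by (rule borel_measurable_continuous_onI[OF gc])
    have shift: "(\<integral>x. f x * g (x - c) \<partial>lborel) = (\<integral>x. f (x + c) * g x \<partial>lborel)" for c
      using integral_lborel_add[of "\<lambda>x. f x * g (x - c)" c] gm by simp
    have ig: "integrable lborel (\<lambda>x. f x * g (x - c))" "integrable lborel (\<lambda>x. f (x + c) * g x)" for c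
      using gb gm by (auto intro!: bdd[where K=B] integrable_lborel_add f)
    have "(\<integral>x. f x * divergence \<phi> x \<partial>lborel) = (- r) * (\<integral>x. f x * g (x - a) - f x * g (x - b) \<partial>lborel)"
      unfolding div by (subst integral_mult_right_zero[symmetric]) (simp add: algebra_simps)
    also have "(\<integral>x. f x * g (x - a) - f x * g (x - b) \<partial>lborel) = (\<integral>x. f (x + a) * g x \<partial>lborel) - (\<integral>x. f (x + b) * g x \<partial>lborel)"
      by (subst Bochner_Integration.integral_diff[OF ig(1) ig(1)]) (simp add: shift)
    also have "\<dots> = (\<integral>x. f (x + a) * g x - f (x + b) * g x \<partial>lborel)"
      by (rule Bochner_Integration.integral_diff[OF ig(2) ig(2), symmetric])
    also have "\<dots> = (\<integral>x. \<zeta> x * (f (x + a) - f (x + b)) * P x \<partial>lborel)"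
      by (intro Bochner_Integration.integral_cong refl) (simp add: g_def algebra_simps)
    finally have "(- r) * (\<integral>x. \<zeta> x * (f (x + a) - f (x + b)) * P x \<partial>lborel) \<le> T" using T by simp
    then show "(\<integral>x. \<zeta> x * (f (x + a) - f (x + b)) * P x \<partial>lborel) \<le> B * norm w * T"
      using w \<zeta>(4) by (simp add: r_def field_simps)
  qed
  then show ?thesis using \<zeta>(2) by (simp add: abs_mult w_def)
qed

section \<open>Weighted averages over the interior of the cube\<close>

definition center :: "real^'n" where
  "center = (\<chi> i. 1/2)"

text \<open>A probability density supported in \<open>[1/4, 3/4]^n\<close>. Shifts by at most 1/8 in
  each coordinate keep its support in the open cube, where the perimeter is under control.\<close>

definition zeta :: "real^'n \<Rightarrow> real" where
  "zeta x = mol (\<lambda>_. 1/4) (\<lambda>_. 0) (x - center)"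

lemma ker_mol_quarter: "ker (mol (\<lambda>_. 1/4) a)"
  by (rule ker_mol) auto

lemma zeta_test_fun: "test_fun (zeta :: real^'n \<Rightarrow> real)"
proof -
  have "test_fun (\<lambda>y. mol (\<lambda>_. 1/4) (\<lambda>_. 0) (- center + 1 *\<^sub>R y :: real^'n))"
    using ker_mol_quarter by (intro test_fun_affine) (auto simp: ker_def)
  then show ?thesis by (simp add: zeta_def[abs_def])
qed

lemma zeta_continuous: "continuous_on UNIV zeta"
  by (rule Ck_continuous[OF test_fun_Ck[OF zeta_test_fun, of 0]])

lemma zeta_borel [measurable]: "zeta \<in> borel_measurable borel"
  by (rule borel_measurable_continuous_onI[OF zeta_continuous])

lemma zeta_nonneg: "0 \<le> zeta x"
  unfolding zeta_def by (rule mol_nonneg) auto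

lemma zeta_support:
  assumes "zeta x \<noteq> 0" shows "1/4 \<le> x $ i \<and> x $ i \<le> 3/4"
proof -
  have "\<bar>(x - center) $ i\<bar> \<le> 1/4"
    by (rule mol_support[where h="\<lambda>_. 1/4"]) (use assms in \<open>auto simp: zeta_def\<close>)
  then have "\<bar>x $ i - 1/2\<bar> \<le> 1/4" by (simp add: center_def)
  then show ?thesis by linarith
qed

lemma zeta_outside: "x \<notin> {x. \<forall>i. 1/4 \<le> x $ i \<and> x $ i \<le> 3/4} \<Longrightarrow> zeta x = 0"
  using zeta_support[of x] by auto

lemma zeta_shift_in_box:
  assumes "zeta x \<noteq> 0" "\<And>l. \<bar>c $ l\<bar> \<le> 1/8" shows "x + c \<in> box 0 1"
proof -
  have "0 < (x + c) $ l \<and> (x + c) $ l < 1" for l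
    using zeta_support[OF assms(1), of l] assms(2)[of l] by (auto simp: abs_le_iff)
  then show ?thesis by (simp add: mem_box_cart)
qed

lemma zeta_in_box: "zeta x \<noteq> 0 \<Longrightarrow> x \<in> box 0 1"
  using zeta_shift_in_box[of x 0] by simp

lemma zeta_integrable: "integrable lborel zeta"
proof -
  have "integrable lborel (mol (\<lambda>_. 1/4) (\<lambda>_. 0))" by (intro cs_integrable ker_cs ker_mol_quarter)
  from integrable_lborel_add[OF this, of "- center"] show ?thesis by (simp add: zeta_def[abs_def])
qed

lemma zeta_integral: "(\<integral>x. zeta x \<partial>(lborel :: (real^'n) measure)) = 1"
proof -
  have "(mol (\<lambda>_. 1/4) (\<lambda>_. 0) :: real^'n \<Rightarrow> real) \<in> borel_measurable borel" by (intro ker_borel ker_mol_quarter)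
  from integral_lborel_add[OF this, of "- center"] show ?thesis
    using integral_mol[of "\<lambda>_ :: 'n. 1/4"] by (simp add: zeta_def[abs_def])
qed

lemma zeta_bounded_ex: "\<exists>B\<ge>1. \<forall>x :: real^'n. zeta x \<le> B"
proof -
  obtain B where B: "\<And>x :: real^'n. \<bar>mol (\<lambda>_. 1/4) (\<lambda>_. 0) x\<bar> \<le> B"
    using ker_bounded[OF ker_mol_quarter] by blast
  have "zeta x \<le> max 1 B" for x :: "real^'n"
    using B[of "x - center"] by (simp add: zeta_def)
  then show ?thesis by (intro exI[of _ "max 1 B"]) auto
qed

definition zeta_bound :: "'n::finite itself \<Rightarrow> real" where
  "zeta_bound _ = (SOME B. B \<ge> 1 \<and> (\<forall>x :: real^'n. zeta x \<le> B))"

lemma zeta_bound: "1 \<le> zeta_bound TYPE('n::finite)" "zeta (x :: real^'n) \<le> zeta_bound TYPE('n)"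
proof -
  have "\<exists>B. B \<ge> 1 \<and> (\<forall>x :: real^'n. zeta x \<le> B)" using zeta_bounded_ex by auto
  from someI_ex[OF this] show "1 \<le> zeta_bound TYPE('n::finite)" "zeta (x :: real^'n) \<le> zeta_bound TYPE('n)"
    unfolding zeta_bound_def by auto
qed

text \<open>A weighted \<open>L^1\<close> seminorm. As a Bochner integral it is 0 on arguments that
  are not integrable: upper bounds then hold trivially, while lower bounds demand
  integrability.\<close>

definition av :: "(real^'n \<Rightarrow> real) \<Rightarrow> real" where
  "av g = (\<integral>x. zeta x * \<bar>g x\<bar> \<partial>lborel)"

lemma av_integrable:
  fixes g :: "real^'n \<Rightarrow> real"
  assumes "integrable lborel g" shows "integrable lborel (\<lambda>x. zeta x * \<bar>g x\<bar>)"
proof (rule Bochner_Integration.integrable_bound[where f="\<lambda>x. zeta_bound TYPE('n) * g x"])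
  show "integrable lborel (\<lambda>x. zeta_bound TYPE('n) * g x)" using assms by simp
  have "\<bar>zeta x * \<bar>g x\<bar>\<bar> \<le> \<bar>zeta_bound TYPE('n) * g x\<bar>" for x
    unfolding abs_mult using zeta_bound(2)[of x] zeta_nonneg[of x] by (intro mult_mono) auto
  then show "AE x in lborel. norm (zeta x * \<bar>g x\<bar>) \<le> norm (zeta_bound TYPE('n) * g x)" by simp
qed (use assms in simp)

lemma av_triangle:
  fixes f g h :: "real^'n \<Rightarrow> real"
  assumes "integrable lborel g" "integrable lborel h" "\<And>x. zeta x \<noteq> 0 \<Longrightarrow> \<bar>f x\<bar> \<le> \<bar>g x\<bar> + \<bar>h x\<bar>"
  shows "av f \<le> av g + av h"
proof (cases "integrable lborel (\<lambda>x. zeta x * \<bar>f x\<bar>)")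
  case True
  have "av f \<le> (\<integral>x. zeta x * \<bar>g x\<bar> + zeta x * \<bar>h x\<bar> \<partial>lborel)"
    unfolding av_def
  proof (intro integral_mono True Bochner_Integration.integrable_add av_integrable assms)
    fix x
    have "zeta x * \<bar>f x\<bar> \<le> zeta x * (\<bar>g x\<bar> + \<bar>h x\<bar>)"
      by (cases "zeta x = 0") (auto intro!: mult_left_mono assms(3) zeta_nonneg)
    then show "zeta x * \<bar>f x\<bar> \<le> zeta x * \<bar>g x\<bar> + zeta x * \<bar>h x\<bar>" by (simp add: distrib_left)
  qed
  then show ?thesis by (simp add: av_def av_integrable assms)
next
  case False
  then have "av f = 0" by (simp add: av_def not_integrable_integral_eq)
  then show ?thesis by (simp add: av_def zeta_nonneg)
qed

lemma av_mono:
  fixes f g :: "real^'n \<Rightarrow> real"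
  assumes "integrable lborel g" "\<And>x. zeta x \<noteq> 0 \<Longrightarrow> \<bar>f x\<bar> \<le> c * \<bar>g x\<bar>" "0 \<le> c"
  shows "av f \<le> c * av g"
proof -
  have i: "integrable lborel (\<lambda>x. c * g x)" using assms(1) by simp
  have "av f \<le> av (\<lambda>x. c * g x) + av (\<lambda>x :: real^'n. 0)"
    by (rule av_triangle[OF i]) (use assms(2,3) in \<open>auto simp: abs_mult\<close>)
  also have "\<dots> = c * av g" using assms(3) by (simp add: av_def abs_mult mult.left_commute)
  finally show ?thesis .
qed

text \<open>The variance of \<open>\<bar>g\<bar>\<close> under the probability density
  \<open>zeta\<close> is nonnegative; then \<open>zeta\<close> is bounded by a constant that is at
  least 1, which may therefore be squared.\<close>

lemma av_le_L2:
  fixes g :: "real^'n \<Rightarrow> real"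
  assumes "integrable lborel g" "integrable lborel (\<lambda>x. (g x)\<^sup>2)" "nsq g \<le> K\<^sup>2" "0 \<le> K"
  shows "av g \<le> zeta_bound TYPE('n) * K"
proof -
  define m where "m = av g"
  define B where "B = zeta_bound TYPE('n)"
  have B: "1 \<le> B" "\<And>x :: real^'n. zeta x \<le> B" unfolding B_def by (rule zeta_bound)+
  have [measurable]: "g \<in> borel_measurable lborel" using assms(1) by auto
  have i2: "integrable lborel (\<lambda>x. zeta x * (g x)\<^sup>2)"
  proof (rule Bochner_Integration.integrable_bound[where f="\<lambda>x. B * (g x)\<^sup>2"])
    show "integrable lborel (\<lambda>x. B * (g x)\<^sup>2)" using assms by simp
    show "AE x in lborel. norm (zeta x * (g x)\<^sup>2) \<le> norm (B * (g x)\<^sup>2)"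
      using B by (auto simp: abs_mult zeta_nonneg intro!: mult_right_mono)
  qed simp
  have "0 \<le> (\<integral>x. zeta x * (\<bar>g x\<bar> - m)\<^sup>2 \<partial>lborel)" by (simp add: zeta_nonneg)
  also have "\<dots> = (\<integral>x. (zeta x * (g x)\<^sup>2 - 2 * m * (zeta x * \<bar>g x\<bar>)) + m\<^sup>2 * zeta x \<partial>lborel)"
    by (intro Bochner_Integration.integral_cong refl) (simp add: power2_eq_square algebra_simps)
  also have "\<dots> = (\<integral>x. zeta x * (g x)\<^sup>2 \<partial>lborel) - 2 * m * m + m\<^sup>2"
    by (subst Bochner_Integration.integral_add Bochner_Integration.integral_diff;
        (intro Bochner_Integration.integrable_diff integrable_mult_right i2 av_integrable assms zeta_integrable)?)+
       (simp add: m_def av_def zeta_integral)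
  finally have "m\<^sup>2 \<le> (\<integral>x. zeta x * (g x)\<^sup>2 \<partial>lborel)" by (simp add: power2_eq_square)
  also have "\<dots> \<le> (\<integral>x. B * (g x)\<^sup>2 \<partial>lborel)"
    using i2 assms(2) B by (intro integral_mono) (auto intro!: mult_right_mono)
  also have "\<dots> \<le> B * K\<^sup>2" using assms(3) B by simp
  also have "\<dots> \<le> B\<^sup>2 * K\<^sup>2" using B by (intro mult_right_mono) (auto simp: power2_eq_square)
  finally have "m\<^sup>2 \<le> (B * K)\<^sup>2" by (simp add: power_mult_distrib)
  then have "m \<le> B * K" by (rule power2_le_imp_le) (use B assms(4) in auto)
  then show ?thesis by (simp add: m_def B_def)
qed

text \<open>The mollification error averages the increments \<open>f x - f (x - z)\<close> with the
  kernel as weight, so this is Minkowski's inequality in integral form. The extra shift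
  \<open>c\<close> serves \<open>nonlinear_transfer\<close>, where the error is also needed at
  displaced points.\<close>

lemma av_conv_le:
  fixes f :: "real^'n \<Rightarrow> real"
  assumes f: "loc f" and h: "\<And>i. 0 < h i" "\<And>i. h i \<le> 1"
    and R: "\<And>z. (\<And>i. \<bar>z $ i\<bar> \<le> h i) \<Longrightarrow> av (\<lambda>x. f (x + c) - f (x + (c - z))) \<le> R"
  shows "av (\<lambda>x. f (x + c) - conv f (mol h (\<lambda>_. 0)) (x + c)) \<le> R"
proof -
  let ?k = "mol h (\<lambda>_. 0)"
  have k: "ker ?k" by (rule ker_mol) (use h in auto)
  note [measurable] = loc_borel[OF f] ker_borel[OF k]
  have fi: "integrable lborel f" using f by (simp add: loc_def)
  have kn: "0 \<le> ?k z" for z by (rule mol_nonneg) (use h in auto)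
  have ki: "integrable lborel ?k" by (intro cs_integrable ker_cs k)
  have kI: "(\<integral>\<^sup>+z. ennreal (?k z) \<partial>lborel) = 1"
    using nn_integral_eq_integral[OF ki] kn integral_mol[of h] h by simp
  have R0: "0 \<le> R"
  proof -
    have "0 \<le> av (\<lambda>x. f (x + c) - f (x + (c - 0)))" by (simp add: av_def)
    also have "\<dots> \<le> R" by (rule R) (use h in \<open>auto intro: less_imp_le\<close>)
    finally show ?thesis .
  qed
  have fci: "integrable lborel (\<lambda>x. f (x + c) - conv f ?k (x + c))"
    by (intro Bochner_Integration.integrable_diff integrable_lborel_add fi cs_integrable cs_conv f k)
  have cm [measurable]: "conv f ?k \<in> borel_measurable borel" by (intro cs_borel cs_conv f k)
  have pt: "ennreal (zeta x * \<bar>f (x + c) - conv f ?k (x + c)\<bar>) \<le>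
     (\<integral>\<^sup>+z. ennreal (?k z) * ennreal (zeta x * \<bar>f (x + c) - f (x + (c - z))\<bar>) \<partial>lborel)" for x
  proof -
    have i1: "integrable lborel (\<lambda>z. f (x + c - z) * ?k z)"
      using integrable_lborel_isometry[OF _ conv_integrable[OF f k, of "x + c"], of "-1" "x + c"] by simp
    have c: "conv f ?k (x + c) = (\<integral>z. f (x + c - z) * ?k z \<partial>lborel)"
      unfolding conv_def using integral_lborel_isometry[of "-1" "\<lambda>y. f y * ?k (x + c - y)" "x + c"] by simp
    have "f (x + c) - conv f ?k (x + c) = (\<integral>z. f (x + c) * ?k z - f (x + c - z) * ?k z \<partial>lborel)"
      using i1 ki integral_mol[of h] h unfolding c by (subst Bochner_Integration.integral_diff) auto
    also have "ennreal \<bar>\<dots>\<bar> \<le> (\<integral>\<^sup>+z. ennreal (norm (f (x + c) * ?k z - f (x + c - z) * ?k z)) \<partial>lborel)"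
      using integral_norm_bound_ennreal[of lborel "\<lambda>z. f (x + c) * ?k z - f (x + c - z) * ?k z"] i1 ki by simp
    finally have "ennreal (zeta x) * ennreal \<bar>f (x + c) - conv f ?k (x + c)\<bar> \<le>
       ennreal (zeta x) * (\<integral>\<^sup>+z. ennreal (norm (f (x + c) * ?k z - f (x + c - z) * ?k z)) \<partial>lborel)"
      by (rule mult_left_mono) simp
    also have "\<dots> = (\<integral>\<^sup>+z. ennreal (zeta x) * ennreal (norm (f (x + c) * ?k z - f (x + c - z) * ?k z)) \<partial>lborel)"
      by (rule nn_integral_cmult[symmetric]) simp
    also have "\<dots> = (\<integral>\<^sup>+z. ennreal (?k z) * ennreal (zeta x * \<bar>f (x + c) - f (x + (c - z))\<bar>) \<partial>lborel)"
    proof (rule nn_integral_cong)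
      fix z
      have "norm (f (x + c) * ?k z - f (x + c - z) * ?k z) = ?k z * \<bar>f (x + c) - f (x + (c - z))\<bar>"
      proof -
        have "f (x + c) * ?k z - f (x + c - z) * ?k z = ?k z * (f (x + c) - f (x + (c - z)))"
          by (simp add: algebra_simps)
        then show ?thesis using kn[of z] by (simp only: real_norm_def abs_mult abs_of_nonneg)
      qed
      then show "ennreal (zeta x) * ennreal (norm (f (x + c) * ?k z - f (x + c - z) * ?k z)) =
          ennreal (?k z) * ennreal (zeta x * \<bar>f (x + c) - f (x + (c - z))\<bar>)"
        using kn[of z] zeta_nonneg[of x] by (simp add: ennreal_mult'[symmetric] mult_ac)
    qed
    finally show ?thesis using zeta_nonneg[of x] by (simp add: ennreal_mult')
  qed
  have "ennreal (av (\<lambda>x. f (x + c) - conv f ?k (x + c))) = (\<integral>\<^sup>+x. ennreal (zeta x * \<bar>f (x + c) - conv f ?k (x + c)\<bar>) \<partial>lborel)"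
    unfolding av_def by (rule nn_integral_eq_integral[symmetric, OF av_integrable[OF fci]]) (simp add: zeta_nonneg)
  also have "\<dots> \<le> (\<integral>\<^sup>+x. (\<integral>\<^sup>+z. ennreal (?k z) * ennreal (zeta x * \<bar>f (x + c) - f (x + (c - z))\<bar>) \<partial>lborel) \<partial>lborel)"
    by (rule nn_integral_mono) (rule pt)
  also have "\<dots> = (\<integral>\<^sup>+z. (\<integral>\<^sup>+x. ennreal (?k z) * ennreal (zeta x * \<bar>f (x + c) - f (x + (c - z))\<bar>) \<partial>lborel) \<partial>lborel)"
    by (rule lborel_pair.Fubini'[symmetric]) (simp add: split_beta')
  also have "\<dots> \<le> (\<integral>\<^sup>+z. ennreal (?k z) * ennreal R \<partial>lborel)"
  proof (rule nn_integral_mono)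
    fix z
    show "(\<integral>\<^sup>+x. ennreal (?k z) * ennreal (zeta x * \<bar>f (x + c) - f (x + (c - z))\<bar>) \<partial>lborel) \<le> ennreal (?k z) * ennreal R"
    proof (cases "?k z = 0")
      case False
      then have z: "\<bar>z $ i\<bar> \<le> h i" for i by (rule mol_support[rotated -1]) (use h in auto)
      have "integrable lborel (\<lambda>x. f (x + c) - f (x + (c - z)))"
        by (intro Bochner_Integration.integrable_diff integrable_lborel_add fi)
      then have "(\<integral>\<^sup>+x. ennreal (zeta x * \<bar>f (x + c) - f (x + (c - z))\<bar>) \<partial>lborel) = ennreal (av (\<lambda>x. f (x + c) - f (x + (c - z))))"
        unfolding av_def by (intro nn_integral_eq_integral av_integrable) (auto simp: zeta_nonneg)
      also have "\<dots> \<le> ennreal R" by (intro ennreal_leI R z)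
      finally show ?thesis by (simp add: nn_integral_cmult mult_left_mono)
    qed simp
  qed
  also have "\<dots> = ennreal R" by (simp add: nn_integral_multc kI)
  finally show ?thesis using R0 by (simp add: ennreal_le_iff)
qed

text \<open>The number 3/4 is the largest coordinate difference between a point of
  \<open>[1/4, 3/4]^n\<close>, where \<open>zeta\<close> lives, and a point of the unit
  cube.\<close>

lemma mol_unit_positive:
  "\<exists>c>0. \<forall>z :: real^'n. (\<forall>i. \<bar>z $ i\<bar> \<le> 3/4) \<longrightarrow> c \<le> mol (\<lambda>_. 1) (\<lambda>_. 0) z"
proof -
  let ?S = "{z::real^'n. \<forall>i. \<bar>z $ i\<bar> \<le> 3/4}"
  have k: "ker (mol (\<lambda>_. 1) (\<lambda>_. 0) :: real^'n \<Rightarrow> real)" by (rule ker_mol) auto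
  have "0 \<in> ?S" by simp
  then obtain z0 where z0: "z0 \<in> ?S" "\<And>z. z \<in> ?S \<Longrightarrow> mol (\<lambda>_. 1) (\<lambda>_. 0) z0 \<le> mol (\<lambda>_. 1) (\<lambda>_. 0) z"
    using continuous_attains_inf[of ?S "mol (\<lambda>_. 1) (\<lambda>_. 0)"] compact_hbox[of "\<lambda>_. 3/4"]
      continuous_on_subset[OF ker_continuous[OF k]] by blast
  have "\<bar>z0 $ i\<bar> < 1" for i
  proof -
    have "\<bar>z0 $ i\<bar> \<le> 3/4" using z0(1) by blast
    then show ?thesis by linarith
  qed
  then have "0 < mol (\<lambda>_. 1) (\<lambda>_. 0) z0"
    using kern_pos[of z0 "\<lambda>_. 1"] kern_mass_pos[where 'n='n] by (simp add: mol_def)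
  with z0 show ?thesis by (intro exI[of _ "mol (\<lambda>_. 1) (\<lambda>_. 0) z0"]) auto
qed

definition mol_low :: "'n::finite itself \<Rightarrow> real" where
  "mol_low _ = (SOME c. c > 0 \<and> (\<forall>z :: real^'n. (\<forall>i. \<bar>z $ i\<bar> \<le> 3/4) \<longrightarrow> c \<le> mol (\<lambda>_. 1) (\<lambda>_. 0) z))"

lemma mol_low: "0 < mol_low TYPE('n::finite)"
  "(\<And>i. \<bar>z $ i\<bar> \<le> 3/4) \<Longrightarrow> mol_low TYPE('n) \<le> mol (\<lambda>_. 1) (\<lambda>_. 0) (z :: real^'n)"
proof -
  have "\<exists>c. c > 0 \<and> (\<forall>z :: real^'n. (\<forall>i. \<bar>z $ i\<bar> \<le> 3/4) \<longrightarrow> c \<le> mol (\<lambda>_. 1) (\<lambda>_. 0) z)"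
    using mol_unit_positive by auto
  from someI_ex[OF this] show "0 < mol_low TYPE('n::finite)"
    "(\<And>i. \<bar>z $ i\<bar> \<le> 3/4) \<Longrightarrow> mol_low TYPE('n) \<le> mol (\<lambda>_. 1) (\<lambda>_. 0) (z :: real^'n)"
    unfolding mol_low_def by auto
qed

text \<open>A nonnegative function cannot lose mass by cancellation: wherever \<open>zeta\<close> is
  nonzero, its mollification at scale 1 is at least a fixed multiple of its integral. This yields
  smallness that does not depend on the perimeter.\<close>

lemma av_le_unit_mollification:
  fixes f :: "real^'n \<Rightarrow> real"
  assumes "loc f" "\<And>x. 0 \<le> f x"
  shows "mol_low TYPE('n) * av f \<le> zeta_bound TYPE('n) * av (conv f (mol (\<lambda>_. 1) (\<lambda>_. 0)))"
proof -
  let ?k = "mol (\<lambda>_. 1) (\<lambda>_. 0) :: real^'n \<Rightarrow> real"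
  define c where "c = mol_low TYPE('n)"
  have k: "ker ?k" by (rule ker_mol) auto
  have fi: "integrable lborel f" using assms by (simp add: loc_def)
  have kn: "0 \<le> ?k z" for z by (rule mol_nonneg) auto
  have lower: "c * (\<integral>x. f x \<partial>lborel) \<le> conv f ?k x" if "zeta x \<noteq> 0" for x
  proof -
    have "c * f y \<le> f y * ?k (x - y)" for y
    proof (cases "f y = 0")
      case False
      then have "y \<in> cbox 0 1" using assms(1) by (auto simp: loc_def)
      have "\<bar>(x - y) $ i\<bar> \<le> 3/4" for i
      proof -
        have "0 \<le> y $ i" "y $ i \<le> 1" using \<open>y \<in> cbox 0 1\<close> by (auto simp: mem_box_cart)
        then show ?thesis using zeta_support[OF that, of i] unfolding vector_minus_component by linarith
      qed
      then have "c \<le> ?k (x - y)" unfolding c_def by (rule mol_low)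
      from mult_right_mono[OF this assms(2)[of y]] show ?thesis by (simp only: mult.commute[of "f y"])
    qed simp
    then have "(\<integral>y. c * f y \<partial>lborel) \<le> (\<integral>y. f y * ?k (x - y) \<partial>lborel)"
      using fi by (intro integral_mono conv_integrable assms k) auto
    then show ?thesis by (simp add: conv_def)
  qed
  have ci: "integrable lborel (conv f ?k)" by (intro cs_integrable cs_conv assms k)
  have "c * (\<integral>x. f x \<partial>lborel) = (\<integral>x. zeta x * (c * (\<integral>x. f x \<partial>lborel)) \<partial>(lborel :: (real^'n) measure))"
    by (simp add: zeta_integral)
  also have "\<dots> \<le> av (conv f ?k)"
    unfolding av_def
  proof (intro integral_mono av_integrable ci)
    show "zeta x * (c * (\<integral>x. f x \<partial>lborel)) \<le> zeta x * \<bar>conv f ?k x\<bar>" for x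
      using lower[of x] zeta_nonneg[of x] by (cases "zeta x = 0") (auto intro!: mult_left_mono)
  qed (simp add: zeta_integrable)
  finally have 1: "c * (\<integral>x. f x \<partial>lborel) \<le> av (conv f ?k)" .
  have "av f \<le> (\<integral>x. zeta_bound TYPE('n) * f x \<partial>lborel)"
    unfolding av_def using fi assms(2) zeta_bound(2) by (intro integral_mono av_integrable) (auto intro!: mult_right_mono)
  then have "c * av f \<le> zeta_bound TYPE('n) * (c * (\<integral>x. f x \<partial>lborel))"
    using mol_low(1)[where 'n='n] by (simp add: c_def)
  also have "\<dots> \<le> zeta_bound TYPE('n) * av (conv f ?k)"
    using 1 zeta_bound(1)[where 'n='n] by (intro mult_left_mono) auto
  finally show ?thesis by (simp add: c_def)
qed

lemma norm_axis_real: "norm (axis i x :: real^'n) = \<bar>x\<bar>"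
  unfolding norm_vec_def L2_set_def by (simp add: axis_def if_distrib[of "\<lambda>x. x\<^sup>2"] cong: if_cong)

section \<open>Estimates in terms of elastic energy and perimeter\<close>

text \<open>The number \<open>K\<close> majorizes all constants that occur, so that later bounds
  read \<open>K\<close> times a sum of scale quotients. The limit 1/8 for the shifts comes from the
  support of \<open>zeta\<close>.\<close>

locale cube_strain = strain v M f D e
  for v :: "'n::finite \<Rightarrow> real^'n \<Rightarrow> real" and M f D e +
  fixes T s B C N K :: real
  defines "B \<equiv> zeta_bound TYPE('n)" and "C \<equiv> mol_const TYPE('n)" and "N \<equiv> real CARD('n)"
    and "K \<equiv> 100 * zeta_bound TYPE('n) ^ 2 * mol_const TYPE('n) * real CARD('n) * (1 + 1 / mol_low TYPE('n))"
  assumes T_nonneg: "0 \<le> T" and s_pos: "0 < s" and s_le: "s \<le> 1" and D_eq: "D = s ^ 4"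
    and f_le: "\<bar>f i x\<bar> \<le> 1"
    and bv: "(\<And>l. \<bar>a $ l\<bar> \<le> 1/8) \<Longrightarrow> (\<And>l. \<bar>b $ l\<bar> \<le> 1/8) \<Longrightarrow>
      av (\<lambda>x. f i (x + a) - f i (x + b)) \<le> zeta_bound TYPE('n) * norm (a - b) * T"
begin

lemma B_ge: "1 \<le> B" unfolding B_def by (rule zeta_bound)

lemma C_ge: "1 \<le> C" unfolding C_def by (rule mol_const_ge)

lemma N_ge: "1 \<le> N" unfolding N_def by (simp add: Suc_leI)

lemma K_bounds: "12 * (B * N) \<le> K" "100 * (B * C) \<le> K" "100 * B \<le> K" "B * (B * (100 * C)) / mol_low TYPE('n) \<le> K" "0 \<le> K" "B * N \<le> K"
proof -
  have low: "0 < mol_low TYPE('n)" by (rule mol_low)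
  have K: "K = 100 * (B * (B * (C * (N * (1 + 1 / mol_low TYPE('n))))))"
    by (simp add: K_def B_def C_def N_def power2_eq_square)
  have ge: "1 \<le> 1 + 1 / mol_low TYPE('n)" "1 / mol_low TYPE('n) \<le> 1 + 1 / mol_low TYPE('n)" using low by auto
  have m: "a \<le> x * a" if "1 \<le> x" "0 \<le> a" for a x :: real using mult_right_mono[OF that] by simp
  define L where "L = 1 + 1 / mol_low TYPE('n)"
  have pos: "1 \<le> L" "0 \<le> N" "0 \<le> C" "0 \<le> B" using ge B_ge C_ge N_ge by (auto simp: L_def)
  have "N * 1 \<le> N * L" by (rule mult_left_mono) (use pos in auto)
  then have NL: "N \<le> N * L" "1 \<le> N * L" using N_ge by linarith+
  have CNL: "N * L \<le> C * (N * L)" using m[OF C_ge, of "N * L"] NL by simp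
  have CNL': "C * 1 \<le> C * (N * L)" by (rule mult_left_mono) (use NL pos in auto)
  have nn: "0 \<le> C * (N * L)" using CNL NL pos by linarith
  have B2: "B * (C * (N * L)) \<le> B * (B * (C * (N * L)))" by (rule m) (use B_ge nn pos in auto)
  have "B * N \<le> B * (C * (N * L))" using CNL NL pos by (intro mult_left_mono) auto
  then show BN: "12 * (B * N) \<le> K" using B2 pos mult_nonneg_nonneg[of B N] unfolding K L_def[symmetric] by linarith
  then show "B * N \<le> K" using pos mult_nonneg_nonneg[of B N] by linarith
  have "B * C \<le> B * (C * (N * L))" using CNL' pos by (intro mult_left_mono) auto
  then show 2: "100 * (B * C) \<le> K" using B2 unfolding K L_def[symmetric] by linarith
  have "B * 1 \<le> B * C" by (rule mult_left_mono) (use C_ge pos in auto)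
  with 2 show "100 * B \<le> K" by linarith
  with pos show "0 \<le> K" by linarith
  have "1 / mol_low TYPE('n) \<le> N * L" using ge(2) NL pos N_ge m[of N L] unfolding L_def by linarith
  then have "100 * (B * (B * (C * (1 / mol_low TYPE('n))))) \<le> K" unfolding K L_def[symmetric]
    by (rule mult_left_mono[OF mult_left_mono[OF mult_left_mono[OF mult_left_mono]]]) (use pos in auto)
  then show "B * (B * (100 * C)) / mol_low TYPE('n) \<le> K" by (simp add: mult_ac)
qed

lemma mollified: "(\<And>i. 0 < h i) \<Longrightarrow> (\<And>i. h i \<le> 1) \<Longrightarrow> mollified_strain v M f D h"
  by unfold_locales auto

lemma integrable_f: "integrable lborel (f i)"
  using loc_f by (simp add: loc_def)

lemma sqrt_D: "sqrt D = s\<^sup>2"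
  using s_pos real_sqrt_unique[of "s\<^sup>2" D] by (simp add: D_eq power2_eq_square power4_eq_xxxx mult.assoc)

lemma bv_small:
  assumes "\<And>l. \<bar>c $ l\<bar> \<le> 1/16" "\<And>l. \<bar>z $ l\<bar> \<le> r" "r \<le> 1/16"
  shows "av (\<lambda>x. f i (x + c) - f i (x + (c - z))) \<le> B * (N * r) * T"
proof -
  have "\<bar>(c - z) $ l\<bar> \<le> 1/8" "\<bar>c $ l\<bar> \<le> 1/8" for l
    unfolding vector_minus_component using assms(1)[of l] assms(2)[of l] assms(3) by linarith+
  then have "av (\<lambda>x. f i (x + c) - f i (x + (c - z))) \<le> B * norm (c - (c - z)) * T"
    unfolding B_def by (intro bv)
  also have "\<dots> \<le> B * (N * r) * T"
  proof (intro mult_right_mono mult_left_mono T_nonneg)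
    have "norm z \<le> (\<Sum>l\<in>UNIV. \<bar>z $ l\<bar>)" by (rule norm_le_l1_cart)
    also have "\<dots> \<le> N * r" using sum_bounded_above[of UNIV "\<lambda>l. \<bar>z $ l\<bar>" r] assms(2) by (simp add: N_def)
    finally show "norm (c - (c - z)) \<le> N * r" by simp
  qed (use B_ge in auto)
  finally show ?thesis .
qed

lemma mollification_error:
  assumes "0 < r" "r \<le> 1/16" "\<And>l. \<bar>c $ l\<bar> \<le> 1/16"
  shows "av (\<lambda>x. f i (x + c) - conv (f i) (mol (\<lambda>_. r) (\<lambda>_. 0)) (x + c)) \<le> B * (N * r) * T"
  by (rule av_conv_le[OF loc_f]) (use assms in \<open>auto intro!: bv_small\<close>)

lemma av_le_mollification:
  assumes "ker k" "av (\<lambda>x. f i x - conv (f i) k x) \<le> a" "nsq (conv (f i) k) \<le> b\<^sup>2" "0 \<le> b"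
  shows "av (f i) \<le> a + B * b"
proof -
  have cs: "cs (conv (f i) k)" by (intro cs_conv loc_f assms)
  have "av (f i) \<le> av (\<lambda>x. f i x - conv (f i) k x) + av (conv (f i) k)"
    by (intro av_triangle Bochner_Integration.integrable_diff integrable_f cs_integrable cs) auto
  also have "av (conv (f i) k) \<le> B * b"
    unfolding B_def by (intro av_le_L2 cs_integrable cs_power2 cs assms)
  finally show ?thesis using assms(2) by linarith
qed

lemma two_direction_nsq:
  assumes "\<And>i. 0 < h i" "\<And>i. h i \<le> 1" "i \<noteq> j" "\<And>x. f i x + f j x = 0"
  shows "nsq (conv (f i) (mol h (\<lambda>_. 0))) \<le> (29 * C * s\<^sup>2 / h i)\<^sup>2"
proof -
  interpret m: mollified_strain v M f D e h C
    using mollified[OF assms(1,2)] by (simp_all add: e_def C_def)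
  have "nsq (m.P i (\<lambda>_. 0)) \<le> 800 * (C\<^sup>2 * D / (h i)\<^sup>2)" by (rule m.two_direction_estimate[OF assms(3,4)])
  \<comment> \<open>The constant is rounded up to the next square, \<open>29\<^sup>2\<close>, to
    allow for a root; in the same way 9000 becomes \<open>95\<^sup>2\<close> below.\<close>
  also have "\<dots> \<le> 841 * (C\<^sup>2 * D / (h i)\<^sup>2)" by (intro mult_right_mono) (auto simp: m.D_nonneg)
  also have "\<dots> = (29 * C * s\<^sup>2 / h i)\<^sup>2" by (simp add: D_eq power_mult_distrib power_divide flip: power_mult)
  finally show ?thesis by (simp add: m.P_def)
qed

lemma one_direction_nsq:
  assumes "\<And>i. 0 < h i" "\<And>i. h i \<le> 1" "i \<noteq> j" "i \<noteq> l" "\<And>x. f j x + f l x = 0"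
  shows "nsq (conv (f i) (mol h (\<lambda>_. 0))) \<le> (95 * C * s\<^sup>2 / (h i)\<^sup>2)\<^sup>2"
proof -
  interpret m: mollified_strain v M f D e h C
    using mollified[OF assms(1,2)] by (simp_all add: e_def C_def)
  have "nsq (m.P i (\<lambda>_. 0)) \<le> 9000 * (C\<^sup>2 * D / (h i)^4)" by (rule m.one_direction_estimate[OF assms(3,4,5)])
  also have "\<dots> \<le> 9025 * (C\<^sup>2 * D / (h i)^4)" by (intro mult_right_mono) (auto simp: m.D_nonneg)
  also have "\<dots> = (95 * C * s\<^sup>2 / (h i)\<^sup>2)\<^sup>2" by (simp add: D_eq power_mult_distrib power_divide flip: power_mult)
  finally show ?thesis by (simp add: m.P_def)
qed

lemma scale_K: "a \<le> K" if "a \<le> b * (B * C)" "b \<le> 100" for a b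
proof -
  have "0 \<le> B * C" using B_ge C_ge by simp
  then have "b * (B * C) \<le> 100 * (B * C)" using that(2) by (intro mult_right_mono)
  then show ?thesis using that(1) K_bounds(2) by linarith
qed

section \<open>Weighted \<open>L^1\<close> bounds of phase entries at given length scales\<close>

lemma first_order_quartic:
  assumes "0 < r" "r \<le> 1/16" "i \<noteq> j" "i \<noteq> l" "\<And>x. f j x + f l x = 0"
  shows "av (f i) \<le> K * (r * T + s\<^sup>2 / r\<^sup>2)"
proof -
  have "av (f i) \<le> B * (N * r) * T + B * (95 * C * s\<^sup>2 / r\<^sup>2)"
    by (rule av_le_mollification[where k="mol (\<lambda>_. r) (\<lambda>_. 0)"])
       (use assms C_ge mollification_error[of r 0 i] one_direction_nsq[of "\<lambda>_. r" i j l] in \<open>auto intro!: ker_mol\<close>)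
  also have "\<dots> = (B * N) * (r * T) + (95 * (B * C)) * (s\<^sup>2 / r\<^sup>2)" by simp
  also have "\<dots> \<le> K * (r * T) + K * (s\<^sup>2 / r\<^sup>2)"
    using K_bounds(6) assms T_nonneg scale_K[of "95 * (B * C)" 95]
    by (intro add_mono mult_right_mono) auto
  finally show ?thesis by (simp add: distrib_left)
qed

lemma first_order_quadratic:
  assumes "0 < r" "r \<le> 1/16" "i \<noteq> j" "\<And>x. f i x + f j x = 0"
  shows "av (f i) \<le> K * (r * T + s\<^sup>2 / r)"
proof -
  have "av (f i) \<le> B * (N * r) * T + B * (29 * C * s\<^sup>2 / r)"
    by (rule av_le_mollification[where k="mol (\<lambda>_. r) (\<lambda>_. 0)"])
       (use assms C_ge mollification_error[of r 0 i] two_direction_nsq[of "\<lambda>_. r" i j] in \<open>auto intro!: ker_mol\<close>)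
  also have "\<dots> = (B * N) * (r * T) + (29 * (B * C)) * (s\<^sup>2 / r)" by simp
  also have "\<dots> \<le> K * (r * T) + K * (s\<^sup>2 / r)"
    using K_bounds(6) assms T_nonneg scale_K[of "29 * (B * C)" 29]
    by (intro add_mono mult_right_mono) auto
  finally show ?thesis by (simp add: distrib_left)
qed

text \<open>For an entry of constant sign, mollification at scale 1 suffices by
  \<open>av_le_unit_mollification\<close>, so neither \<open>r\<close> nor \<open>T\<close> appears.
  This is what rules out the third well for first order laminates.\<close>

lemma nonneg_small:
  assumes "\<And>x. 0 \<le> f i x" "nsq (conv (f i) (mol (\<lambda>_. 1) (\<lambda>_. 0))) \<le> (b * C * s\<^sup>2)\<^sup>2" "0 \<le> b" "b \<le> 100"
  shows "av (f i) \<le> K * s\<^sup>2"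
proof -
  let ?k = "mol (\<lambda>_. 1) (\<lambda>_. 0) :: real^'n \<Rightarrow> real"
  have k: "ker ?k" by (rule ker_mol) auto
  have cs: "cs (conv (f i) ?k)" by (intro cs_conv loc_f k)
  have low: "0 < mol_low TYPE('n)" by (rule mol_low)
  have "mol_low TYPE('n) * av (f i) \<le> B * av (conv (f i) ?k)"
    unfolding B_def by (rule av_le_unit_mollification[OF loc_f assms(1)])
  also have "av (conv (f i) ?k) \<le> B * (b * C * s\<^sup>2)"
    unfolding B_def by (intro av_le_L2 cs_integrable cs_power2 cs assms) (use assms C_ge in auto)
  also have "B * (b * C * s\<^sup>2) \<le> B * (100 * C * s\<^sup>2)" using assms B_ge C_ge by (intro mult_left_mono mult_right_mono) auto
  finally have "av (f i) \<le> (B * (B * (100 * C)) / mol_low TYPE('n)) * s\<^sup>2"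
    using low B_ge by (simp add: field_simps)
  also have "\<dots> \<le> K * s\<^sup>2" by (intro mult_right_mono K_bounds) simp
  finally show ?thesis .
qed

lemma nonneg_small_two_direction:
  "(\<And>x. 0 \<le> f i x) \<Longrightarrow> i \<noteq> j \<Longrightarrow> (\<And>x. f i x + f j x = 0) \<Longrightarrow> av (f i) \<le> K * s\<^sup>2"
  using two_direction_nsq[of "\<lambda>_. 1" i j] by (intro nonneg_small[of i 29]) auto

lemma nonneg_small_one_direction:
  "(\<And>x. 0 \<le> f i x) \<Longrightarrow> i \<noteq> j \<Longrightarrow> i \<noteq> l \<Longrightarrow> (\<And>x. f j x + f l x = 0) \<Longrightarrow> av (f i) \<le> K * s\<^sup>2"
  using one_direction_nsq[of "\<lambda>_. 1" i j l] by (intro nonneg_small[of i 95]) auto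

text \<open>The entry \<open>f\<^sub>j\<close> is a Lipschitz function of \<open>f\<^sub>i\<close>. So it inherits the regularity of \<open>f\<^sub>i\<close> at scales
  larger than the one at which it is controlled by the perimeter.\<close>

lemma nonlinear_transfer:
  assumes r: "0 < r" "r \<le> 1/16" and h: "\<And>i. 0 < h i" "\<And>i. h i \<le> 1/16"
    and lip: "\<And>x y. x \<in> box 0 1 \<Longrightarrow> y \<in> box 0 1 \<Longrightarrow> \<bar>f j x - f j y\<bar> \<le> 4 * \<bar>f i x - f i y\<bar>"
    and Q: "\<And>z. (\<And>l. \<bar>z $ l\<bar> \<le> h l) \<Longrightarrow> \<exists>z'. (\<forall>l. \<bar>z' $ l\<bar> \<le> 1/16) \<and> norm (z - z') \<le> r \<and>
       nsq (\<lambda>x. conv (f i) (mol (\<lambda>_. r) (\<lambda>_. 0)) (x + (- z')) - conv (f i) (mol (\<lambda>_. r) (\<lambda>_. 0)) x) \<le> Q\<^sup>2"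
    and Q0: "0 \<le> Q"
  shows "av (\<lambda>x. f j x - conv (f j) (mol h (\<lambda>_. 0)) x) \<le> K * (r * T) + 4 * (B * Q)"
proof -
  let ?P = "conv (f i) (mol (\<lambda>_. r) (\<lambda>_. 0))"
  have csP: "cs ?P" by (intro cs_conv loc_f ker_mol) (use r in auto)
  have iP: "integrable lborel (\<lambda>x. ?P (x + c))" for c by (intro integrable_lborel_add cs_integrable csP)
  have if': "integrable lborel (\<lambda>x. f i (x + c))" for c by (intro integrable_lborel_add integrable_f)
  have main: "av (\<lambda>x. f j (x + 0) - f j (x + (0 - z))) \<le> K * (r * T) + 4 * (B * Q)" if z: "\<And>l. \<bar>z $ l\<bar> \<le> h l" for z
  proof -
    obtain z' where z': "\<And>l. \<bar>z' $ l\<bar> \<le> 1/16" "norm (z - z') \<le> r"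
      "nsq (\<lambda>x. ?P (x + (- z')) - ?P x) \<le> Q\<^sup>2" using Q[OF z] by blast
    have z16: "\<bar>z $ l\<bar> \<le> 1/16" for l using z[of l] h(2)[of l] by linarith
    have z8: "\<bar>(- z) $ l\<bar> \<le> 1/8" for l using z16[of l] by simp
    have 1: "av (\<lambda>x. f j (x + 0) - f j (x + (0 - z))) \<le> 4 * av (\<lambda>x. f i x - f i (x + (- z)))"
    proof (rule av_mono)
      fix x :: "real^'n" assume "zeta x \<noteq> 0"
      note zeta_in_box[OF this] zeta_shift_in_box[of x "- z", OF this z8]
      then show "\<bar>f j (x + 0) - f j (x + (0 - z))\<bar> \<le> 4 * \<bar>f i x - f i (x + (- z))\<bar>"
        using lip[of x "x + (- z)"] by simp
    qed (use if'[of 0] if'[of "-z"] in auto)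
    have "av (\<lambda>x. f i x - f i (x + (- z))) \<le> av (\<lambda>x. f i x - ?P x) + av (\<lambda>x. ?P x - f i (x + (- z)))"
      using if'[of 0] if'[of "-z"] iP[of 0] by (intro av_triangle Bochner_Integration.integrable_diff) auto
    also have "av (\<lambda>x. ?P x - f i (x + (- z))) \<le> av (\<lambda>x. ?P (x + (- z')) - ?P x) + av (\<lambda>x. ?P (x + (- z')) - f i (x + (- z)))"
      using if'[of "-z"] iP[of 0] iP[of "- z'"] by (intro av_triangle Bochner_Integration.integrable_diff) auto
    also have "av (\<lambda>x. ?P (x + (- z')) - f i (x + (- z))) \<le> av (\<lambda>x. f i (x + (- z')) - ?P (x + (- z'))) + av (\<lambda>x. f i (x + (- z')) - f i (x + (- z)))"
      using if'[of "-z"] if'[of "-z'"] iP[of "- z'"] by (intro av_triangle Bochner_Integration.integrable_diff) auto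
    \<comment> \<open>The path from \<open>f i x\<close> to \<open>f i (x - z)\<close>: mollify,
      move by \<open>z'\<close> with the mollified function, undo the mollification, and cover the
      remaining distance, at most \<open>r\<close>, by the perimeter. Three of the four terms cost
      \<open>B * (N * r) * T\<close>; times the Lipschitz constant 4 this is the 12 in
      \<open>K_bounds\<close>.\<close>
    finally have 2: "av (\<lambda>x. f i x - f i (x + (- z))) \<le> av (\<lambda>x. f i x - ?P x) + (av (\<lambda>x. ?P (x + (- z')) - ?P x)
      + (av (\<lambda>x. f i (x + (- z')) - ?P (x + (- z'))) + av (\<lambda>x. f i (x + (- z')) - f i (x + (- z)))))"
      by linarith
    have 3: "av (\<lambda>x. f i x - ?P x) \<le> B * (N * r) * T"
      using mollification_error[of r 0 i] r by simp
    have 4: "av (\<lambda>x. f i (x + (- z')) - ?P (x + (- z'))) \<le> B * (N * r) * T"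
      by (rule mollification_error[OF r]) (use z' in simp)
    have 5: "av (\<lambda>x. ?P (x + (- z')) - ?P x) \<le> B * Q"
      unfolding B_def
      using iP[of "- z'"] iP[of 0] integrable_translate_diff_square[OF csP, of "- z'"] z'(3) Q0
      by (intro av_le_L2 Bochner_Integration.integrable_diff) auto
    have 6: "av (\<lambda>x. f i (x + (- z')) - f i (x + (- z))) \<le> B * (N * r) * T"
    proof -
      have "av (\<lambda>x. f i (x + (- z')) - f i (x + (- z))) \<le> B * norm (- z' - (- z)) * T"
        unfolding B_def
      proof (rule bv)
        show "\<bar>(- z') $ l\<bar> \<le> 1/8" "\<bar>(- z) $ l\<bar> \<le> 1/8" for l using z'(1)[of l] z16[of l] by auto
      qed
      also have "\<dots> \<le> B * (N * r) * T"
      proof (intro mult_right_mono mult_left_mono)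
        have "1 * r \<le> N * r" by (rule mult_right_mono[OF N_ge]) (use r in simp)
        then show "norm (- z' - (- z)) \<le> N * r" using z'(2) by simp
      qed (use B_ge T_nonneg in auto)
      finally show ?thesis .
    qed
    have "12 * (B * N) * (r * T) \<le> K * (r * T)" using K_bounds(1) r T_nonneg by (intro mult_right_mono) auto
    moreover have "12 * (B * N) * (r * T) = 12 * (B * (N * r) * T)" by simp
    ultimately show ?thesis using 1 2 3 4 5 6 by linarith
  qed
  have "av (\<lambda>x. f j (x + 0) - conv (f j) (mol h (\<lambda>_. 0)) (x + 0)) \<le> K * (r * T) + 4 * (B * Q)"
  proof (rule av_conv_le[OF loc_f h(1) _ main])
    show "h i \<le> 1" for i using h(2)[of i] by simp
  qed auto
  then show ?thesis by simp
qed

text \<open>The averaging box has side \<open>r\<close> along \<open>i\<close>, the oscillation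
  direction of \<open>f i\<close>, and side \<open>H\<close> along \<open>j\<close> and
  \<open>l\<close>, where \<open>translation_estimate_quartic\<close> applies. The two-direction
  bound for the mollified \<open>f j\<close> involves only \<open>h j = H\<close> and does not feel
  the short side.\<close>

lemma second_order_quartic:
  assumes r: "0 < r" "r \<le> 1/16" and H: "0 < H" "H \<le> 1/16"
    and ijl: "i \<noteq> j" "i \<noteq> l" "j \<noteq> l" "UNIV = {i, j, l}" and cancel: "\<And>x. f j x + f l x = 0"
    and lip: "\<And>x y. x \<in> box 0 1 \<Longrightarrow> y \<in> box 0 1 \<Longrightarrow> \<bar>f j x - f j y\<bar> \<le> 4 * \<bar>f i x - f i y\<bar>"
  shows "av (f j) \<le> K * (r * T + H * s / r + s\<^sup>2 + s\<^sup>2 / H)"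
proof -
  define h where "h = (\<lambda>k. if k = i then r else H)"
  have h: "0 < h k" "h k \<le> 1/16" for k using r H by (auto simp: h_def)
  have h1: "h k \<le> 1" for k using h(2)[of k] by simp
  interpret m: mollified_strain v M f D e "\<lambda>_. r" C
    using mollified[of "\<lambda>_. r"] r by (simp_all add: e_def C_def)
  \<comment> \<open>A root of the translation bound: two coordinates with constant 72 give
    \<open>144 = 12\<^sup>2\<close>, and 8 is rounded up to \<open>3\<^sup>2\<close>.\<close>
  define Q where "Q = 12 * (H * C * s / r) + 3 * s\<^sup>2"
  have x0: "0 \<le> H * C * s / r" using H C_ge s_pos r by simp
  have Q0: "0 \<le> Q" using x0 by (simp add: Q_def)
  have nsqP: "nsq (m.P i (\<lambda>_. 0)) \<le> 1"
  proof -
    have le1: "(f i x)\<^sup>2 \<le> indicator (cbox 0 1) x" for x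
    proof (cases "x \<in> cbox 0 1")
      case True
      then show ?thesis using f_le[of i x] by (simp add: abs_square_le_1)
    next
      case False
      then show ?thesis using loc_f[of i] by (simp add: loc_def)
    qed
    have int1: "integrable lborel (indicator (cbox 0 1) :: real^'n \<Rightarrow> real)"
      by (intro integrable_real_indicator) (auto simp: emeasure_lborel_cbox_eq)
    have int: "integrable lborel (\<lambda>x. (f i x)\<^sup>2)"
      by (rule Bochner_Integration.integrable_bound[OF int1]) (use le1 loc_borel[OF loc_f] in auto)
    have "nsq (f i) \<le> (\<integral>x. indicator (cbox 0 1) x \<partial>(lborel :: (real^'n) measure))"
      by (intro integral_mono int int1 le1)
    also have "\<dots> = 1"
    proof -
      have "measure lborel (cbox 0 (1 :: real^'n)) = 1"
        by (subst measure_lborel_cbox_eq) (auto simp: Basis_vec_axis inner_axis intro!: prod.neutral)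
      then show ?thesis by simp
    qed
    finally have "nsq (f i) \<le> 1" .
    from integral_conv_mol_square(1)[OF _ _ loc_f int this, of "\<lambda>_. r"] show ?thesis
      using r by (simp add: m.P_def)
  qed
  have nsqQ: "\<exists>z'. (\<forall>l. \<bar>z' $ l\<bar> \<le> 1/16) \<and> norm (z - z') \<le> r \<and>
       nsq (\<lambda>x. conv (f i) (mol (\<lambda>_. r) (\<lambda>_. 0)) (x + (- z')) - conv (f i) (mol (\<lambda>_. r) (\<lambda>_. 0)) x) \<le> Q\<^sup>2"
    if z: "\<And>l. \<bar>z $ l\<bar> \<le> h l" for z
  proof (intro exI[of _ "z $ j *\<^sub>R axis j 1 + z $ l *\<^sub>R axis l 1"] conjI allI)
    let ?z = "z $ j *\<^sub>R axis j 1 + z $ l *\<^sub>R axis l 1 :: real^'n"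
    have comp: "?z $ k = (if k = i then 0 else z $ k)" for k
      using ijl UNIV_I[of k] by (auto simp: axis_def)
    show "\<bar>?z $ k\<bar> \<le> 1/16" for k unfolding comp using z[of k] h(2)[of k] by auto
    have "z - ?z = axis i (z $ i)"
    proof (subst vec_eq_iff, rule allI)
      show "(z - ?z) $ k = axis i (z $ i) $ k" for k
        unfolding vector_minus_component comp by (simp add: axis_def)
    qed
    then show "norm (z - ?z) \<le> r" using z[of i] by (simp add: h_def norm_axis_real)
    have zjl: "(z $ j)\<^sup>2 \<le> H\<^sup>2" "(z $ l)\<^sup>2 \<le> H\<^sup>2" using z[of j] z[of l] ijl H by (auto simp: h_def abs_le_square_iff[symmetric])
    have "nsq (\<lambda>x. m.P i (\<lambda>_. 0) (x + (- ?z)) - m.P i (\<lambda>_. 0) x) \<le>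
       72 * (((- (z $ j))\<^sup>2 + (- (z $ l))\<^sup>2) * (C\<^sup>2 * sqrt D / r\<^sup>2)) + 8 * D"
      by (rule m.translation_estimate_quartic[OF ijl(1-3) cancel nsqP])
         (use s_pos s_le in \<open>auto simp: D_eq power_le_one\<close>)
    also have "\<dots> \<le> 72 * ((H\<^sup>2 + H\<^sup>2) * (C\<^sup>2 * sqrt D / r\<^sup>2)) + 8 * D"
      using zjl m.D_nonneg by (intro add_mono mult_left_mono mult_right_mono) auto
    also have "\<dots> = 144 * (H * C * s / r)\<^sup>2 + 8 * (s\<^sup>2)\<^sup>2"
      unfolding sqrt_D by (simp add: D_eq power_mult_distrib power_divide flip: power_mult)
    also have "\<dots> \<le> Q\<^sup>2"
    proof -
      have "Q\<^sup>2 = 144 * (H * C * s / r)\<^sup>2 + 72 * ((H * C * s / r) * s\<^sup>2) + 9 * (s\<^sup>2)\<^sup>2"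
        unfolding Q_def by (simp only: power2_sum power_mult_distrib) simp
      moreover have "0 \<le> (H * C * s / r) * s\<^sup>2" using x0 by (intro mult_nonneg_nonneg) auto
      moreover have "0 \<le> (s\<^sup>2)\<^sup>2" by simp
      ultimately show ?thesis by linarith
    qed
    finally show "nsq (\<lambda>x. conv (f i) (mol (\<lambda>_. r) (\<lambda>_. 0)) (x + (- ?z)) - conv (f i) (mol (\<lambda>_. r) (\<lambda>_. 0)) x) \<le> Q\<^sup>2"
      by (simp only: m.P_def)
  qed
  have hj: "h j = H" using ijl by (simp add: h_def)
  have "av (f j) \<le> (K * (r * T) + 4 * (B * Q)) + B * (29 * C * s\<^sup>2 / H)"
  proof (rule av_le_mollification)
    show "ker (mol h (\<lambda>_. 0))" by (rule ker_mol[OF h(1) h1])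
    show "av (\<lambda>x. f j x - conv (f j) (mol h (\<lambda>_. 0)) x) \<le> K * (r * T) + 4 * (B * Q)"
      by (rule nonlinear_transfer[OF r h lip nsqQ Q0])
    show "nsq (conv (f j) (mol h (\<lambda>_. 0))) \<le> (29 * C * s\<^sup>2 / H)\<^sup>2"
      using two_direction_nsq[of h j l] h(1) h1 ijl(3) cancel by (simp add: hj)
  qed (use C_ge H in auto)
  also have "\<dots> = K * (r * T) + (48 * (B * C)) * (H * s / r) + (12 * B) * s\<^sup>2 + (29 * (B * C)) * (s\<^sup>2 / H)"
    unfolding Q_def by (simp add: algebra_simps)
  also have "\<dots> \<le> K * (r * T) + K * (H * s / r) + K * s\<^sup>2 + K * (s\<^sup>2 / H)"
    using T_nonneg scale_K[of "48 * (B * C)" 48] scale_K[of "29 * (B * C)" 29] K_bounds(3) B_ge s_pos H r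
    by (intro add_mono mult_right_mono) auto
  finally show ?thesis by (simp add: distrib_left)
qed

text \<open>The geometry is complementary to the quartic case: the fine entry \<open>f j\<close>
  oscillates in the plane of \<open>j\<close> and \<open>l\<close>, so the box is long only along
  \<open>i\<close>, and the coarse entry \<open>f i\<close> has the one-direction bound, which
  involves only \<open>h i = H\<close>.\<close>

lemma second_order_quadratic:
  assumes r: "0 < r" "r \<le> 1/16" and H: "0 < H" "H \<le> 1/16"
    and ijl: "i \<noteq> j" "i \<noteq> l" and cancel: "\<And>x. f j x + f l x = 0"
    and lip: "\<And>x y. x \<in> box 0 1 \<Longrightarrow> y \<in> box 0 1 \<Longrightarrow> \<bar>f i x - f i y\<bar> \<le> 4 * \<bar>f j x - f j y\<bar>"
    and N3: "CARD('n) = 3"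
  shows "av (f i) \<le> K * (r * T + H * s\<^sup>2 / r + s\<^sup>2 + s\<^sup>2 / H\<^sup>2)"
proof -
  \<comment> \<open>A third of \<open>r\<close>, so that the sum norm of the components other than
    \<open>i\<close> is at most \<open>r\<close> in dimension 3.\<close>
  define rr where "rr = r / 3"
  have rr: "0 < rr" "rr \<le> 1/16" using r by (auto simp: rr_def)
  define h where "h = (\<lambda>k. if k = i then H else rr)"
  have h: "0 < h k" "h k \<le> 1/16" for k using rr H by (auto simp: h_def)
  have h1: "h k \<le> 1" for k using h(2)[of k] by simp
  interpret m: mollified_strain v M f D e "\<lambda>_. r" C
    using mollified[of "\<lambda>_. r"] r by (simp_all add: e_def C_def)
  define Q where "Q = 20 * (H * C * s\<^sup>2 / r) + 3 * s\<^sup>2"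
  have x0: "0 \<le> H * C * s\<^sup>2 / r" using H C_ge s_pos r by simp
  have Q0: "0 \<le> Q" using x0 by (simp add: Q_def)
  have nsqQ: "\<exists>z'. (\<forall>l. \<bar>z' $ l\<bar> \<le> 1/16) \<and> norm (z - z') \<le> r \<and>
       nsq (\<lambda>x. conv (f j) (mol (\<lambda>_. r) (\<lambda>_. 0)) (x + (- z')) - conv (f j) (mol (\<lambda>_. r) (\<lambda>_. 0)) x) \<le> Q\<^sup>2"
    if z: "\<And>l. \<bar>z $ l\<bar> \<le> h l" for z
  proof (intro exI[of _ "z $ i *\<^sub>R axis i 1"] conjI allI)
    let ?z = "z $ i *\<^sub>R axis i 1 :: real^'n"
    show "\<bar>?z $ k\<bar> \<le> 1/16" for k using z[of i] H by (auto simp: axis_def h_def)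
    have "norm (z - ?z) \<le> (\<Sum>k\<in>UNIV. \<bar>(z - ?z) $ k\<bar>)" by (rule norm_le_l1_cart)
    also have "\<dots> \<le> real (card (UNIV :: 'n set)) * rr"
    proof (rule sum_bounded_above)
      show "\<bar>(z - ?z) $ k\<bar> \<le> rr" for k using z[of k] rr by (auto simp: axis_def h_def)
    qed
    finally show "norm (z - ?z) \<le> r" by (simp add: N3 rr_def)
    have zi: "(z $ i)\<^sup>2 \<le> H\<^sup>2" using z[of i] H by (auto simp: h_def abs_le_square_iff[symmetric])
    have "nsq (\<lambda>x. m.P j (\<lambda>_. 0) (x + (- (z $ i)) *\<^sub>R axis i 1) - m.P j (\<lambda>_. 0) x) \<le>
       400 * ((- (z $ i))\<^sup>2 * (C\<^sup>2 * D / r\<^sup>2)) + 8 * D"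
      by (rule m.translation_estimate_quadratic[OF ijl cancel refl])
    also have "\<dots> \<le> 400 * (H\<^sup>2 * (C\<^sup>2 * D / r\<^sup>2)) + 8 * D"
      using zi m.D_nonneg by (intro add_mono mult_left_mono mult_right_mono) auto
    also have "\<dots> = 400 * (H * C * s\<^sup>2 / r)\<^sup>2 + 8 * (s\<^sup>2)\<^sup>2"
      by (simp add: D_eq power_mult_distrib power_divide flip: power_mult)
    also have "\<dots> \<le> Q\<^sup>2"
    proof -
      have "Q\<^sup>2 = 400 * (H * C * s\<^sup>2 / r)\<^sup>2 + 120 * ((H * C * s\<^sup>2 / r) * s\<^sup>2) + 9 * (s\<^sup>2)\<^sup>2"
        unfolding Q_def by (simp only: power2_sum power_mult_distrib) simp
      moreover have "0 \<le> (H * C * s\<^sup>2 / r) * s\<^sup>2" using x0 by (intro mult_nonneg_nonneg) auto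
      moreover have "0 \<le> (s\<^sup>2)\<^sup>2" by simp
      ultimately show ?thesis by linarith
    qed
    finally show "nsq (\<lambda>x. conv (f j) (mol (\<lambda>_. r) (\<lambda>_. 0)) (x + (- ?z)) - conv (f j) (mol (\<lambda>_. r) (\<lambda>_. 0)) x) \<le> Q\<^sup>2"
      by (simp add: m.P_def)
  qed
  have hi: "h i = H" by (simp add: h_def)
  have "av (f i) \<le> (K * (r * T) + 4 * (B * Q)) + B * (95 * C * s\<^sup>2 / H\<^sup>2)"
  proof (rule av_le_mollification)
    show "ker (mol h (\<lambda>_. 0))" by (rule ker_mol[OF h(1) h1])
    show "av (\<lambda>x. f i x - conv (f i) (mol h (\<lambda>_. 0)) x) \<le> K * (r * T) + 4 * (B * Q)"
      by (rule nonlinear_transfer[OF r h lip nsqQ Q0])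
    show "nsq (conv (f i) (mol h (\<lambda>_. 0))) \<le> (95 * C * s\<^sup>2 / H\<^sup>2)\<^sup>2"
      using one_direction_nsq[of h i j l] h(1) h1 ijl cancel by (simp add: hi)
  qed (use C_ge H in auto)
  also have "\<dots> = K * (r * T) + (80 * (B * C)) * (H * s\<^sup>2 / r) + (12 * B) * s\<^sup>2 + (95 * (B * C)) * (s\<^sup>2 / H\<^sup>2)"
    unfolding Q_def by (simp add: algebra_simps)
  also have "\<dots> \<le> K * (r * T) + K * (H * s\<^sup>2 / r) + K * s\<^sup>2 + K * (s\<^sup>2 / H\<^sup>2)"
    using T_nonneg scale_K[of "80 * (B * C)" 80] scale_K[of "95 * (B * C)" 95] K_bounds(3) B_ge s_pos H r
    by (intro add_mono mult_right_mono) auto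
  finally show ?thesis by (simp add: distrib_left)
qed

end

section \<open>From the variational problem to mollified displacements\<close>

lemma L1_loc_integrable_scaleR:
  fixes g :: "real^'n \<Rightarrow> 'b::euclidean_space"
  assumes "L1_loc g" "continuous_on UNIV \<phi>" "compact S" "\<And>x. x \<notin> S \<Longrightarrow> \<phi> x = 0"
  shows "integrable lebesgue (\<lambda>x. \<phi> x *\<^sub>R g x)"
proof -
  obtain B where B: "0 \<le> B" "\<And>x. \<bar>\<phi> x\<bar> \<le> B" using compact_support_bounded[OF assms(2-4)] by blast
  have i: "integrable lebesgue (\<lambda>x. indicator S x *\<^sub>R g x)"
    using assms(1,3) by (simp add: L1_loc_def set_integrable_def)
  have m: "\<phi> \<in> borel_measurable lebesgue"
    by (rule measurable_completion) (simp add: borel_measurable_continuous_onI assms(2))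
  have eq: "\<phi> x *\<^sub>R g x = \<phi> x *\<^sub>R (indicator S x *\<^sub>R g x)" for x using assms(4)[of x] by (cases "x \<in> S") auto
  show ?thesis unfolding eq
  proof (rule Bochner_Integration.integrable_bound[where f="\<lambda>x. B *\<^sub>R (indicator S x *\<^sub>R g x)"])
    show "integrable lebesgue (\<lambda>x. B *\<^sub>R (indicator S x *\<^sub>R g x))" by (rule integrable_scaleR_right[OF i])
    show "(\<lambda>x. \<phi> x *\<^sub>R (indicator S x *\<^sub>R g x)) \<in> borel_measurable lebesgue"
      by (intro borel_measurable_scaleR m borel_measurable_integrable[OF i])
    show "AE x in lebesgue. norm (\<phi> x *\<^sub>R (indicator S x *\<^sub>R g x)) \<le> norm (B *\<^sub>R (indicator S x *\<^sub>R g x))"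
      using B by (auto simp: indicator_def abs_mult intro!: AE_I2 mult_right_mono)
  qed
qed

lemma test_fun_compact_support:
  assumes "test_fun \<phi>"
  obtains S where "compact S" "\<And>x. x \<notin> S \<Longrightarrow> \<phi> x = 0" "continuous_on UNIV \<phi>"
  using test_fun_support[OF assms] Ck_continuous[OF test_fun_Ck[OF assms, of 0]] by metis

lemma L1_loc_integrable_test:
  assumes "test_fun \<phi>"
  shows "L1_loc (u :: real^'n \<Rightarrow> real^'m) \<Longrightarrow> integrable lebesgue (\<lambda>x. u x $ i * \<phi> x)"
    and "L1_loc (G :: real^'n \<Rightarrow> real^'m^'k) \<Longrightarrow> integrable lebesgue (\<lambda>x. G x $ l $ i * \<phi> x)"
proof -
  obtain S where S: "compact S" "\<And>x. x \<notin> S \<Longrightarrow> \<phi> x = 0" "continuous_on UNIV \<phi>"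
    using test_fun_compact_support[OF assms] by blast
  show "integrable lebesgue (\<lambda>x. u x $ i * \<phi> x)" if "L1_loc u"
    using integrable_bounded_linear[OF bounded_linear_vec_nth L1_loc_integrable_scaleR[OF that S(3,1,2)]]
    by (simp add: mult.commute)
  show "integrable lebesgue (\<lambda>x. G x $ l $ i * \<phi> x)" if "L1_loc G"
    using integrable_bounded_linear[OF bounded_linear_compose[OF bounded_linear_vec_nth bounded_linear_vec_nth]
        L1_loc_integrable_scaleR[OF that S(3,1,2)]]
    by (simp add: mult.commute)
qed

lemma L1_loc_continuous:
  fixes g :: "real^'n \<Rightarrow> 'b::euclidean_space"
  assumes "continuous_on UNIV g" shows "L1_loc g"
  unfolding L1_loc_def set_integrable_def
proof (intro allI impI)
  fix C :: "(real^'n) set" assume C: "compact C"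
  then have "integrable lborel (\<lambda>x. indicator C x *\<^sub>R g x)"
    by (intro borel_integrable_compact continuous_on_subset[OF assms]) auto
  then show "integrable lebesgue (\<lambda>x. indicator C x *\<^sub>R g x)"
    by (subst integrable_completion) (auto dest: borel_measurable_integrable)
qed

lemma L1_loc_diff: "L1_loc f \<Longrightarrow> L1_loc g \<Longrightarrow> L1_loc (\<lambda>x. f x - g x)"
  unfolding L1_loc_def by (auto intro: set_integral_diff)

text \<open>The product of the test function with an affine component \<open>l\<close> is again a
  test function, so the integral of its partial derivative vanishes; this is the weak formulation
  for the affine part.\<close>

lemma has_weak_gradient_subtract_affine:
  assumes "has_weak_gradient u G"
  shows "has_weak_gradient (\<lambda>x. u x - (F *v x + b)) (\<lambda>x. G x - F)"
  unfolding has_weak_gradient_def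
proof (intro conjI allI impI)
  have ac: "continuous_on UNIV (\<lambda>x. F *v x + b)"
    by (intro continuous_intros linear_continuous_on matrix_vector_mul_bounded_linear)
  have L: "L1_loc u" "L1_loc G" "L1_loc (\<lambda>x. F *v x + b)" "L1_loc (\<lambda>x::real^'a. F)"
    using assms L1_loc_continuous[OF ac] L1_loc_continuous[of "\<lambda>x. F"] by (auto simp: has_weak_gradient_def)
  show "L1_loc (\<lambda>x. u x - (F *v x + b))" "L1_loc (\<lambda>x. G x - F)" by (intro L1_loc_diff L)+
  fix \<phi> :: "real^'a \<Rightarrow> real" and i j assume \<phi>: "test_fun \<phi>"
  note d = test_fun_partial_deriv[OF \<phi>, of j]
  define l where "l x = (F *v x + b) $ i" for x
  have lin: "bounded_linear (\<lambda>x. (F *v x) $ i)"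
    by (rule bounded_linear_compose[OF bounded_linear_vec_nth matrix_vector_mul_bounded_linear])
  have lC: "Ck k l" for k
    unfolding l_def vector_add_component by (intro Ck_add Ck_const Ck_linear lin)
  have lp: "partial_deriv j l x = F $ i $ j" for x
  proof -
    have "(l has_derivative (\<lambda>z. (F *v z) $ i)) (at x)"
      unfolding l_def vector_add_component by (intro has_derivative_add_const bounded_linear_imp_has_derivative lin)
    from partial_derivI[OF this] show ?thesis by (simp add: matrix_vector_mult_basis column_def)
  qed
  have tl: "test_fun (\<lambda>x. \<phi> x * l x)" by (rule test_fun_mult_Ck[OF \<phi> lC])
  have "partial_deriv j (\<lambda>x. \<phi> x * l x) = (\<lambda>x. l x * partial_deriv j \<phi> x + F $ i $ j * \<phi> x)"
    using partial_deriv_mult[OF test_fun_Ck[OF \<phi>] lC] by (simp add: lp fun_eq_iff mult.commute)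
  then have 0: "(\<integral>x. l x * partial_deriv j \<phi> x + F $ i $ j * \<phi> x \<partial>lborel) = 0"
    using integral_partial_deriv[OF tl, of j] by simp
  have meas: "(\<lambda>x. l x * partial_deriv j \<phi> x + F $ i $ j * \<phi> x) \<in> borel_measurable lborel"
  proof -
    have "continuous_on UNIV (\<lambda>x. l x * partial_deriv j \<phi> x + F $ i $ j * \<phi> x)"
      by (intro continuous_intros Ck_continuous[OF lC[of 0]] Ck_continuous[OF test_fun_Ck[OF d, of 0]]
          Ck_continuous[OF test_fun_Ck[OF \<phi>, of 0]])
    then show ?thesis by (simp add: borel_measurable_continuous_onI)
  qed
  have i1: "integrable lebesgue (\<lambda>x. u x $ i * partial_deriv j \<phi> x)" by (rule L1_loc_integrable_test(1)[OF d L(1)])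
  have i2: "integrable lebesgue (\<lambda>x. l x * partial_deriv j \<phi> x)" unfolding l_def by (rule L1_loc_integrable_test(1)[OF d L(3)])
  have i3: "integrable lebesgue (\<lambda>x. G x $ i $ j * \<phi> x)" by (rule L1_loc_integrable_test(2)[OF \<phi> L(2)])
  have i4: "integrable lebesgue (\<lambda>x. F $ i $ j * \<phi> x)" by (rule L1_loc_integrable_test(2)[OF \<phi> L(4)])
  have "(\<integral>x. l x * partial_deriv j \<phi> x + F $ i $ j * \<phi> x \<partial>lebesgue) = 0"
    using 0 integral_completion[OF meas] by simp
  then have 1: "(\<integral>x. l x * partial_deriv j \<phi> x \<partial>lebesgue) = - (\<integral>x. F $ i $ j * \<phi> x \<partial>lebesgue)"
    using Bochner_Integration.integral_add[OF i2 i4] by linarith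
  have 2: "(\<integral>x. u x $ i * partial_deriv j \<phi> x \<partial>lebesgue) = - (\<integral>x. G x $ i $ j * \<phi> x \<partial>lebesgue)"
    using assms \<phi> by (simp add: has_weak_gradient_def)
  have "(\<integral>x. (u x - (F *v x + b)) $ i * partial_deriv j \<phi> x \<partial>lebesgue) =
     (\<integral>x. u x $ i * partial_deriv j \<phi> x - l x * partial_deriv j \<phi> x \<partial>lebesgue)"
    by (intro Bochner_Integration.integral_cong refl) (simp add: l_def algebra_simps)
  also have "\<dots> = - ((\<integral>x. G x $ i $ j * \<phi> x \<partial>lebesgue) - (\<integral>x. F $ i $ j * \<phi> x \<partial>lebesgue))"
    using Bochner_Integration.integral_diff[OF i1 i2] 1 2 by simp
  also have "(\<integral>x. G x $ i $ j * \<phi> x \<partial>lebesgue) - (\<integral>x. F $ i $ j * \<phi> x \<partial>lebesgue) = (\<integral>x. G x $ i $ j * \<phi> x - F $ i $ j * \<phi> x \<partial>lebesgue)"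
    by (rule Bochner_Integration.integral_diff[OF i3 i4, symmetric])
  also have "\<dots> = (\<integral>x. (G x - F) $ i $ j * \<phi> x \<partial>lebesgue)"
    by (intro Bochner_Integration.integral_cong refl) (simp add: algebra_simps)
  finally show "(\<integral>x. (u x - (F *v x + b)) $ i * partial_deriv j \<phi> x \<partial>lebesgue) = - (\<integral>x. (G x - F) $ i $ j * \<phi> x \<partial>lebesgue)" .
qed

text \<open>Borel functions are required because Tonelli's theorem is applied to products of
  \<open>lborel\<close>, whereas the variational problem is stated with Lebesgue measure.\<close>

lemma borel_representative:
  fixes g :: "real^'n \<Rightarrow> real"
  assumes "integrable lebesgue g" "S \<in> sets borel" "\<And>x. x \<notin> S \<Longrightarrow> g x = 0"
  obtains g' where "integrable lborel g'" "\<And>x. x \<notin> S \<Longrightarrow> g' x = 0" "AE x in lebesgue. g x = g' x"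
proof -
  obtain g0 where g0: "g0 \<in> borel_measurable lborel" "AE x in lborel. g x = g0 x"
    using completion_ex_borel_measurable_real[of g lborel] borel_measurable_integrable[OF assms(1)] by auto
  define g' where "g' x = indicator S x * g0 x" for x
  have m: "g' \<in> borel_measurable lborel" using g0 assms(2) unfolding g'_def[abs_def] by simp
  have ae: "AE x in lborel. g x = g' x"
    using g0(2) by eventually_elim (use assms(3) in \<open>auto simp: g'_def indicator_def\<close>)
  have ae': "AE x in lebesgue. g x = g' x" by (rule AE_completion[OF ae])
  have "integrable lebesgue g'"
    by (rule integrable_cong_AE_imp[OF assms(1) measurable_completion[OF m]]) (use ae' in \<open>simp add: eq_commute\<close>)
  then have i: "integrable lborel g'" using integrable_completion[OF m] by simp
  show thesis by (rule that[OF i _ ae']) (simp add: g'_def)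
qed

lemma integral_representative:
  fixes g g' q :: "real^'n \<Rightarrow> real"
  assumes "integrable lborel g'" "AE x in lebesgue. g x = g' x" "q \<in> borel_measurable borel"
    "integrable lebesgue (\<lambda>x. g x * q x)"
  shows "(\<integral>x. g x * q x \<partial>lebesgue) = (\<integral>x. g' x * q x \<partial>lborel)"
proof -
  have m: "(\<lambda>x. g' x * q x) \<in> borel_measurable lborel" using assms(1,3) by simp
  have "(\<integral>x. g x * q x \<partial>lebesgue) = (\<integral>x. g' x * q x \<partial>lebesgue)"
    by (rule integral_cong_AE[OF borel_measurable_integrable[OF assms(4)] measurable_completion[OF m]])
      (use assms(2) in eventually_elim, simp)
  then show ?thesis using integral_completion[OF m] by simp
qed

text \<open>Tests are a bump that is positive on the open box times polynomials. Their derivatives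
  vanish outside the closed box, and \<open>w\<close> vanishes almost everywhere in it, so
  \<open>H\<close> times the bump is orthogonal to all polynomials and hence zero almost
  everywhere.\<close>

lemma weak_gradient_zero_box:
  assumes w: "has_weak_gradient w H" and Q: "AE x in lebesgue. x \<notin> Q \<longrightarrow> w x = 0" "cbox a b \<inter> Q = {}"
  shows "AE x in lebesgue. x \<in> box a b \<longrightarrow> H x $ i $ j = 0"
proof (cases "box a b = {}")
  case False
  then have ab: "a $ k < b $ k" for k by (auto simp: box_eq_empty Basis_vec_axis inner_axis not_le)
  define c where "c = (1/2) *\<^sub>R (a + b)"
  define h where "h k = (b $ k - a $ k) / 2" for k
  have h: "0 < h k" for k using ab[of k] by (simp add: h_def)
  define \<zeta> where "\<zeta> x = kern h (\<lambda>_. 0) (- c + 1 *\<^sub>R x)" for x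
  have t: "test_fun \<zeta>" unfolding \<zeta>_def by (intro test_fun_affine test_fun_kern h) simp
  have out: "\<zeta> x = 0" if "x \<notin> cbox a b" for x
    unfolding \<zeta>_def
  proof (rule kern_outside[OF h], rule)
    assume "- c + 1 *\<^sub>R x \<in> {z. \<forall>i. \<bar>z $ i\<bar> \<le> h i}"
    then have "\<bar>x $ k - (a $ k + b $ k) / 2\<bar> \<le> (b $ k - a $ k) / 2" for k by (auto simp: c_def h_def dest!: spec[of _ k])
    then have "a $ k \<le> x $ k \<and> x $ k \<le> b $ k" for k
      by (auto simp: abs_le_iff field_simps dest!: meta_spec[of _ k])
    then show False using that by (simp add: mem_box_cart)
  qed
  have pos: "0 < \<zeta> x" if "x \<in> box a b" for x
    unfolding \<zeta>_def
  proof (rule kern_pos)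
    fix k
    have "a $ k < x $ k" "x $ k < b $ k" using that by (auto simp: mem_box_cart)
    then show "\<bar>(- c + 1 *\<^sub>R x) $ k\<bar> < h k" by (simp add: c_def h_def abs_less_iff field_simps)
  qed
  have L: "L1_loc w" "L1_loc H" using w by (auto simp: has_weak_gradient_def)
  have int: "integrable lebesgue (\<lambda>x. H x $ i $ j * \<zeta> x)" by (rule L1_loc_integrable_test(2)[OF t L(2)])
  obtain g where g: "integrable lborel g" "\<And>x. x \<notin> cbox a b \<Longrightarrow> g x = 0" "AE x in lebesgue. H x $ i $ j * \<zeta> x = g x"
    using borel_representative[OF int, of "cbox a b"] out by auto
  have "AE x in lborel. g x = 0"
  proof (rule AE_zero_polynomial_test[OF g(1) compact_cbox g(2)])
    fix P :: "real^'a \<Rightarrow> real" assume P: "real_polynomial_function P"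
    have t2: "test_fun (\<lambda>x. \<zeta> x * P x)" by (intro test_fun_mult_Ck t Ck_polynomial P)
    have "(\<integral>x. w x $ i * partial_deriv j (\<lambda>x. \<zeta> x * P x) x \<partial>lebesgue) = 0"
    proof (rule integral_eq_zero_AE)
      show "AE x in lebesgue. w x $ i * partial_deriv j (\<lambda>x. \<zeta> x * P x) x = 0"
        using Q(1)
      proof eventually_elim
        case (elim x)
        show ?case
        proof (cases "x \<in> Q")
          case True
          then have "x \<notin> cbox a b" using Q(2) by auto
          then have "partial_deriv j (\<lambda>x. \<zeta> x * P x) x = 0"
            by (intro partial_deriv_outside[OF test_fun_Ck[OF t2], of "cbox a b"]) (auto simp: out)
          then show ?thesis by simp
        qed (use elim in simp)
      qed
    qed
    then have "(\<integral>x. H x $ i $ j * (\<zeta> x * P x) \<partial>lebesgue) = 0"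
      using w t2 by (simp add: has_weak_gradient_def)
    moreover have "(\<integral>x. (H x $ i $ j * \<zeta> x) * P x \<partial>lebesgue) = (\<integral>x. g x * P x \<partial>lborel)"
      using L1_loc_integrable_test(2)[OF t2 L(2), of i j]
      by (intro integral_representative g borel_measurable_polynomial P) (simp add: mult.assoc)
    ultimately show "(\<integral>x. g x * P x \<partial>lborel) = 0" by (simp add: mult.assoc)
  qed
  then have "AE x in lebesgue. g x = 0" by (rule AE_completion)
  with g(3) show ?thesis
  proof eventually_elim
    case (elim x)
    then show ?case using pos[of x] by auto
  qed
qed simp

text \<open>The complement of \<open>Q\<close> is a countable union of closed boxes, whose frontiers
  are null sets. Applied to the closed cube, it makes the gradient of the deviation from the datum
  vanish outside, as \<open>loc\<close> demands.\<close>

lemma weak_gradient_zero_outside: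
  assumes w: "has_weak_gradient w H" and Q: "AE x in lebesgue. x \<notin> Q \<longrightarrow> w x = 0" "closed Q"
  shows "AE x in lebesgue. x \<notin> Q \<longrightarrow> H x $ i $ j = 0"
proof -
  obtain \<D> where D: "countable \<D>" "\<D> \<subseteq> Pow (- Q)" "\<And>X. X \<in> \<D> \<Longrightarrow> \<exists>a b. X = cbox a b" "\<Union>\<D> = - Q"
    using open_countable_Union_open_cbox[of "- Q"] Q(2) by (auto simp: open_Compl)
  have "AE x in lebesgue. x \<in> X \<longrightarrow> H x $ i $ j = 0" if X: "X \<in> \<D>" for X
  proof -
    obtain a b where ab: "X = cbox a b" using D(3)[OF X] by blast
    have "cbox a b \<inter> Q = {}" using D(2) X ab by auto
    from weak_gradient_zero_box[OF w Q(1) this]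
    have "AE x in lebesgue. x \<in> box a b \<longrightarrow> H x $ i $ j = 0" .
    moreover have "AE x in lebesgue. x \<notin> cbox a b - box a b"
      by (rule AE_not_in) (simp add: negligible_frontier_interval flip: negligible_iff_null_sets)
    ultimately show ?thesis by eventually_elim (auto simp: ab)
  qed
  then have "AE x in lebesgue. \<forall>X\<in>\<D>. x \<in> X \<longrightarrow> H x $ i $ j = 0"
    by (rule AE_ball_countable[OF D(1), THEN iffD2, OF ballI])
  then show ?thesis by eventually_elim (use D(4) in auto)
qed


lemma zeta_compact_support:
  "compact {x :: real^'n. \<forall>i. 1/4 \<le> x $ i \<and> x $ i \<le> 3/4}"
proof -
  have "{x :: real^'n. \<forall>i. 1/4 \<le> x $ i \<and> x $ i \<le> 3/4} = cbox (\<chi> i. 1/4) (\<chi> i. 3/4)"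
    by (auto simp: mem_box_cart)
  then show ?thesis by simp
qed

lemma integrable_indicator_box:
  fixes Y :: "(real^'n) set"
  assumes "Y \<in> sets borel" "Y \<subseteq> box 0 1" shows "integrable lborel (indicator Y :: real^'n \<Rightarrow> real)"
proof (intro integrable_real_indicator)
  have "emeasure lborel Y \<le> emeasure lborel (box 0 (1::real^'n))" by (rule emeasure_mono[OF assms(2)]) simp
  also have "\<dots> < \<infinity>" by (rule emeasure_bounded_finite) simp
  finally show "emeasure lborel Y < \<infinity>" .
qed (use assms in auto)

text \<open>The link between \<open>total_variation\<close>, an integral over the cube against
  Lebesgue measure, and \<open>bv_translation\<close>, which takes a Borel function on the whole
  space: the indicator of \<open>Y\<close> vanishes off the cube and agrees with the phase almost
  everywhere inside.\<close>

lemma av_translate_phase: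
  fixes Y :: "(real^'n) set" and X :: "real^'n \<Rightarrow> bool"
  assumes Y: "Y \<in> sets borel" "Y \<subseteq> box 0 1" "AE x in lebesgue. x \<in> box 0 1 \<longrightarrow> (x \<in> Y \<longleftrightarrow> X x)"
    and meas: "{x \<in> box 0 1. X x} \<in> sets lebesgue"
    and tv: "total_variation (box 0 1) (indicator {x. X x}) \<le> ennreal T" "0 \<le> T"
    and ab: "\<And>l. \<bar>a $ l\<bar> \<le> 1/8" "\<And>l. \<bar>b $ l\<bar> \<le> 1/8"
  shows "av (\<lambda>x. indicator Y (x + a) - indicator Y (x + b)) \<le> zeta_bound TYPE('n) * norm (a - b) * T"
  unfolding av_def
proof (rule bv_translation[where \<Omega>="box 0 1"])
  show "integrable lborel (indicator Y :: real^'n \<Rightarrow> real)" by (rule integrable_indicator_box[OF Y(1,2)])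
  show "test_fun (zeta :: real^'n \<Rightarrow> real)" by (rule zeta_test_fun)
  show "0 \<le> zeta x" "zeta x \<le> zeta_bound TYPE('n)" for x :: "real^'n" by (rule zeta_nonneg zeta_bound)+
  show "0 < zeta_bound TYPE('n)" using zeta_bound(1)[where 'n='n] by simp
  show "compact {x :: real^'n. \<forall>i. 1/4 \<le> x $ i \<and> x $ i \<le> 3/4}" by (rule zeta_compact_support)
  show "zeta x = 0" if "x \<notin> {x. \<forall>i. 1/4 \<le> x $ i \<and> x $ i \<le> 3/4}" for x :: "real^'n"
    using that by (rule zeta_outside)
  show "x + b + t *\<^sub>R (a - b) \<in> box 0 1" if "x \<in> {x. \<forall>i. 1/4 \<le> x $ i \<and> x $ i \<le> 3/4}" "0 \<le> t" "t \<le> 1" for x t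
  proof -
    have "0 < (x + b + t *\<^sub>R (a - b)) $ l \<and> (x + b + t *\<^sub>R (a - b)) $ l < 1" for l
    proof -
      have "\<bar>(1 - t) * b $ l\<bar> \<le> (1 - t) * (1/8)" "\<bar>t * a $ l\<bar> \<le> t * (1/8)"
        using that mult_left_mono[OF ab(2)[of l], of "1 - t"] mult_left_mono[OF ab(1)[of l], of t]
        by (simp_all only: abs_mult abs_of_nonneg diff_ge_0_iff_ge)
      then have "\<bar>(1 - t) * b $ l + t * a $ l\<bar> \<le> (1 - t) * (1/8) + t * (1/8)"
        by (rule order_trans[OF abs_triangle_ineq add_mono])
      moreover have "(1 - t) * (1/8) + t * (1/8) = 1/8" by (simp add: field_simps)
      ultimately have "\<bar>(1 - t) * b $ l + t * a $ l\<bar> \<le> 1/8" by (simp only:)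
      moreover have "1/4 \<le> x $ l" "x $ l \<le> 3/4" using that(1) by auto
      moreover have "(x + b + t *\<^sub>R (a - b)) $ l = x $ l + ((1 - t) * b $ l + t * a $ l)" by (simp add: algebra_simps)
      ultimately show ?thesis by linarith
    qed
    then show ?thesis by (simp add: mem_box_cart)
  qed
  fix \<phi> :: "real^'n \<Rightarrow> real^'n" assume \<phi>: "test_field (box 0 1) \<phi>" "\<And>x. norm (\<phi> x) \<le> 1"
  have cdiv: "continuous_on UNIV (divergence \<phi>)"
    unfolding divergence_def[abs_def] using \<phi>(1) by (intro continuous_intros) (auto simp: test_field_def)
  have "ennreal (LINT x:box 0 1|lebesgue. indicator {x. X x} x * divergence \<phi> x) \<le> total_variation (box 0 1) (indicator {x. X x})"
    unfolding total_variation_def by (rule SUP_upper) (use \<phi> in auto)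
  with tv have "ennreal (LINT x:box 0 1|lebesgue. indicator {x. X x} x * divergence \<phi> x) \<le> ennreal T" by (rule_tac order_trans)
  then have le: "(LINT x:box 0 1|lebesgue. indicator {x. X x} x * divergence \<phi> x) \<le> T"
    using tv(2) by (simp add: ennreal_le_iff)
  have m: "(\<lambda>x. indicator Y x * divergence \<phi> x) \<in> borel_measurable lborel"
    using Y(1) borel_measurable_continuous_onI[OF cdiv] by simp
  have m2: "(\<lambda>x. indicator {x \<in> box 0 1. X x} x * divergence \<phi> x) \<in> borel_measurable lebesgue"
    by (intro borel_measurable_times borel_measurable_indicator meas measurable_completion)
       (simp add: borel_measurable_continuous_onI[OF cdiv])
  have "(LINT x:box 0 1|lebesgue. indicator {x. X x} x * divergence \<phi> x) = (\<integral>x. indicator {x \<in> box 0 1. X x} x * divergence \<phi> x \<partial>lebesgue)"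
    unfolding set_lebesgue_integral_def by (intro Bochner_Integration.integral_cong refl) (auto simp: indicator_def)
  also have "\<dots> = (\<integral>x. indicator Y x * divergence \<phi> x \<partial>lebesgue)"
  proof (rule integral_cong_AE[OF m2 measurable_completion[OF m]])
    show "AE x in lebesgue. indicator {x \<in> box 0 1. X x} x * divergence \<phi> x = indicator Y x * divergence \<phi> x"
      using Y(3) by eventually_elim (use Y(2) in \<open>auto simp: indicator_def\<close>)
  qed
  also have "\<dots> = (\<integral>x. indicator Y x * divergence \<phi> x \<partial>lborel)" by (rule integral_completion[OF m])
  finally show "(\<integral>x. indicator Y x * divergence \<phi> x \<partial>lborel) \<le> T" using le by simp
qed

lemma borel_phase:
  fixes S :: "(real^'n) set"
  assumes "S \<in> sets lebesgue" "S \<subseteq> box 0 1"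
  obtains Y where "Y \<in> sets borel" "Y \<subseteq> S" "AE x in lebesgue. x \<in> S \<longleftrightarrow> x \<in> Y"
proof -
  obtain Y N N' where Y: "S = Y \<union> N" "N \<subseteq> N'" "N' \<in> null_sets lborel" "Y \<in> sets lborel"
    using assms(1) by (rule sets_completionE)
  have "AE x in lborel. x \<notin> N'" by (rule AE_not_in[OF Y(3)])
  then have "AE x in lebesgue. x \<notin> N'" by (rule AE_completion)
  then have "AE x in lebesgue. x \<in> S \<longleftrightarrow> x \<in> Y" by eventually_elim (use Y in auto)
  then show thesis using Y by (intro that[of Y]) auto
qed

lemma unit_cube_eq: "unit_cube = box 0 1"
  by (auto simp: unit_cube_def mem_box_cart)

lemma norm_entry_le: "\<bar>(Z :: real^'n^'m) $ i $ j\<bar> \<le> norm Z"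
  using order_trans[OF component_le_norm_cart Finite_Cartesian_Product.norm_nth_le] .

text \<open>The squared \<open>L\<^sup>2\<close>-error is written as \<open>s\<^sup>4\<close> because its fourth root enters the estimates for
  second order laminates.\<close>

definition admissible :: "real \<Rightarrow> (real^'n^'n) list \<Rightarrow> (real^'n) set \<Rightarrow> real^'n^'n \<Rightarrow> real \<Rightarrow> real \<Rightarrow> bool" where
  "admissible p A \<Omega> F s T \<longleftrightarrow> 0 < s \<and> s \<le> 1 \<and> 0 \<le> T \<and>
    (\<exists>X\<in>BV_into \<Omega> (set A). \<exists>u\<in>dirichlet_class p \<Omega> F.
      (\<integral>\<^sup>+x\<in>\<Omega>. ennreal ((norm (sym_part (weak_gradient u x) - X x))\<^sup>2) \<partial>lebesgue) \<le> ennreal (s ^ 4) \<and>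
      (\<Sum>j=1..<length A. total_variation \<Omega> (phase A X j)) \<le> ennreal T)"

text \<open>Subtracting the boundary datum lets displacement and weak gradient vanish off the cube,
  so the weak formulation involves only functions supported there. As wells and datum are diagonal,
  the off-diagonal part of the symmetrized gradient is pure error.\<close>

lemma energy_cube_strain:
  fixes A0 A1 A2 F :: "real^3^3"
  assumes distinct: "A0 \<noteq> A1" "A0 \<noteq> A2" "A1 \<noteq> A2"
    and diag: "\<And>i j. i \<noteq> j \<Longrightarrow> F $ i $ j = 0" "\<And>i j. i \<noteq> j \<Longrightarrow> A0 $ i $ j = 0"
      "\<And>i j. i \<noteq> j \<Longrightarrow> A1 $ i $ j = 0" "\<And>i j. i \<noteq> j \<Longrightarrow> A2 $ i $ j = 0"
    and le1: "\<And>i. \<bar>A0 $ i $ i - F $ i $ i\<bar> \<le> 1" "\<And>i. \<bar>A1 $ i $ i - F $ i $ i\<bar> \<le> 1" "\<And>i. \<bar>A2 $ i $ i - F $ i $ i\<bar> \<le> 1"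
      "\<And>i. \<bar>A1 $ i $ i - A0 $ i $ i\<bar> \<le> 1" "\<And>i. \<bar>A2 $ i $ i - A0 $ i $ i\<bar> \<le> 1"
    and adm: "admissible p [A0, A1, A2] unit_cube F s T"
  obtains v M f Y1 Y2 where "cube_strain v M f (s ^ 4) T s" "Y1 \<inter> Y2 = {}" "Y1 \<subseteq> box 0 1" "Y2 \<subseteq> box 0 1"
    "\<And>i x. f i x = (if x \<in> Y1 then A1 $ i $ i - F $ i $ i else if x \<in> Y2 then A2 $ i $ i - F $ i $ i
       else if x \<in> box 0 1 then A0 $ i $ i - F $ i $ i else 0)"
proof -
  note cube = unit_cube_eq
  have s: "0 < s" "s \<le> 1" and T0: "0 \<le> T" using adm by (auto simp: admissible_def)
  obtain X u where X: "X \<in> BV_into unit_cube {A0, A1, A2}" and u: "u \<in> dirichlet_class p unit_cube F"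
    and elastic: "(\<integral>\<^sup>+x\<in>unit_cube. ennreal ((norm (sym_part (weak_gradient u x) - X x))\<^sup>2) \<partial>lebesgue) \<le> ennreal (s ^ 4)"
    and tv0: "(\<Sum>j=1..<3. total_variation unit_cube (phase [A0, A1, A2] X j)) \<le> ennreal T"
    using adm by (auto simp: admissible_def numeral_3_eq_3)
  note tv = tv0 T0
  have bs: "box 0 1 \<in> sets (lebesgue :: (real^3) measure)" by simp
  have XK: "X x \<in> {A0, A1, A2}" if "x \<in> box 0 1" for x using X that by (simp add: BV_into_def cube)
  have Xint: "integrable lebesgue (\<lambda>x. indicator (box 0 1) x *\<^sub>R X x)"
    using X by (simp add: BV_into_def cube set_integrable_def)
  have Smeas: "{x \<in> box 0 1. X x = Z} \<in> sets lebesgue" for Z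
  proof -
    have "{x \<in> space lebesgue. indicator (box 0 1) x *\<^sub>R X x = Z} \<in> sets lebesgue"
      using borel_measurable_integrable[OF Xint] by measurable
    moreover have "{x \<in> box 0 1. X x = Z} = box 0 1 \<inter> {x \<in> space lebesgue. indicator (box 0 1) x *\<^sub>R X x = Z}"
      by (auto simp: indicator_def)
    ultimately show ?thesis using sets.Int[OF bs] by (simp only:)
  qed
  obtain Y1 where Y1: "Y1 \<in> sets borel" "Y1 \<subseteq> {x \<in> box 0 1. X x = A1}" "AE x in lebesgue. x \<in> {x \<in> box 0 1. X x = A1} \<longleftrightarrow> x \<in> Y1"
    using borel_phase[OF Smeas] by blast
  obtain Y2 where Y2: "Y2 \<in> sets borel" "Y2 \<subseteq> {x \<in> box 0 1. X x = A2}" "AE x in lebesgue. x \<in> {x \<in> box 0 1. X x = A2} \<longleftrightarrow> x \<in> Y2"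
    using borel_phase[OF Smeas] by blast
  define f where "f i x = (if x \<in> Y1 then A1 $ i $ i - F $ i $ i else if x \<in> Y2 then A2 $ i $ i - F $ i $ i
       else if x \<in> box 0 1 then A0 $ i $ i - F $ i $ i else 0)" for i :: 3 and x :: "real^3"
  have Y12: "Y1 \<inter> Y2 = {}" "Y1 \<subseteq> box 0 1" "Y2 \<subseteq> box 0 1" using Y1(2) Y2(2) distinct by auto
  have fX: "AE x in lebesgue. x \<in> box 0 1 \<longrightarrow> f i x = X x $ i $ i - F $ i $ i" for i
    using Y1(3) Y2(3)
  proof eventually_elim
    case (elim x)
    show ?case using elim XK[of x] distinct by (auto simp: f_def)
  qed
  have fle: "\<bar>f i x\<bar> \<le> 1" for i x using le1[of i] by (auto simp: f_def)
  have fout: "f i x = 0" if "x \<notin> box 0 1" for i x using that Y12 by (auto simp: f_def)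
  have fm: "f i \<in> borel_measurable borel" for i
    unfolding f_def[abs_def] using Y1(1) Y2(1) by measurable
  have fi: "integrable lborel (f i)" for i
  proof (rule Bochner_Integration.integrable_bound[where f="indicator (box 0 1) :: real^3 \<Rightarrow> real"])
    show "integrable lborel (indicator (box 0 1) :: real^3 \<Rightarrow> real)" by (rule integrable_indicator_box) auto
    show "AE x in lborel. norm (f i x) \<le> norm (indicator (box 0 1) x :: real)"
      using fle fout by (auto simp: indicator_def)
  qed (use fm in simp)
  define G where "G = weak_gradient u"
  obtain b where wg: "has_weak_gradient u G" and b: "AE x in lebesgue. x \<notin> box 0 1 \<longrightarrow> u x = F *v x + b"
  proof -
    have "\<exists>G. has_weak_gradient u G" using u by (auto simp: dirichlet_class_def W1p_loc_def)
    then have "has_weak_gradient u G" unfolding G_def weak_gradient_def by (rule someI_ex)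
    with u that show ?thesis by (auto simp: dirichlet_class_def cube)
  qed
  define w where "w x = u x - (F *v x + b)" for x
  define H where "H x = G x - F" for x
  have wH: "has_weak_gradient w H"
    unfolding w_def[abs_def] H_def[abs_def] by (rule has_weak_gradient_subtract_affine[OF wg])
  have L: "L1_loc w" "L1_loc H" using wH by (auto simp: has_weak_gradient_def)
  have w0: "AE x in lebesgue. x \<notin> box 0 1 \<longrightarrow> w x = 0" using b by eventually_elim (simp add: w_def)
  have bd: "AE x in lebesgue. x \<notin> cbox 0 1 - box 0 (1::real^3)"
    by (rule AE_not_in) (simp add: negligible_frontier_interval flip: negligible_iff_null_sets)
  have H0: "AE x in lebesgue. x \<notin> box 0 1 \<longrightarrow> H x $ i $ j = 0" for i j
  proof -
    have "AE x in lebesgue. x \<notin> cbox 0 1 \<longrightarrow> w x = 0"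
      using w0 by eventually_elim (use box_subset_cbox in blast)
    from weak_gradient_zero_outside[OF wH this closed_cbox] bd
    show ?thesis by eventually_elim blast
  qed
  have wint: "integrable lebesgue (\<lambda>x. indicator (box 0 1) x * w x $ i)" for i
  proof -
    have "integrable lebesgue (\<lambda>x. indicator (cbox 0 1) x *\<^sub>R w x)"
      using L(1) by (simp add: L1_loc_def set_integrable_def)
    from integrable_bounded_linear[OF bounded_linear_vec_nth[of i] this]
    have "integrable lebesgue (\<lambda>x. indicator (box 0 1) x *\<^sub>R (indicator (cbox 0 1) x * w x $ i))"
      by (intro integrable_mult_indicator bs) simp
    moreover have "(\<lambda>x. indicator (box 0 1) x *\<^sub>R (indicator (cbox 0 1) x * w x $ i)) = (\<lambda>x. indicator (box 0 1) x * w x $ i)"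
      using box_subset_cbox[of 0 "1::real^3"] by (auto simp: indicator_def fun_eq_iff)
    ultimately show ?thesis by simp
  qed
  have Hint: "integrable lebesgue (\<lambda>x. indicator (box 0 1) x * H x $ i $ j)" for i j
  proof -
    have "integrable lebesgue (\<lambda>x. indicator (cbox 0 1) x *\<^sub>R H x)"
      using L(2) by (simp add: L1_loc_def set_integrable_def)
    from integrable_bounded_linear[OF bounded_linear_compose[OF bounded_linear_vec_nth[of j] bounded_linear_vec_nth[of i]] this]
    have "integrable lebesgue (\<lambda>x. indicator (box 0 1) x *\<^sub>R (indicator (cbox 0 1) x * H x $ i $ j))"
      by (intro integrable_mult_indicator bs) simp
    moreover have "(\<lambda>x. indicator (box 0 1) x *\<^sub>R (indicator (cbox 0 1) x * H x $ i $ j)) = (\<lambda>x. indicator (box 0 1) x * H x $ i $ j)"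
      using box_subset_cbox[of 0 "1::real^3"] by (auto simp: indicator_def fun_eq_iff)
    ultimately show ?thesis by simp
  qed
  \<comment> \<open>Choice supplies, for all indices at once, Borel representatives that vanish
    everywhere, not just almost everywhere, outside the open cube.\<close>
  define Rep where "Rep g g' \<longleftrightarrow> integrable lborel g' \<and> (\<forall>x. x \<notin> box 0 1 \<longrightarrow> g' x = 0) \<and>
    (AE x in lebesgue. indicator (box 0 1) x * g x = g' x)" for g g' :: "real^3 \<Rightarrow> real"
  have Rep: "Rep g (SOME g'. Rep g g')" if int: "integrable lebesgue (\<lambda>x. indicator (box 0 1) x * g x)" for g
  proof (rule someI_ex[of "Rep g"])
    obtain g' where "integrable lborel g'" "\<And>x. x \<notin> box 0 1 \<Longrightarrow> g' x = 0" "AE x in lebesgue. indicator (box 0 1) x * g x = g' x"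
      by (rule borel_representative[OF int, of "box 0 1"]) auto
    then show "\<exists>g'. Rep g g'" unfolding Rep_def by blast
  qed
  define v where "v i = (SOME g'. Rep (\<lambda>x. w x $ i) g')" for i
  define M where "M i j = (SOME g'. Rep (\<lambda>x. H x $ i $ j) g')" for i j
  have Rv: "Rep (\<lambda>x. w x $ i) (v i)" for i unfolding v_def by (rule Rep[OF wint])
  have RM: "Rep (\<lambda>x. H x $ i $ j) (M i j)" for i j unfolding M_def by (rule Rep[OF Hint])
  have v: "integrable lborel (v i)" "x \<notin> box 0 1 \<Longrightarrow> v i x = 0"
    "AE x in lebesgue. indicator (box 0 1) x * w x $ i = v i x" for i x
    using Rv[of i] unfolding Rep_def by blast+
  have M: "integrable lborel (M i j)" "x \<notin> box 0 1 \<Longrightarrow> M i j x = 0"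
    "AE x in lebesgue. indicator (box 0 1) x * H x $ i $ j = M i j x" for i j x
    using RM[of i j] unfolding Rep_def by blast+
  have inc: "x \<notin> box 0 1" if "x \<notin> cbox 0 (1::real^3)" for x using that box_subset_cbox by blast
  have loc: "loc (v i)" "loc (M i j)" "loc (f i)" for i j
    using v(1,2) M(1,2) fi fout inc by (auto simp: loc_def)
  have wv: "AE x in lebesgue. w x $ i = v i x" for i
    using v(3)[of i] w0 by eventually_elim (use v(2) in \<open>auto simp: indicator_def split: if_splits\<close>)
  have HM: "AE x in lebesgue. H x $ i $ j = M i j x" for i j
    using M(3)[of i j] H0[of i j] by eventually_elim (use M(2) in \<open>auto simp: indicator_def split: if_splits\<close>)
  define e where "e i j x = (M i j x + M j i x) / 2 - (if i = j then f i x else 0)" for i j x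
  have em: "e i j \<in> borel_measurable lborel" for i j
    unfolding e_def[abs_def] using M(1)[THEN borel_measurable_integrable] fm by auto
  have ele: "AE x in lebesgue. (e i j x)\<^sup>2 \<le> (norm (sym_part (weak_gradient u x) - X x))\<^sup>2 * indicator (box 0 1) x" for i j
    using HM[of i j] HM[of j i] fX[of i]
  proof eventually_elim
    case (elim x)
    show ?case
    proof (cases "x \<in> box 0 1")
      case True
      have Xd: "X x $ i $ j = 0" if "i \<noteq> j" using XK[OF True] diag that by auto
      have "e i j x = (sym_part (G x) - X x) $ i $ j"
      proof (cases "i = j")
        case True
        then show ?thesis using elim \<open>x \<in> box 0 1\<close>
          by (simp add: e_def sym_part_def transpose_def H_def flip: elim(1))
      next
        case False
        then show ?thesis using elim(1,2) Xd[OF False] diag(1)[OF False] diag(1)[OF False[symmetric]]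
          by (simp add: e_def sym_part_def transpose_def H_def flip: elim(1,2))
      qed
      then have "\<bar>e i j x\<bar> \<le> norm (sym_part (G x) - X x)" using norm_entry_le by metis
      then have "(e i j x)\<^sup>2 \<le> (norm (sym_part (G x) - X x))\<^sup>2" by (simp add: abs_le_square_iff[symmetric])
      then show ?thesis using True by (simp add: G_def)
    next
      case False
      then have "e i j x = 0" using M(2)[of x i j] M(2)[of x j i] fout[of x] by (simp add: e_def)
      then show ?thesis by simp
    qed
  qed
  have enn: "(\<integral>\<^sup>+x. ennreal ((e i j x)\<^sup>2) \<partial>lborel) \<le> ennreal (s ^ 4)" for i j
  proof -
    have m: "(\<lambda>x. ennreal ((e i j x)\<^sup>2)) \<in> borel_measurable lborel" using em[of i j] by simp
    have "(\<integral>\<^sup>+x. ennreal ((e i j x)\<^sup>2) \<partial>lborel) = (\<integral>\<^sup>+x. ennreal ((e i j x)\<^sup>2) \<partial>lebesgue)"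
      by (rule nn_integral_completion[symmetric])
    also have "\<dots> \<le> (\<integral>\<^sup>+x\<in>unit_cube. ennreal ((norm (sym_part (weak_gradient u x) - X x))\<^sup>2) \<partial>lebesgue)"
      unfolding cube
    proof (rule nn_integral_mono_AE)
      show "AE x in lebesgue. ennreal ((e i j x)\<^sup>2) \<le> ennreal ((norm (sym_part (weak_gradient u x) - X x))\<^sup>2) * indicator (box 0 1) x"
        using ele[of i j] by eventually_elim (auto simp: indicator_def split: if_splits intro: ennreal_leI)
    qed
    finally show ?thesis using elastic by (rule order_trans)
  qed
  have ei: "integrable lborel (\<lambda>x. (e i j x)\<^sup>2)" for i j
  proof (rule integrableI_bounded)
    show "(\<integral>\<^sup>+x. ennreal (norm ((e i j x)\<^sup>2)) \<partial>lborel) < \<infinity>" using enn[of i j] by (simp add: le_less_trans)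
  qed (use em[of i j] in simp)
  have eD: "nsq (e i j) \<le> s ^ 4" for i j
    using enn[of i j] nn_integral_eq_integral[OF ei[of i j]] by (simp add: ennreal_le_iff s less_imp_le)
  have weak: "(\<integral>x. v i x * partial_deriv j \<phi> x \<partial>lborel) = - (\<integral>x. M i j x * \<phi> x \<partial>lborel)" if \<phi>: "test_fun \<phi>" for \<phi> i j
  proof -
    note d = test_fun_partial_deriv[OF \<phi>, of j]
    have bm: "partial_deriv j \<phi> \<in> borel_measurable borel" "\<phi> \<in> borel_measurable borel"
      using Ck_continuous[OF test_fun_Ck[OF d, of 0]] Ck_continuous[OF test_fun_Ck[OF \<phi>, of 0]]
      by (auto intro: borel_measurable_continuous_onI)
    have "(\<integral>x. w x $ i * partial_deriv j \<phi> x \<partial>lebesgue) = (\<integral>x. v i x * partial_deriv j \<phi> x \<partial>lborel)"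
      by (rule integral_representative[OF v(1) wv bm(1) L1_loc_integrable_test(1)[OF d L(1)]])
    moreover have "(\<integral>x. H x $ i $ j * \<phi> x \<partial>lebesgue) = (\<integral>x. M i j x * \<phi> x \<partial>lborel)"
      by (rule integral_representative[OF M(1) HM bm(2) L1_loc_integrable_test(2)[OF \<phi> L(2)]])
    ultimately show ?thesis using wH \<phi> by (simp add: has_weak_gradient_def)
  qed
  have bv: "av (\<lambda>x. f i (x + a) - f i (x + b)) \<le> zeta_bound TYPE(3) * norm (a - b) * T"
    if ab: "\<And>l. \<bar>a $ l\<bar> \<le> 1/8" "\<And>l. \<bar>b $ l\<bar> \<le> 1/8" for i a b
  proof -
    define V where "V j = total_variation (box 0 1) (indicator {x. X x = [A0, A1, A2] ! j} :: real^3 \<Rightarrow> real)" for j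
    have "(\<Sum>j=1..<3. V j) = V 1 + V 2" by (simp add: numeral_3_eq_3 numeral_2_eq_2 sum.atLeast_Suc_lessThan)
    then have V: "V 1 + V 2 \<le> ennreal T" using tv(1) by (simp add: V_def cube phase_def)
    then have "V 1 < \<infinity>" "V 2 < \<infinity>"
      using le_less_trans[OF order_trans[OF _ V] ennreal_less_top] by (auto simp: infinity_ennreal_def)
    then obtain T1 T2 where T12: "V 1 = ennreal T1" "0 \<le> T1" "V 2 = ennreal T2" "0 \<le> T2"
      by (auto simp: less_top_ennreal)
    have T12': "T1 + T2 \<le> T" using V T12 tv(2) by (simp add: ennreal_plus[symmetric] ennreal_le_iff del: ennreal_plus)
    have q1: "av (\<lambda>x. indicator Y1 (x + a) - indicator Y1 (x + b)) \<le> zeta_bound TYPE(3) * norm (a - b) * T1"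
    proof (rule av_translate_phase[where X="\<lambda>x. X x = A1"])
      show "AE x in lebesgue. x \<in> box 0 1 \<longrightarrow> (x \<in> Y1 \<longleftrightarrow> X x = A1)" using Y1(3) by eventually_elim auto
    qed (use Y1 Y12 T12 Smeas ab in \<open>auto simp: V_def\<close>)
    have q2: "av (\<lambda>x. indicator Y2 (x + a) - indicator Y2 (x + b)) \<le> zeta_bound TYPE(3) * norm (a - b) * T2"
    proof (rule av_translate_phase[where X="\<lambda>x. X x = A2"])
      show "AE x in lebesgue. x \<in> box 0 1 \<longrightarrow> (x \<in> Y2 \<longleftrightarrow> X x = A2)" using Y2(3) by eventually_elim auto
    qed (use Y2 Y12 T12 Smeas ab in \<open>auto simp: V_def\<close>)
    have iY: "integrable lborel (\<lambda>x. indicator Y (x + a) - indicator Y (x + b) :: real)"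
      if "Y \<in> sets borel" "Y \<subseteq> box 0 1" for Y :: "(real^3) set"
      by (intro Bochner_Integration.integrable_diff integrable_lborel_add integrable_indicator_box that)
    have "av (\<lambda>x. f i (x + a) - f i (x + b)) \<le> av (\<lambda>x. indicator Y1 (x + a) - indicator Y1 (x + b)) + av (\<lambda>x. indicator Y2 (x + a) - indicator Y2 (x + b))"
    proof (rule av_triangle)
      fix x :: "real^3" assume z: "zeta x \<noteq> 0"
      define \<alpha> \<beta> where "\<alpha> = A1 $ i $ i - A0 $ i $ i" and "\<beta> = A2 $ i $ i - A0 $ i $ i"
      \<comment> \<open>On the cube \<open>f i\<close> is affine in the indicators of
        \<open>Y1\<close> and \<open>Y2\<close>, with coefficients of size at most 1. Its increments
        are therefore dominated by those of the two phases, and their variations add up to at most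
        \<open>T\<close>.\<close>
      have fb: "f i y = A0 $ i $ i - F $ i $ i + \<alpha> * indicator Y1 y + \<beta> * indicator Y2 y" if "y \<in> box 0 1" for y
        using that Y12 by (auto simp: f_def \<alpha>_def \<beta>_def indicator_def)
      have "f i (x + a) - f i (x + b) = \<alpha> * (indicator Y1 (x + a) - indicator Y1 (x + b)) + \<beta> * (indicator Y2 (x + a) - indicator Y2 (x + b))"
        using fb[OF zeta_shift_in_box[OF z ab(1)]] fb[OF zeta_shift_in_box[OF z ab(2)]] by (simp add: algebra_simps)
      also have "\<bar>\<dots>\<bar> \<le> \<bar>\<alpha>\<bar> * \<bar>indicator Y1 (x + a) - indicator Y1 (x + b)\<bar> + \<bar>\<beta>\<bar> * \<bar>indicator Y2 (x + a) - indicator Y2 (x + b)\<bar>"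
        using abs_triangle_ineq by (simp add: abs_mult[symmetric])
      also have "\<dots> \<le> 1 * \<bar>indicator Y1 (x + a) - indicator Y1 (x + b)\<bar> + 1 * \<bar>indicator Y2 (x + a) - indicator Y2 (x + b)\<bar>"
        using le1(4,5)[of i] by (intro add_mono mult_right_mono) (auto simp: \<alpha>_def \<beta>_def)
      finally show "\<bar>f i (x + a) - f i (x + b)\<bar> \<le> \<bar>indicator Y1 (x + a) - indicator Y1 (x + b)\<bar> + \<bar>indicator Y2 (x + a) - indicator Y2 (x + b)\<bar>" by simp
    qed (use Y1 Y2 Y12 in \<open>auto intro!: iY\<close>)
    also have "\<dots> \<le> zeta_bound TYPE(3) * norm (a - b) * (T1 + T2)" using q1 q2 by (simp add: distrib_left)
    also have "\<dots> \<le> zeta_bound TYPE(3) * norm (a - b) * T"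
      using T12' zeta_bound(1)[where 'n=3] by (intro mult_left_mono mult_nonneg_nonneg) auto
    finally show ?thesis .
  qed
  have "cube_strain v M f (s ^ 4) T s"
    by unfold_locales (use loc weak ei[unfolded e_def[abs_def]] eD[unfolded e_def[abs_def]] tv(2) s fle bv in auto)
  then show thesis using Y12 by (rule that) (simp add: f_def)
qed

section \<open>Rigidity\<close>

lemma average_lower_bound:
  fixes f g :: "real^'n \<Rightarrow> real"
  assumes "integrable lborel f" "integrable lborel g" "\<And>x. zeta x \<noteq> 0 \<Longrightarrow> m \<le> \<bar>f x\<bar> + \<bar>g x\<bar>" "0 \<le> m"
  shows "m \<le> av f + av g"
proof -
  have "m = av (\<lambda>x :: real^'n. m)"
    using assms(4) by (simp add: av_def zeta_integral)
  also have "\<dots> \<le> av f + av g"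
    by (rule av_triangle[OF assms(1,2)]) (use assms(3,4) in auto)
  finally show ?thesis .
qed

context cube_strain
begin

text \<open>The exponent 6 in the smallness assumptions is explained by
  \<open>(\<eta>\<^sup>2) ^ 3 = \<eta> ^ 6\<close> and \<open>s ^ 3 \<le> s ^ k\<close>.\<close>

lemma small_s:
  assumes "(1 + T) * s ^ k < \<eta> ^ 6" "0 < \<eta>" "\<eta> \<le> 1/16" "0 < k" "k \<le> 3"
  shows "s \<le> \<eta>\<^sup>2"
proof (rule ccontr)
  assume "\<not> s \<le> \<eta>\<^sup>2"
  then have "\<eta>\<^sup>2 < s" by simp
  then have "(\<eta>\<^sup>2) ^ 3 \<le> s ^ 3" by (intro power_mono) auto
  also have "\<dots> \<le> s ^ k" using s_pos s_le assms by (intro power_decreasing) auto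
  also have "\<dots> \<le> (1 + T) * s ^ k" using s_pos T_nonneg by (simp add: distrib_right)
  finally show False using assms(1) by (simp flip: power_mult)
qed

text \<open>Dividing by \<open>1 + T\<close> rather than by \<open>T\<close> keeps the length below
  1/16 also for small perimeter.\<close>

lemma length_scale:
  assumes "0 < \<eta>" "\<eta> \<le> 1/16"
  shows "0 < \<eta> / (1 + T)" "\<eta> / (1 + T) \<le> 1/16" "\<eta> / (1 + T) * T \<le> \<eta>"
proof -
  have le: "\<eta> / (1 + T) \<le> \<eta>" using assms T_nonneg by (simp add: divide_le_eq distrib_left)
  show "0 < \<eta> / (1 + T)" using assms T_nonneg by simp
  show "\<eta> / (1 + T) \<le> 1/16" using le assms by linarith
  show "\<eta> / (1 + T) * T \<le> \<eta>" using assms T_nonneg by (simp add: field_simps)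
qed

lemma small_powers:
  fixes \<eta> :: real
  assumes "0 < \<eta>" "\<eta> \<le> 1/16"
  shows "\<eta>\<^sup>2 \<le> \<eta>" "\<eta> ^ 3 \<le> \<eta>" "\<eta> ^ 4 \<le> \<eta>" "\<eta> ^ 5 \<le> \<eta>" "\<eta> ^ 10 \<le> \<eta>"
  using power_decreasing[of 1 _ \<eta>] assms by auto

lemma s_square_le:
  assumes "s \<le> \<eta>\<^sup>2" "0 < \<eta>" "\<eta> \<le> 1/16" shows "s\<^sup>2 \<le> \<eta>"
proof -
  have "s\<^sup>2 \<le> s" using s_pos s_le by (simp add: power2_eq_square mult_left_le)
  then show ?thesis using assms(1) small_powers(1)[OF assms(2,3)] by linarith
qed

text \<open>With \<open>r = \<eta> / (1 + T)\<close> the elastic term equals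
  \<open>((1 + T) * s)\<^sup>2 / \<eta>\<^sup>2\<close>, which is why the hypothesis has the first
  power of \<open>s\<close>. In the quadratic case below the term is linear in \<open>1 / r\<close>,
  and \<open>(1 + T) * s\<^sup>2\<close> appears.\<close>

lemma rigid_first_order_quartic:
  assumes \<eta>: "0 < \<eta>" "\<eta> \<le> 1/16" "(1 + T) * s < \<eta> ^ 6"
    and ijl: "i \<noteq> j" "i \<noteq> l" "\<And>x. f j x + f l x = 0"
  shows "av (f i) \<le> 2 * (K * \<eta>)"
proof -
  define r where "r = \<eta> / (1 + T)"
  note r = length_scale[OF \<eta>(1,2), folded r_def]
  have "s\<^sup>2 / r\<^sup>2 = ((1 + T) * s)\<^sup>2 / \<eta>\<^sup>2" using T_nonneg by (simp add: r_def power_divide power_mult_distrib)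
  also have "\<dots> \<le> (\<eta> ^ 6)\<^sup>2 / \<eta>\<^sup>2" using \<eta> s_pos T_nonneg by (intro divide_right_mono power_mono) auto
  also have "\<dots> = \<eta> ^ 10" using \<eta>(1) by (simp add: field_simps flip: power_mult power_add)
  also have "\<dots> \<le> \<eta>" using small_powers[OF \<eta>(1,2)] by simp
  finally have q: "s\<^sup>2 / r\<^sup>2 \<le> \<eta>" .
  have "av (f i) \<le> K * (r * T + s\<^sup>2 / r\<^sup>2)" by (rule first_order_quartic[OF r(1,2) ijl])
  also have "\<dots> \<le> K * (\<eta> + \<eta>)" using r(3) q K_bounds(5) by (intro mult_left_mono) auto
  finally show ?thesis by simp
qed

lemma rigid_first_order_quadratic:
  assumes \<eta>: "0 < \<eta>" "\<eta> \<le> 1/16" "(1 + T) * s\<^sup>2 < \<eta> ^ 6"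
    and ij: "i \<noteq> j" "\<And>x. f i x + f j x = 0"
  shows "av (f i) \<le> 2 * (K * \<eta>)"
proof -
  define r where "r = \<eta> / (1 + T)"
  note r = length_scale[OF \<eta>(1,2), folded r_def]
  have "s\<^sup>2 / r = ((1 + T) * s\<^sup>2) / \<eta>" using T_nonneg by (simp add: r_def mult.commute)
  also have "\<dots> \<le> \<eta> ^ 6 / \<eta>" using \<eta> by (intro divide_right_mono) auto
  also have "\<dots> = \<eta> ^ 5" using \<eta>(1) by (simp add: eval_nat_numeral)
  also have "\<dots> \<le> \<eta>" using small_powers[OF \<eta>(1,2)] by simp
  finally have q: "s\<^sup>2 / r \<le> \<eta>" .
  have "av (f i) \<le> K * (r * T + s\<^sup>2 / r)" by (rule first_order_quadratic[OF r(1,2) ij])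
  also have "\<dots> \<le> K * (\<eta> + \<eta>)" using r(3) q K_bounds(5) by (intro mult_left_mono) auto
  finally show ?thesis by simp
qed

text \<open>The transversal error of both second order cases once \<open>H\<close> has been
  inserted.\<close>

lemma cubic_quotient:
  assumes \<eta>: "0 < \<eta>" "\<eta> \<le> 1/16" "(1 + T) * s ^ 3 < \<eta> ^ 6"
  shows "s ^ 3 / \<eta> / (\<eta> / (1 + T)) \<le> \<eta>"
proof -
  have "s ^ 3 / \<eta> / (\<eta> / (1 + T)) = ((1 + T) * s ^ 3) / \<eta>\<^sup>2" by (simp add: power2_eq_square mult.commute)
  also have "\<dots> \<le> \<eta> ^ 6 / \<eta>\<^sup>2" using \<eta> by (intro divide_right_mono) auto
  also have "\<dots> = \<eta> ^ 4" using \<eta>(1) by (simp add: eval_nat_numeral)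
  also have "\<dots> \<le> \<eta>" using small_powers[OF \<eta>(1,2)] by simp
  finally show ?thesis .
qed

text \<open>The mollification length transversal to the finest oscillations is chosen so that the
  coarse oscillation is just not resolved by the elastic energy.\<close>

lemma rigid_second_order_quartic:
  assumes \<eta>: "0 < \<eta>" "\<eta> \<le> 1/16" "(1 + T) * s ^ 3 < \<eta> ^ 6"
    and ijl: "i \<noteq> j" "i \<noteq> l" "j \<noteq> l" "UNIV = {i, j, l}" and cancel: "\<And>x. f j x + f l x = 0"
    and lip: "\<And>x y. x \<in> box 0 1 \<Longrightarrow> y \<in> box 0 1 \<Longrightarrow> \<bar>f j x - f j y\<bar> \<le> 4 * \<bar>f i x - f i y\<bar>"
  shows "av (f j) \<le> 4 * (K * \<eta>)"
proof -
  define r H where "r = \<eta> / (1 + T)" and "H = s\<^sup>2 / \<eta>"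
  note r = length_scale[OF \<eta>(1,2), folded r_def]
  have s2: "s \<le> \<eta>\<^sup>2" by (rule small_s[OF \<eta>(3,1,2)]) auto
  have "s\<^sup>2 \<le> (\<eta>\<^sup>2)\<^sup>2" using s2 s_pos by (intro power_mono) auto
  then have "H \<le> (\<eta>\<^sup>2)\<^sup>2 / \<eta>" unfolding H_def using \<eta> by (intro divide_right_mono) auto
  also have "\<dots> = \<eta> ^ 3" using \<eta>(1) by (simp add: eval_nat_numeral)
  also have "\<dots> \<le> 1/16" using small_powers[OF \<eta>(1,2)] \<eta>(2) by linarith
  finally have H: "0 < H" "H \<le> 1/16" using s_pos \<eta> by (auto simp: H_def)
  have 1: "H * s / r \<le> \<eta>" using cubic_quotient[OF \<eta>] by (simp add: H_def r_def power2_eq_square power3_eq_cube)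
  have 2: "s\<^sup>2 / H = \<eta>" using s_pos \<eta> by (simp add: H_def)
  have "av (f j) \<le> K * (r * T + H * s / r + s\<^sup>2 + s\<^sup>2 / H)"
    by (rule second_order_quartic[OF r(1,2) H ijl cancel lip])
  also have "\<dots> \<le> K * (\<eta> + \<eta> + \<eta> + \<eta>)"
    using r(3) 1 2 s_square_le[OF s2 \<eta>(1,2)] K_bounds(5) by (intro mult_left_mono) auto
  finally show ?thesis by simp
qed

text \<open>Here the coarse entry obeys the bound \<open>s\<^sup>2 / H\<^sup>2\<close>, so
  \<open>H\<close> of order \<open>s\<close> is enough, and \<open>H * s\<^sup>2 / r\<close> is
  again cubic in \<open>s\<close>.\<close>

lemma rigid_second_order_quadratic:
  assumes \<eta>: "0 < \<eta>" "\<eta> \<le> 1/16" "(1 + T) * s ^ 3 < \<eta> ^ 6"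
    and ijl: "i \<noteq> j" "i \<noteq> l" and cancel: "\<And>x. f j x + f l x = 0"
    and lip: "\<And>x y. x \<in> box 0 1 \<Longrightarrow> y \<in> box 0 1 \<Longrightarrow> \<bar>f i x - f i y\<bar> \<le> 4 * \<bar>f j x - f j y\<bar>"
    and N3: "CARD('n) = 3"
  shows "av (f i) \<le> 4 * (K * \<eta>)"
proof -
  define r H where "r = \<eta> / (1 + T)" and "H = s / \<eta>"
  note r = length_scale[OF \<eta>(1,2), folded r_def]
  have s2: "s \<le> \<eta>\<^sup>2" by (rule small_s[OF \<eta>(3,1,2)]) auto
  then have "H \<le> \<eta>\<^sup>2 / \<eta>" unfolding H_def using \<eta> by (intro divide_right_mono) auto
  then have "H \<le> \<eta>" using \<eta>(1) by (simp add: power2_eq_square)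
  then have H: "H \<le> 1/16" using \<eta>(2) by linarith
  have H0: "0 < H" using s_pos \<eta> by (simp add: H_def)
  have 1: "H * s\<^sup>2 / r \<le> \<eta>" using cubic_quotient[OF \<eta>] by (simp add: H_def r_def power2_eq_square power3_eq_cube)
  have "s\<^sup>2 / H\<^sup>2 = \<eta>\<^sup>2" using s_pos \<eta> by (simp add: H_def power_divide)
  then have 2: "s\<^sup>2 / H\<^sup>2 \<le> \<eta>" using small_powers[OF \<eta>(1,2)] by simp
  have "av (f i) \<le> K * (r * T + H * s\<^sup>2 / r + s\<^sup>2 + s\<^sup>2 / H\<^sup>2)"
    by (rule second_order_quadratic[OF r(1,2) H0 H ijl cancel lip N3])
  also have "\<dots> \<le> K * (\<eta> + \<eta> + \<eta> + \<eta>)"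
    using r(3) 1 2 s_square_le[OF s2 \<eta>(1,2)] K_bounds(5) by (intro mult_left_mono) auto
  finally show ?thesis by simp
qed

end

section \<open>The passage to scaling laws\<close>

text \<open>A pointwise substitute for Hoelder's inequality: below the threshold \<open>l\<close>
  the first term suffices, above it the exponent \<open>2 - p\<close> is at most 0 and
  \<open>a powr (2 - p)\<close> is largest at \<open>l\<close>.\<close>

lemma square_le_powr:
  fixes a l p :: real
  assumes "0 \<le> a" "0 < l" "2 \<le> p"
  shows "a\<^sup>2 \<le> l\<^sup>2 + l powr (2 - p) * a powr p"
proof (cases "a \<le> l")
  case True
  then have "a\<^sup>2 \<le> l\<^sup>2" using assms by (intro power_mono) auto
  then show ?thesis by (simp add: add_increasing2)
next
  case False
  then have a: "0 < a" "l \<le> a" using assms by auto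
  have "a\<^sup>2 = a powr (2 - p) * a powr p" using a by (simp flip: powr_add)
  also have "\<dots> \<le> l powr (2 - p) * a powr p"
    using a assms by (intro mult_right_mono powr_mono2') auto
  finally show ?thesis by (simp add: add_increasing)
qed

lemma continuous_sym_part: "continuous_on UNIV (sym_part :: real^'n^'n \<Rightarrow> real^'n^'n)"
  unfolding sym_part_def[abs_def] transpose_def by (intro continuous_intros)

text \<open>The function \<open>weak_gradient u\<close> is a chosen representative whose
  measurability is known only through integrability on compact sets; hence the cutoff to the closure
  of the bounded set \<open>\<Omega>\<close>.\<close>

lemma elastic_energy_measurable:
  fixes X :: "real^'n \<Rightarrow> real^'n^'n"
  assumes u: "u \<in> W1p_loc p" and X: "set_integrable lebesgue \<Omega> X" and \<Omega>: "\<Omega> \<in> sets borel" "bounded \<Omega>"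
  shows "(\<lambda>x. ennreal (norm (sym_part (weak_gradient u x) - X x) powr p) * indicator \<Omega> x) \<in> borel_measurable lebesgue"
proof -
  define G where "G = weak_gradient u"
  have "\<exists>G. has_weak_gradient u G" using u by (auto simp: W1p_loc_def)
  then have "has_weak_gradient u G" unfolding G_def weak_gradient_def by (rule someI_ex)
  then have "set_integrable lebesgue (closure \<Omega>) G"
    using \<Omega>(2) by (auto simp: has_weak_gradient_def L1_loc_def)
  then have G: "(\<lambda>x. indicator (closure \<Omega>) x *\<^sub>R G x) \<in> borel_measurable lebesgue"
    by (auto simp: set_integrable_def)
  have X': "(\<lambda>x. indicator \<Omega> x *\<^sub>R X x) \<in> borel_measurable lebesgue" using X by (auto simp: set_integrable_def)
  have sp: "(sym_part :: real^'n^'n \<Rightarrow> real^'n^'n) \<in> borel_measurable borel"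
    by (rule borel_measurable_continuous_onI[OF continuous_sym_part])
  have Om: "\<Omega> \<in> sets lebesgue" using \<Omega>(1) by simp
  have "(\<lambda>x. ennreal (norm (sym_part (indicator (closure \<Omega>) x *\<^sub>R G x) - indicator \<Omega> x *\<^sub>R X x) powr p) * indicator \<Omega> x) \<in> borel_measurable lebesgue"
    using measurable_compose[OF G sp] X' Om by measurable
  moreover have "ennreal (norm (sym_part (indicator (closure \<Omega>) x *\<^sub>R G x) - indicator \<Omega> x *\<^sub>R X x) powr p) * indicator \<Omega> x =
     ennreal (norm (sym_part (weak_gradient u x) - X x) powr p) * indicator \<Omega> x" for x
    using closure_subset[of \<Omega>] by (auto simp: indicator_def G_def)
  ultimately show ?thesis by simp
qed

lemma emeasure_unit_cube: "emeasure lebesgue unit_cube = 1"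
proof -
  have "emeasure lborel (box 0 (1 :: real^3)) = 1"
    by (subst emeasure_lborel_box) (auto simp: Basis_vec_axis inner_axis intro!: prod.neutral)
  then show ?thesis by (simp add: unit_cube_eq)
qed

text \<open>Either the elastic part already reaches \<open>a * \<epsilon> powr \<theta>\<close>, or
  it is so small that \<open>s ^ k \<le> 2 * \<epsilon> powr (1 - \<theta>)\<close> for an
  admissible \<open>s\<close>. In the second case rigidity makes \<open>T\<close> large, and
  \<open>\<epsilon> * T\<close> is at least
  \<open>\<kappa> / 4 * \<epsilon> powr \<theta>\<close>.\<close>

lemma energy_scaling:
  fixes A :: "(real^3^3) list" and k :: nat
  assumes p: "2 \<le> p" and k: "0 < k" "k \<le> 3" and \<kappa>: "0 < \<kappa>" "\<kappa> \<le> 1" and A: "length A = 3"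
    and rigid: "\<And>s T. admissible p A unit_cube F s T \<Longrightarrow> \<kappa> \<le> (1 + T) * s ^ k"
  shows "\<exists>c>0. \<forall>\<epsilon>. 0 < \<epsilon> \<and> \<epsilon> < 1 \<longrightarrow> ennreal (c * \<epsilon> powr (2 * p / (2 * p + real k))) \<le> min_energy p \<epsilon> unit_cube A F"
proof -
  define \<theta> where "\<theta> = 2 * p / (2 * p + real k)"
  \<comment> \<open>Chosen so that \<open>m \<le> a\<close> implies
    \<open>s \<le> \<kappa> / 2\<close>; then the summand \<open>s ^ k\<close> of
    \<open>(1 + T) * s ^ k\<close> uses up at most half of \<open>\<kappa>\<close>.\<close>
  define a where "a = ((\<kappa> / 2) ^ 4 / 2) powr (p / 2)"
  have \<theta>: "0 < \<theta>" using p k by (simp add: \<theta>_def)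
  have "(\<kappa> / 2) ^ 4 \<le> 1 ^ 4" using \<kappa> by (intro power_mono) auto
  then have a: "0 < a" "a \<le> 1" using \<kappa> p by (auto simp: a_def intro!: powr_le1)
  define c where "c = min a (\<kappa> / 4)"
  have c: "0 < c" "c \<le> a" "c \<le> \<kappa> / 4" using a \<kappa> by (auto simp: c_def)
  have "ennreal (c * \<epsilon> powr \<theta>) \<le> energy p \<epsilon> unit_cube A u X"
    if \<epsilon>: "0 < \<epsilon>" "\<epsilon> < 1" and X: "X \<in> BV_into unit_cube (set A)" and u: "u \<in> dirichlet_class p unit_cube F" for \<epsilon> X u
  proof -
    define EL where "EL = (\<integral>\<^sup>+ x\<in>unit_cube. ennreal (norm (sym_part (weak_gradient u x) - X x) powr p) \<partial>lebesgue)"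
    define S where "S = (\<Sum>j=1..<3. total_variation unit_cube (phase A X j))"
    have E: "energy p \<epsilon> unit_cube A u X = EL + ennreal \<epsilon> * S" by (simp add: energy_def EL_def S_def A)
    have e\<theta>: "0 < \<epsilon> powr \<theta>" "\<epsilon> powr \<theta> \<le> 1" using \<epsilon> \<theta> by (auto intro!: powr_le1)
    define m where "m = a * \<epsilon> powr \<theta>"
    have m: "0 < m" "m \<le> a" "m \<le> \<epsilon> powr \<theta>" using a e\<theta> by (auto simp: m_def mult_left_le mult_left_le_one_le)
    show ?thesis
    proof (cases "ennreal m \<le> EL")
      case True
      have "ennreal (c * \<epsilon> powr \<theta>) \<le> ennreal m" unfolding m_def using c e\<theta> by (intro ennreal_leI mult_right_mono) auto
      also have "\<dots> \<le> energy p \<epsilon> unit_cube A u X" unfolding E using True by (simp add: add_increasing2)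
      finally show ?thesis .
    next
      case False
      then have EL: "EL \<le> ennreal m" by simp
      show ?thesis
      proof (cases "S = \<infinity>")
        case True
        then show ?thesis using \<epsilon> unfolding E by (simp add: ennreal_mult_top)
      next
        case False
        define T where "T = enn2real S"
        have T: "0 \<le> T" "S = ennreal T" using False by (auto simp: T_def less_top)
        \<comment> \<open>For \<open>l powr p = m\<close> each of the two terms in
          \<open>square_le_powr\<close> integrates to at most \<open>l\<^sup>2\<close> over the cube
          of volume 1; this gives \<open>s ^ 4 = 2 * l\<^sup>2\<close>.\<close>
        define l where "l = m powr (1 / p)"
        have l: "0 < l" using m by (simp add: l_def)
        have lm: "l powr (2 - p) * m = l\<^sup>2"
        proof -
          have "m = l powr p" using m p by (simp add: l_def powr_powr)
          then show ?thesis using l by (simp flip: powr_add)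
        qed
        define s where "s = (2 * l\<^sup>2) powr (1 / 4)"
        have s0: "0 < s" using l by (simp add: s_def)
        have s4: "s ^ 4 = 2 * l\<^sup>2"
        proof -
          have "s ^ 4 = s powr real 4" using powr_realpow[OF s0, of 4] by simp
          also have "\<dots> = (2 * l\<^sup>2) powr (1 / 4 * real 4)" unfolding s_def powr_powr ..
          finally show ?thesis using l by simp
        qed
        have l2: "l\<^sup>2 = m powr (2 / p)"
        proof -
          have "l\<^sup>2 = l powr real 2" using powr_realpow[OF l, of 2] by simp
          also have "\<dots> = m powr (1 / p * real 2)" unfolding l_def powr_powr ..
          finally show ?thesis by simp
        qed
        have "l\<^sup>2 \<le> a powr (2 / p)" unfolding l2 using m p by (intro powr_mono2) auto
        also have "\<dots> = (\<kappa> / 2) ^ 4 / 2" using \<kappa> p by (simp add: a_def powr_powr)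
        finally have "s ^ 4 \<le> (\<kappa> / 2) ^ 4" unfolding s4 by simp
        then have s\<kappa>: "s \<le> \<kappa> / 2" using power_le_imp_le_base[of s 3 "\<kappa> / 2"] \<kappa> by simp
        then have s1: "s \<le> 1" using \<kappa> by simp
        have "(\<integral>\<^sup>+x\<in>unit_cube. ennreal ((norm (sym_part (weak_gradient u x) - X x))\<^sup>2) \<partial>lebesgue)
           \<le> (\<integral>\<^sup>+x. ennreal (l\<^sup>2) * indicator unit_cube x +
               ennreal (l powr (2 - p)) * (ennreal (norm (sym_part (weak_gradient u x) - X x) powr p) * indicator unit_cube x) \<partial>lebesgue)"
        proof (rule nn_integral_mono)
          fix x
          have "ennreal ((norm (sym_part (weak_gradient u x) - X x))\<^sup>2) \<le>
             ennreal (l\<^sup>2 + l powr (2 - p) * norm (sym_part (weak_gradient u x) - X x) powr p)"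
            by (intro ennreal_leI square_le_powr l p) simp
          then show "ennreal ((norm (sym_part (weak_gradient u x) - X x))\<^sup>2) * indicator unit_cube x \<le>
             ennreal (l\<^sup>2) * indicator unit_cube x + ennreal (l powr (2 - p)) * (ennreal (norm (sym_part (weak_gradient u x) - X x) powr p) * indicator unit_cube x)"
            by (auto simp: indicator_def ennreal_mult')
        qed
        also have "\<dots> = ennreal (l\<^sup>2) + ennreal (l powr (2 - p)) * EL"
        proof -
          have "u \<in> W1p_loc p" "set_integrable lebesgue unit_cube X" using u X by (auto simp: dirichlet_class_def BV_into_def)
          from elastic_energy_measurable[OF this]
          have meas: "(\<lambda>x. ennreal (norm (sym_part (weak_gradient u x) - X x) powr p) * indicator unit_cube x) \<in> borel_measurable lebesgue"
            by (simp add: unit_cube_eq)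
          have cm: "unit_cube \<in> sets lebesgue" by (simp add: unit_cube_eq)
          show ?thesis
            using meas cm by (subst nn_integral_add) (auto simp: nn_integral_cmult nn_integral_cmult_indicator emeasure_unit_cube EL_def)
        qed
        also have "\<dots> \<le> ennreal (l\<^sup>2) + ennreal (l powr (2 - p)) * ennreal m" by (intro add_left_mono mult_left_mono EL) simp
        also have "\<dots> = ennreal (s ^ 4)" using lm m by (simp add: ennreal_mult'[symmetric] s4 ennreal_plus[symmetric] del: ennreal_plus)
        finally have "\<kappa> \<le> (1 + T) * s ^ k"
          using s0 s1 T X u by (intro rigid) (auto simp: admissible_def S_def A)
        moreover have "s ^ k \<le> s" using power_decreasing[of 1 k s] k s0 s1 by simp
        ultimately have Ts: "\<kappa> / 2 \<le> T * s ^ k" using s\<kappa> by (simp add: distrib_right)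
        have "s ^ k \<le> 2 * \<epsilon> powr (1 - \<theta>)"
        proof -
          have "s ^ k = s powr real k" using powr_realpow[OF s0, of k] by simp
          also have "\<dots> = (2 * l\<^sup>2) powr (real k / 4)" by (simp add: s_def powr_powr)
          also have "\<dots> = 2 powr (real k / 4) * m powr (real k / (2 * p))"
            using m p by (simp add: l2 powr_mult powr_powr)
          also have "\<dots> \<le> 2 powr 1 * (\<epsilon> powr \<theta>) powr (real k / (2 * p))"
            using k m p by (intro mult_mono powr_mono powr_mono2) auto
          also have "(\<epsilon> powr \<theta>) powr (real k / (2 * p)) = \<epsilon> powr (1 - \<theta>)"
          proof -
            \<comment> \<open>The exponent \<open>\<theta>\<close> is the solution of exactly this
              equation, which equates the orders of elastic and surface energy.\<close>
            have "\<theta> * (real k / (2 * p)) = 1 - \<theta>" using p k by (simp add: \<theta>_def field_simps)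
            then show ?thesis by (simp add: powr_powr)
          qed
          finally show ?thesis by simp
        qed
        then have "T * s ^ k \<le> T * (2 * \<epsilon> powr (1 - \<theta>))" using T(1) by (rule mult_left_mono)
        with Ts have "\<kappa> / 4 \<le> T * \<epsilon> powr (1 - \<theta>)" by simp
        then have "\<kappa> / 4 * \<epsilon> powr \<theta> \<le> T * \<epsilon> powr (1 - \<theta>) * \<epsilon> powr \<theta>" using e\<theta> by (intro mult_right_mono) auto
        also have "\<dots> = \<epsilon> * T" using \<epsilon> by (simp add: mult.assoc flip: powr_add)
        finally have "c * \<epsilon> powr \<theta> \<le> \<epsilon> * T" using c(3) e\<theta> mult_right_mono[of c "\<kappa> / 4" "\<epsilon> powr \<theta>"] by linarith
        then have "ennreal (c * \<epsilon> powr \<theta>) \<le> ennreal \<epsilon> * S"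
          using \<epsilon> T by (simp add: ennreal_mult'[symmetric] ennreal_leI)
        then show ?thesis unfolding E by (rule add_increasing[OF zero_le])
      qed
    qed
  qed
  then have "\<forall>\<epsilon>. 0 < \<epsilon> \<and> \<epsilon> < 1 \<longrightarrow> ennreal (c * \<epsilon> powr \<theta>) \<le> min_energy p \<epsilon> unit_cube A F"
    unfolding min_energy_def by (auto intro!: INF_greatest)
  then show ?thesis using c(1) unfolding \<theta>_def by blast
qed

section \<open>Laminates of the two sets of wells\<close>

lemma diag_nth: "diag v $ i $ j = (if i = j then v $ i else 0)"
  by (simp add: diag_def)

text \<open>A symmetrized product of two vectors has rank at most two, so in dimension 3 its
  determinant is 0; for a diagonal difference the determinant is the product of the entries.\<close>

lemma compatible_diag_product:
  fixes A B :: "real^3^3"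
  assumes "compatible A B" "\<And>i j. i \<noteq> j \<Longrightarrow> A $ i $ j = B $ i $ j"
  shows "(A $ 1 $ 1 - B $ 1 $ 1) * (A $ 2 $ 2 - B $ 2 $ 2) * (A $ 3 $ 3 - B $ 3 $ 3) = 0"
proof -
  obtain a b where ab: "A - B = sym_outer a b" using assms(1) by (auto simp: compatible_def)
  have e: "A $ i $ j - B $ i $ j = (a $ i * b $ j + b $ i * a $ j) / 2" for i j
    using arg_cong[OF ab, of "\<lambda>M. M $ i $ j"] by (simp add: sym_outer_def outer_def)
  have o: "a $ i * b $ j + b $ i * a $ j = 0" if "i \<noteq> j" for i j
    using e[of i j] assms(2)[OF that] by simp
  have d: "A $ i $ i - B $ i $ i = a $ i * b $ i" for i using e[of i i] by (simp add: mult.commute)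
  have "2 * (a $ 1 * b $ 2 * (a $ 3 * b $ 3) * (a $ 1 * b $ 2)) = 0"
    using o[of 1 2] o[of 1 3] o[of 2 3] by simp algebra
  then have "a $ 1 * b $ 2 = 0 \<or> a $ 3 * b $ 3 = 0" by auto
  then show ?thesis using o[of 1 2] unfolding d by auto
qed

text \<open>Both sets of wells have this geometry: one compatible edge, and a third well that is
  compatible with the line through the edge only at the midpoint. Mixtures of points of the edge
  stay in the edge, so new second order laminates can only join \<open>Z\<close> to the
  midpoint.\<close>

lemma laminates_triangle:
  fixes seg :: "real \<Rightarrow> real^'n^'n"
  assumes aff: "\<And>t a b. t *\<^sub>R seg a + (1 - t) *\<^sub>R seg b = seg (t * a + (1 - t) * b)"
    and comp: "compatible (seg 1) (seg 0)"
    and half: "\<And>t. compatible Z (seg t) \<or> compatible (seg t) Z \<Longrightarrow> t = 1/2"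
  shows "F \<in> laminates {seg 0, seg 1, Z} 1 - {seg 0, seg 1, Z} \<Longrightarrow> \<exists>t. 0 < t \<and> t < 1 \<and> F = seg t"
    and "F \<in> laminates {seg 0, seg 1, Z} 2 - laminates {seg 0, seg 1, Z} 1 \<Longrightarrow>
      \<exists>t. 0 < t \<and> t < 1 \<and> F = t *\<^sub>R Z + (1 - t) *\<^sub>R seg (1/2)"
proof -
  let ?K = "{seg 0, seg 1, Z}"
  have ne: "\<not> compatible B B" for B :: "real^'n^'n" by (simp add: compatible_def)
  have nZ: "\<not> compatible Z (seg 0)" "\<not> compatible Z (seg 1)" "\<not> compatible (seg 0) Z" "\<not> compatible (seg 1) Z"
    using half[of 0] half[of 1] by auto
  have one: "\<exists>t. 0 < t \<and> t < 1 \<and> F = seg t" if F: "F \<in> laminates ?K 1 - ?K" for F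
  proof -
    from F obtain t B1 B2 where t: "F = t *\<^sub>R B1 + (1 - t) *\<^sub>R B2" "0 < t" "t < 1" "B1 \<in> ?K" "B2 \<in> ?K" "compatible B1 B2"
      by auto
    from t(4,5,6) have "B1 = seg 0 \<and> B2 = seg 1 \<or> B1 = seg 1 \<and> B2 = seg 0"
      using ne[of Z] ne[of "seg 0"] ne[of "seg 1"] nZ by blast
    then show ?thesis
    proof
      assume "B1 = seg 0 \<and> B2 = seg 1"
      then have "F = seg (1 - t)" using t(1) aff[of t 0 1] by simp
      then show ?thesis using t by (intro exI[of _ "1 - t"]) auto
    next
      assume "B1 = seg 1 \<and> B2 = seg 0"
      then have "F = seg t" using t(1) aff[of t 1 0] by simp
      then show ?thesis using t by blast
    qed
  qed
  then show "F \<in> laminates ?K 1 - ?K \<Longrightarrow> \<exists>t. 0 < t \<and> t < 1 \<and> F = seg t" .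
  have seg: "seg t \<in> laminates ?K 1" if t: "0 \<le> t" "t \<le> 1" for t
  proof -
    consider "t = 0" | "t = 1" | "0 < t" "t < 1" using t unfolding le_less by blast
    then show ?thesis
    proof cases
      case 3
      have "seg t = t *\<^sub>R seg 1 + (1 - t) *\<^sub>R seg 0" using aff[of t 1 0] by simp
      then show ?thesis using 3 comp by auto
    qed auto
  qed
  have L1: "(\<exists>t. 0 \<le> t \<and> t \<le> 1 \<and> B = seg t) \<or> B = Z" if "B \<in> laminates ?K 1" for B
  proof (cases "B \<in> ?K")
    case True
    moreover have "0 \<le> (0::real)" "0 \<le> (1::real)" "(1::real) \<le> 1" by simp_all
    ultimately show ?thesis by blast
  next
    case False
    then show ?thesis using one[of B] that less_imp_le by blast
  qed
  assume F: "F \<in> laminates ?K 2 - laminates ?K 1"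
  then obtain t B1 B2 where t: "F = t *\<^sub>R B1 + (1 - t) *\<^sub>R B2" "0 < t" "t < 1"
    "B1 \<in> laminates ?K 1" "B2 \<in> laminates ?K 1" "compatible B1 B2"
    using laminates.simps(2)[of ?K 1] unfolding Suc_1 by blast
  from L1[OF t(4)] L1[OF t(5)]
  consider a b where "0 \<le> a" "a \<le> 1" "0 \<le> b" "b \<le> 1" "B1 = seg a" "B2 = seg b"
    | a where "B1 = seg a" "B2 = Z" | b where "B1 = Z" "B2 = seg b" | "B1 = Z" "B2 = Z" by blast
  then show "\<exists>t. 0 < t \<and> t < 1 \<and> F = t *\<^sub>R Z + (1 - t) *\<^sub>R seg (1/2)"
  proof cases
    case (1 a b)
    have "F = seg (t * a + (1 - t) * b)" using 1 t(1) aff by simp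
    moreover have "0 \<le> t * a + (1 - t) * b" using 1 t(2,3) by simp
    moreover have "t * a + (1 - t) * b \<le> t * 1 + (1 - t) * 1" using 1 t(2,3) by (intro add_mono mult_left_mono) auto
    ultimately have "F \<in> laminates ?K 1" using seg by simp
    with F show ?thesis by blast
  next
    case (2 a)
    then have a: "a = 1/2" using half[of a] t(6) by blast
    have "F = (1 - t) *\<^sub>R Z + (1 - (1 - t)) *\<^sub>R seg (1/2)" unfolding t(1) 2 a by (simp add: add.commute)
    then show ?thesis using t(2,3) by (intro exI[of _ "1 - t"]) simp
  next
    case (3 b)
    then have "b = 1/2" using half[of b] t(6) by blast
    then show ?thesis using t(1,2,3) 3 by blast
  next
    case 4
    then show ?thesis using t(6) ne by blast
  qed
qed

text \<open>The constant \<open>K\<close> of \<open>cube_strain\<close> in dimension 3, stated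
  outside the locale so that \<open>\<eta>\<close> can be fixed before a competitor is
  given.\<close>

definition rigidity_const :: real where
  "rigidity_const = 100 * zeta_bound TYPE(3) ^ 2 * mol_const TYPE(3) * real CARD(3) * (1 + 1 / mol_low TYPE(3))"

lemma rigidity_const_pos: "0 < rigidity_const"
  using zeta_bound(1)[where 'n=3] mol_const_ge(1)[where 'n=3] mol_low(1)[where 'n=3]
  unfolding rigidity_const_def by (intro mult_pos_pos zero_less_power) (auto intro: add_pos_pos)

lemma forall_3I: "P 1 \<Longrightarrow> P 2 \<Longrightarrow> P 3 \<Longrightarrow> P (i :: 3)"
  using forall_3[of P] by blast

text \<open>The number \<open>\<eta>\<close> depends only on \<open>m\<close> and is so small that
  the conclusion of \<open>main\<close> is false. Hence \<open>(1 + T) * s ^ k\<close> is at least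
  \<open>\<eta> ^ 6\<close>, which is the \<open>\<kappa>\<close> of
  \<open>energy_scaling\<close>.\<close>

lemma scaling_from_average:
  fixes A :: "(real^3^3) list" and k :: nat
  assumes p: "2 \<le> p" and k: "0 < k" "k \<le> 3" and A: "length A = 3" and m: "0 < m"
    and main: "\<And>s T \<eta>. admissible p A unit_cube F s T \<Longrightarrow>
      0 < \<eta> \<Longrightarrow> \<eta> \<le> 1/16 \<Longrightarrow> (1 + T) * s ^ k < \<eta> ^ 6 \<Longrightarrow> m \<le> 4 * (rigidity_const * \<eta>)"
  shows "\<exists>c>0. \<forall>\<epsilon>. 0 < \<epsilon> \<and> \<epsilon> < 1 \<longrightarrow> ennreal (c * \<epsilon> powr (2 * p / (2 * p + real k))) \<le> min_energy p \<epsilon> unit_cube A F"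
proof -
  define \<eta> where "\<eta> = min (1/16) (m / (8 * rigidity_const))"
  have \<eta>: "0 < \<eta>" "\<eta> \<le> 1/16" "\<eta> \<le> m / (8 * rigidity_const)" using m rigidity_const_pos by (auto simp: \<eta>_def)
  have "rigidity_const * \<eta> \<le> m / 8" using \<eta>(3) rigidity_const_pos by (simp add: field_simps)
  then have lt: "4 * (rigidity_const * \<eta>) < m" using m by linarith
  have "\<eta> ^ 6 \<le> 1 ^ 6" using \<eta> by (intro power_mono) auto
  then have \<kappa>: "0 < \<eta> ^ 6" "\<eta> ^ 6 \<le> 1" using \<eta>(1) by simp_all
  show ?thesis
  proof (rule energy_scaling[OF p k \<kappa> A])
    fix s T assume "admissible p A unit_cube F s T"
    note * = main[OF this \<eta>(1,2)]
    show "\<eta> ^ 6 \<le> (1 + T) * s ^ k"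
    proof (rule ccontr)
      assume "\<not> \<eta> ^ 6 \<le> (1 + T) * s ^ k"
      with * have "m \<le> 4 * (rigidity_const * \<eta>)" by (simp only: not_le)
      with lt show False by linarith
    qed
  qed
qed

lemma diag_vector_entries:
  "diag (vector [a, b, c] :: real^3) $ 1 $ 1 = a" "diag (vector [a, b, c] :: real^3) $ 2 $ 2 = b"
  "diag (vector [a, b, c] :: real^3) $ 3 $ 3 = c"
  by (simp_all add: diag_nth)

lemma diag_vector_offdiag: "i \<noteq> j \<Longrightarrow> diag v $ i $ j = 0"
  by (simp add: diag_nth)

lemma diag_vector_eq_iff:
  "diag (vector [a, b, c] :: real^3) = diag (vector [a', b', c']) \<longleftrightarrow> a = a' \<and> b = b' \<and> c = c'"
  using diag_vector_entries by metis

lemma diag_combination: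
  "t *\<^sub>R diag (vector [a, b, c] :: real^3) + r *\<^sub>R diag (vector [a', b', c'])
    = diag (vector [t * a + r * a', t * b + r * b', t * c + r * c'])"
  by (simp add: vec_eq_iff forall_3 diag_nth)

text \<open>The datum covers both orders of lamination: \<open>b = 0\<close> describes the edge,
  \<open>a = 1/2\<close> the segment from its midpoint to the third well.\<close>

lemma strain_212:
  assumes "admissible p K212 unit_cube (diag (vector [a, b, - b])) s T" "0 \<le> a" "a \<le> 1" "0 \<le> b" "b \<le> 1"
  obtains v M and f :: "3 \<Rightarrow> real^3 \<Rightarrow> real" and Y1 Y2 where "cube_strain v M f (s ^ 4) T s" "Y1 \<inter> Y2 = {}" "Y1 \<subseteq> box 0 1" "Y2 \<subseteq> box 0 1"
    "\<And>x. f 1 x = (if x \<in> Y1 then 1 - a else if x \<in> Y2 then 1/2 - a else if x \<in> box 0 1 then - a else 0)"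
    "\<And>x. f 2 x = (if x \<in> Y1 then - b else if x \<in> Y2 then 1 - b else if x \<in> box 0 1 then - b else 0)"
    "\<And>x. f 3 x = - f 2 x"
  by (rule energy_cube_strain[OF _ _ _ _ _ _ _ _ _ _ _ _ assms(1)[unfolded K212_def]])
    (use assms(2-) in \<open>auto simp: diag_vector_eq_iff diag_vector_offdiag diag_vector_entries intro: forall_3I\<close>)

lemma strain_221:
  assumes "admissible p K221 unit_cube (diag (vector [a, - a, b])) s T" "0 \<le> a" "a \<le> 1" "0 \<le> b" "b \<le> 1"
  obtains v M and f :: "3 \<Rightarrow> real^3 \<Rightarrow> real" and Y1 Y2 where "cube_strain v M f (s ^ 4) T s" "Y1 \<inter> Y2 = {}" "Y1 \<subseteq> box 0 1" "Y2 \<subseteq> box 0 1"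
    "\<And>x. f 1 x = (if x \<in> Y1 then 1 - a else if x \<in> Y2 then 1/2 - a else if x \<in> box 0 1 then - a else 0)"
    "\<And>x. f 2 x = - f 1 x"
    "\<And>x. f 3 x = (if x \<in> Y1 then - b else if x \<in> Y2 then 1 - b else if x \<in> box 0 1 then - b else 0)"
  by (rule energy_cube_strain[OF _ _ _ _ _ _ _ _ _ _ _ _ assms(1)[unfolded K221_def]])
    (use assms(2-) in \<open>auto simp: diag_vector_eq_iff diag_vector_offdiag diag_vector_entries intro: forall_3I\<close>)

text \<open>The entry \<open>f 2\<close> is the indicator of the third phase and cancels with
  \<open>f 3\<close>, so its sign makes it small. Elsewhere in the cube \<open>f 1\<close> equals
  \<open>1 - t\<close> or \<open>- t\<close> and stays away from 0.\<close>

lemma first_order_212: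
  assumes t: "0 < t" "t < 1" and adm: "admissible p K212 unit_cube (diag (vector [t, 0, 0])) s T"
    and \<eta>: "0 < \<eta>" "\<eta> \<le> 1/16" "(1 + T) * s ^ 1 < \<eta> ^ 6"
  shows "min t (1 - t) \<le> 4 * (rigidity_const * \<eta>)"
proof -
  obtain v M and f :: "3 \<Rightarrow> real^3 \<Rightarrow> real" and Y1 Y2 where cs: "cube_strain v M f (s ^ 4) T s" and Y: "Y1 \<inter> Y2 = {}" "Y1 \<subseteq> box 0 1" "Y2 \<subseteq> box 0 1"
    and f: "\<And>x. f 1 x = (if x \<in> Y1 then 1 - t else if x \<in> Y2 then 1/2 - t else if x \<in> box 0 1 then - t else 0)"
      "\<And>x. f 2 x = (if x \<in> Y1 then 0 else if x \<in> Y2 then 1 else 0)" "\<And>x. f 3 x = - f 2 x"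
    by (rule strain_212[of p t 0 s T]) (use adm t in auto)
  interpret cube_strain v M f "s ^ 4" "\<lambda>i j x. (M i j x + M j i x) / 2 - (if i = j then f i x else 0)" T s
    "zeta_bound TYPE(3)" "mol_const TYPE(3)" "real CARD(3)" rigidity_const
    using cs by (simp_all add: rigidity_const_def)
  have f1: "av (f 1) \<le> 2 * (rigidity_const * \<eta>)"
    by (rule rigid_first_order_quartic[OF \<eta>(1,2), where j=2 and l=3]) (use \<eta> in \<open>auto simp: f\<close>)
  have "av (f 2) \<le> rigidity_const * s\<^sup>2"
    by (rule nonneg_small_two_direction[where j=3]) (auto simp: f)
  also have "\<dots> \<le> rigidity_const * \<eta>"
    using s_square_le[OF small_s[OF \<eta>(3,1,2)] \<eta>(1,2)] rigidity_const_pos by (intro mult_left_mono) auto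
  finally have fs: "av (f 2) \<le> rigidity_const * \<eta>" .
  have "min t (1 - t) \<le> av (f 1) + av (f 2)"
    by (rule average_lower_bound[OF integrable_f integrable_f])
       (use t Y zeta_in_box in \<open>auto simp: f\<close>)
  then show ?thesis using f1 fs rigidity_const_pos \<eta>(1) mult_pos_pos[of rigidity_const \<eta>] by linarith
qed

text \<open>Here the oscillating entries \<open>f 1\<close> and \<open>f 2\<close> cancel, which
  gives the two-direction bound. The indicator \<open>f 3\<close> of the third phase has only a
  one-direction bound, but at scale 1 this is equally good.\<close>

lemma first_order_221:
  assumes t: "0 < t" "t < 1" and adm: "admissible p K221 unit_cube (diag (vector [t, - t, 0])) s T"
    and \<eta>: "0 < \<eta>" "\<eta> \<le> 1/16" "(1 + T) * s ^ 2 < \<eta> ^ 6"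
  shows "min t (1 - t) \<le> 4 * (rigidity_const * \<eta>)"
proof -
  obtain v M and f :: "3 \<Rightarrow> real^3 \<Rightarrow> real" and Y1 Y2 where cs: "cube_strain v M f (s ^ 4) T s" and Y: "Y1 \<inter> Y2 = {}" "Y1 \<subseteq> box 0 1" "Y2 \<subseteq> box 0 1"
    and f: "\<And>x. f 1 x = (if x \<in> Y1 then 1 - t else if x \<in> Y2 then 1/2 - t else if x \<in> box 0 1 then - t else 0)"
      "\<And>x. f 2 x = - f 1 x" "\<And>x. f 3 x = (if x \<in> Y1 then 0 else if x \<in> Y2 then 1 else 0)"
    by (rule strain_221[of p t 0 s T]) (use adm t in auto)
  interpret cube_strain v M f "s ^ 4" "\<lambda>i j x. (M i j x + M j i x) / 2 - (if i = j then f i x else 0)" T s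
    "zeta_bound TYPE(3)" "mol_const TYPE(3)" "real CARD(3)" rigidity_const
    using cs by (simp_all add: rigidity_const_def)
  have f1: "av (f 1) \<le> 2 * (rigidity_const * \<eta>)"
    by (rule rigid_first_order_quadratic[OF \<eta>, where j=2]) (use \<eta> in \<open>auto simp: f\<close>)
  have "av (f 3) \<le> rigidity_const * s\<^sup>2"
    by (rule nonneg_small_one_direction[where j=1 and l=2]) (auto simp: f)
  also have "\<dots> \<le> rigidity_const * \<eta>"
    using s_square_le[OF small_s[OF \<eta>(3,1,2)] \<eta>(1,2)] rigidity_const_pos by (intro mult_left_mono) auto
  finally have fs: "av (f 3) \<le> rigidity_const * \<eta>" .
  have "min t (1 - t) \<le> av (f 1) + av (f 3)"
    by (rule average_lower_bound[OF integrable_f integrable_f])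
       (use t Y zeta_in_box in \<open>auto simp: f\<close>)
  then show ?thesis using f1 fs rigidity_const_pos \<eta>(1) mult_pos_pos[of rigidity_const \<eta>] by linarith
qed

text \<open>The fine entry is \<open>f 1\<close>, with one lamination direction; the coarse entry is
  \<open>f 2\<close>, whose modulus is at least \<open>min t (1 - t)\<close> at every point of the
  cube.\<close>

lemma second_order_212:
  assumes t: "0 < t" "t < 1" and adm: "admissible p K212 unit_cube (diag (vector [1/2, t, - t])) s T"
    and \<eta>: "0 < \<eta>" "\<eta> \<le> 1/16" "(1 + T) * s ^ 3 < \<eta> ^ 6"
  shows "min t (1 - t) \<le> 4 * (rigidity_const * \<eta>)"
proof -
  obtain v M and f :: "3 \<Rightarrow> real^3 \<Rightarrow> real" and Y1 Y2 where cs: "cube_strain v M f (s ^ 4) T s" and Y: "Y1 \<inter> Y2 = {}" "Y1 \<subseteq> box 0 1" "Y2 \<subseteq> box 0 1"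
    and f: "\<And>x. f 1 x = (if x \<in> Y1 then 1 - 1/2 else if x \<in> Y2 then 1/2 - 1/2 else if x \<in> box 0 1 then - 1/2 else 0)"
      "\<And>x. f 2 x = (if x \<in> Y1 then - t else if x \<in> Y2 then 1 - t else if x \<in> box 0 1 then - t else 0)" "\<And>x. f 3 x = - f 2 x"
    by (rule strain_212[of p "1/2" t s T]) (use adm t in auto)
  interpret cube_strain v M f "s ^ 4" "\<lambda>i j x. (M i j x + M j i x) / 2 - (if i = j then f i x else 0)" T s
    "zeta_bound TYPE(3)" "mol_const TYPE(3)" "real CARD(3)" rigidity_const
    using cs by (simp_all add: rigidity_const_def)
  have "av (f 2) \<le> 4 * (rigidity_const * \<eta>)"
  proof (rule rigid_second_order_quartic[OF \<eta>, where i=1 and l=3])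
    show "f 2 x + f 3 x = 0" for x by (simp add: f)
    \<comment> \<open>On the cube \<open>f 2 = 1 - t - 4 * (f 1)\<^sup>2\<close>, and this function
      of \<open>f 1\<close> has Lipschitz constant 4 on \<open>[-1/2, 1/2]\<close>.\<close>
    show "\<bar>f 2 x - f 2 y\<bar> \<le> 4 * \<bar>f 1 x - f 1 y\<bar>" if "x \<in> box 0 1" "y \<in> box 0 1" for x y
      using that Y by (simp add: f)
    show "UNIV = {1, 2, 3 :: 3}" by (rule UNIV_3)
  qed simp_all
  moreover have "min t (1 - t) \<le> av (f 2) + av (\<lambda>x :: real^3. 0)"
    by (rule average_lower_bound[OF integrable_f]) (use t zeta_in_box in \<open>auto simp: f\<close>)
  ultimately show ?thesis by (simp add: av_def)
qed

text \<open>The fine entry \<open>f 1\<close> cancels with \<open>f 2\<close> and has two lamination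
  directions, while the coarse entry \<open>f 3\<close> stands alone; so the quadratic variant
  applies.\<close>

lemma second_order_221:
  assumes t: "0 < t" "t < 1" and adm: "admissible p K221 unit_cube (diag (vector [1/2, -1/2, t])) s T"
    and \<eta>: "0 < \<eta>" "\<eta> \<le> 1/16" "(1 + T) * s ^ 3 < \<eta> ^ 6"
  shows "min t (1 - t) \<le> 4 * (rigidity_const * \<eta>)"
proof -
  obtain v M and f :: "3 \<Rightarrow> real^3 \<Rightarrow> real" and Y1 Y2 where cs: "cube_strain v M f (s ^ 4) T s" and Y: "Y1 \<inter> Y2 = {}" "Y1 \<subseteq> box 0 1" "Y2 \<subseteq> box 0 1"
    and f: "\<And>x. f 1 x = (if x \<in> Y1 then 1 - 1/2 else if x \<in> Y2 then 1/2 - 1/2 else if x \<in> box 0 1 then - 1/2 else 0)"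
      "\<And>x. f 2 x = - f 1 x" "\<And>x. f 3 x = (if x \<in> Y1 then - t else if x \<in> Y2 then 1 - t else if x \<in> box 0 1 then - t else 0)"
    by (rule strain_221[of p "1/2" t s T]) (use adm t in auto)
  interpret cube_strain v M f "s ^ 4" "\<lambda>i j x. (M i j x + M j i x) / 2 - (if i = j then f i x else 0)" T s
    "zeta_bound TYPE(3)" "mol_const TYPE(3)" "real CARD(3)" rigidity_const
    using cs by (simp_all add: rigidity_const_def)
  have "av (f 3) \<le> 4 * (rigidity_const * \<eta>)"
  proof (rule rigid_second_order_quadratic[OF \<eta>, where j=1 and l=2])
    show "\<bar>f 3 x - f 3 y\<bar> \<le> 4 * \<bar>f 1 x - f 1 y\<bar>" if "x \<in> box 0 1" "y \<in> box 0 1" for x y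
      using that Y by (simp add: f)
  qed (simp_all add: f)
  moreover have "min t (1 - t) \<le> av (f 3) + av (\<lambda>x :: real^3. 0)"
    by (rule average_lower_bound[OF integrable_f]) (use t zeta_in_box in \<open>auto simp: f\<close>)
  ultimately show ?thesis by (simp add: av_def)
qed

lemma laminates_K212:
  shows "F \<in> laminates (set K212) 1 - set K212 \<Longrightarrow> \<exists>t. 0 < t \<and> t < 1 \<and> F = diag (vector [t, 0, 0])"
    and "F \<in> laminates (set K212) 2 - laminates (set K212) 1 \<Longrightarrow> \<exists>t. 0 < t \<and> t < 1 \<and> F = diag (vector [1/2, t, - t])"
proof -
  define seg where "seg t = diag (vector [t, 0, 0] :: real^3)" for t
  define Z where "Z = diag (vector [1/2, 1, -1] :: real^3)"
  have K: "set K212 = {seg 0, seg 1, Z}" by (simp add: K212_def seg_def Z_def)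
  have aff: "t *\<^sub>R seg a + (1 - t) *\<^sub>R seg b = seg (t * a + (1 - t) * b)" for t a b
    by (simp add: seg_def diag_combination)
  have comp: "compatible (seg 1) (seg 0)"
    unfolding compatible_def
  proof (intro conjI exI)
    show "seg 1 \<noteq> seg 0" by (simp add: seg_def diag_vector_eq_iff)
    show "(vector [1, 0, 0] :: real^3) \<noteq> 0" "(vector [1, 0, 0] :: real^3) \<noteq> 0"
      by (simp_all add: vec_eq_iff forall_3)
    show "seg 1 - seg 0 = sym_outer (vector [1, 0, 0]) (vector [1, 0, 0])"
      by (simp add: seg_def vec_eq_iff forall_3 diag_nth sym_outer_def outer_def)
  qed
  \<comment> \<open>Up to sign the determinant of the difference is
    \<open>(1/2 - t) * 1 * (-1)\<close>.\<close>
  have half: "t = 1/2" if "compatible Z (seg t) \<or> compatible (seg t) Z" for t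
    using that
  proof
    assume "compatible Z (seg t)"
    from compatible_diag_product[OF this] show ?thesis by (simp add: Z_def seg_def diag_vector_entries diag_vector_offdiag)
  next
    assume "compatible (seg t) Z"
    from compatible_diag_product[OF this] show ?thesis by (simp add: Z_def seg_def diag_vector_entries diag_vector_offdiag)
  qed
  show "F \<in> laminates (set K212) 1 - set K212 \<Longrightarrow> \<exists>t. 0 < t \<and> t < 1 \<and> F = diag (vector [t, 0, 0])"
    using laminates_triangle(1)[of seg Z F, OF aff comp half] unfolding K seg_def by blast
  have "t *\<^sub>R Z + (1 - t) *\<^sub>R seg (1/2) = diag (vector [1/2, t, - t])" for t
    unfolding seg_def Z_def diag_combination diag_vector_eq_iff by (simp add: field_simps)
  then show "F \<in> laminates (set K212) 2 - laminates (set K212) 1 \<Longrightarrow> \<exists>t. 0 < t \<and> t < 1 \<and> F = diag (vector [1/2, t, - t])"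
    using laminates_triangle(2)[of seg Z F, OF aff comp half] unfolding K by metis
qed

lemma laminates_K221:
  shows "F \<in> laminates (set K221) 1 - set K221 \<Longrightarrow> \<exists>t. 0 < t \<and> t < 1 \<and> F = diag (vector [t, - t, 0])"
    and "F \<in> laminates (set K221) 2 - laminates (set K221) 1 \<Longrightarrow> \<exists>t. 0 < t \<and> t < 1 \<and> F = diag (vector [1/2, -1/2, t])"
proof -
  define seg where "seg t = diag (vector [t, - t, 0] :: real^3)" for t
  define Z where "Z = diag (vector [1/2, -1/2, 1] :: real^3)"
  have K: "set K221 = {seg 0, seg 1, Z}" by (simp add: K221_def seg_def Z_def)
  have aff: "t *\<^sub>R seg a + (1 - t) *\<^sub>R seg b = seg (t * a + (1 - t) * b)" for t a b
    by (simp add: seg_def diag_combination)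
  have comp: "compatible (seg 1) (seg 0)"
    unfolding compatible_def
  proof (intro conjI exI)
    show "seg 1 \<noteq> seg 0" by (simp add: seg_def diag_vector_eq_iff)
    \<comment> \<open>The factors \<open>e_1 + e_2\<close> and \<open>e_1 - e_2\<close> are the two
      lamination directions of the edge.\<close>
    show "(vector [1, 1, 0] :: real^3) \<noteq> 0" "(vector [1, -1, 0] :: real^3) \<noteq> 0"
      by (simp_all add: vec_eq_iff forall_3)
    show "seg 1 - seg 0 = sym_outer (vector [1, 1, 0]) (vector [1, -1, 0])"
      by (simp add: seg_def vec_eq_iff forall_3 diag_nth sym_outer_def outer_def)
  qed
  \<comment> \<open>Up to sign the determinant of the difference is now
    \<open>(1/2 - t)\<^sup>2\<close>.\<close>
  have half: "t = 1/2" if "compatible Z (seg t) \<or> compatible (seg t) Z" for t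
    using that
  proof
    assume "compatible Z (seg t)"
    from compatible_diag_product[OF this] show ?thesis by (simp add: Z_def seg_def diag_vector_entries diag_vector_offdiag)
  next
    assume "compatible (seg t) Z"
    from compatible_diag_product[OF this] show ?thesis by (simp add: Z_def seg_def diag_vector_entries diag_vector_offdiag)
  qed
  show "F \<in> laminates (set K221) 1 - set K221 \<Longrightarrow> \<exists>t. 0 < t \<and> t < 1 \<and> F = diag (vector [t, - t, 0])"
    using laminates_triangle(1)[of seg Z F, OF aff comp half] unfolding K seg_def by blast
  have "t *\<^sub>R Z + (1 - t) *\<^sub>R seg (1/2) = diag (vector [1/2, -1/2, t])" for t
    unfolding seg_def Z_def diag_combination diag_vector_eq_iff by (simp add: field_simps)
  then show "F \<in> laminates (set K221) 2 - laminates (set K221) 1 \<Longrightarrow> \<exists>t. 0 < t \<and> t < 1 \<and> F = diag (vector [1/2, -1/2, t])"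
    using laminates_triangle(2)[of seg Z F, OF aff comp half] unfolding K by metis
qed

lemma length_wells: "length K212 = 3" "length K221 = 3"
  by (simp_all add: K212_def K221_def)

theorem theorem1p2:
  fixes p :: real
  assumes "2 \<le> p"
  shows
    "(\<forall>F \<in> laminates (set K212) 1 - set K212.
        \<exists>c>0. \<forall>\<epsilon>. 0 < \<epsilon> \<and> \<epsilon> < 1 \<longrightarrow>
          ennreal (c * \<epsilon> powr (2 * p / (2 * p + 1))) \<le> min_energy p \<epsilon> unit_cube K212 F)
     \<and> (\<forall>F \<in> laminates (set K221) 1 - set K221.
        \<exists>c>0. \<forall>\<epsilon>. 0 < \<epsilon> \<and> \<epsilon> < 1 \<longrightarrow>
          ennreal (c * \<epsilon> powr (2 * p / (2 * p + 2))) \<le> min_energy p \<epsilon> unit_cube K221 F)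
     \<and> (\<forall>A \<in> {K212, K221}. \<forall>F \<in> laminates (set A) 2 - laminates (set A) 1.
        \<exists>c>0. \<forall>\<epsilon>. 0 < \<epsilon> \<and> \<epsilon> < 1 \<longrightarrow>
          ennreal (c * \<epsilon> powr (2 * p / (2 * p + 3))) \<le> min_energy p \<epsilon> unit_cube A F)"
proof (intro conjI ballI)
  fix F assume "F \<in> laminates (set K212) 1 - set K212"
  then obtain t where t: "0 < t" "t < 1" "F = diag (vector [t, 0, 0])" using laminates_K212(1) by blast
  have "0 < min t (1 - t)" using t by simp
  from scaling_from_average[OF assms _ _ length_wells(1) this first_order_212[OF t(1,2)], of 1]
  show "\<exists>c>0. \<forall>\<epsilon>. 0 < \<epsilon> \<and> \<epsilon> < 1 \<longrightarrow> ennreal (c * \<epsilon> powr (2 * p / (2 * p + 1))) \<le> min_energy p \<epsilon> unit_cube K212 F"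
    by (simp add: t(3))
next
  fix F assume "F \<in> laminates (set K221) 1 - set K221"
  then obtain t where t: "0 < t" "t < 1" "F = diag (vector [t, - t, 0])" using laminates_K221(1) by blast
  have "0 < min t (1 - t)" using t by simp
  from scaling_from_average[OF assms _ _ length_wells(2) this first_order_221[OF t(1,2)], of 2]
  show "\<exists>c>0. \<forall>\<epsilon>. 0 < \<epsilon> \<and> \<epsilon> < 1 \<longrightarrow> ennreal (c * \<epsilon> powr (2 * p / (2 * p + 2))) \<le> min_energy p \<epsilon> unit_cube K221 F"
    by (simp add: t(3))
next
  fix A F assume "A \<in> {K212, K221}" and F: "F \<in> laminates (set A) 2 - laminates (set A) 1"
  then consider "A = K212" | "A = K221" by blast
  then show "\<exists>c>0. \<forall>\<epsilon>. 0 < \<epsilon> \<and> \<epsilon> < 1 \<longrightarrow> ennreal (c * \<epsilon> powr (2 * p / (2 * p + 3))) \<le> min_energy p \<epsilon> unit_cube A F"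
  proof cases
    case 1
    obtain t where t: "0 < t" "t < 1" "F = diag (vector [1/2, t, - t])" using laminates_K212(2) F 1 by blast
    have "0 < min t (1 - t)" using t by simp
    from scaling_from_average[OF assms _ _ length_wells(1) this second_order_212[OF t(1,2)], of 3] show ?thesis by (simp add: 1 t(3))
  next
    case 2
    obtain t where t: "0 < t" "t < 1" "F = diag (vector [1/2, -1/2, t])" using laminates_K221(2) F 2 by blast
    have "0 < min t (1 - t)" using t by simp
    from scaling_from_average[OF assms _ _ length_wells(2) this second_order_221[OF t(1,2)], of 3] show ?thesis by (simp add: 2 t(3))
  qed
qed

end
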